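(* Let $n,l,g$ be positive integers with $g\ge 3$ and let $p=\lfloor\frac{n-g-gl+l}{l+1}\rfloor$. Then the poset $(\mathcal{U}_{n,l}^{g,1},\preceq)$ has exactly $p+1$ minimal elements, namely $U_{n,l}^{g,0},U_{n,l}^{g,1},\dots,U_{n,l}^{g,p}$.
   Context: For a graph $G$ on $n$ vertices with Laplacian matrix $L(G)=D(G)-A(G)$ (degree matrix minus adjacency matrix), write $\det(\lambda I_n-L(G))=\sum_{k=0}^n(-1)^k c_k(G)\lambda^{n-k}$; the $c_k(G)$ are the Laplacian coefficients. For graphs $G,H$ of order $n$, write $G\preceq H$ if $c_k(G)\le c_k(H)$ for all $0\le k\le n$, and $G\prec H$ if $G\preceq H$ and $c_k(G)<c_k(H)$ for some $k$. A minimal element of a set of graphs (up to isomorphism) is a graph $G$ in the set such that no $H$ in the set satisfies $H\prec G$. A leaf is a vertex of degree $1$. $\mathcal{U}_{n,l}^g$ denotes the set of connected unicyclic graphs with $n$ vertices, exactly $l$ leaves and girth $g$. Every $G\in\mathcal{U}_{n,l}^g$ can be written as $C_{T_1,\dots,T_g}$: it is obtained from the cycle $C_g=u_1u_2\cdots u_g$ by attaching trees $T_1,\dots,T_g$ rooted at $u_1,\dots,u_g$ respectively. $\mathcal{U}_{n,l}^{g,1}$ is the set of $C_{T_1,\dots,T_g}\in\mathcal{U}_{n,l}^g$ with $|V(T_i)|=1$ for $i=2,\dots,g$ (all vertices off the cycle hang from the single cycle vertex $u_1$). The balanced starlike tree $BST_{m,l}$ is the tree of order $m$ with $l$ leaves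 obtained by identifying one end of each of $l$ paths, each of order $\lfloor\frac{m-1}{l}\rfloor+1$ or $\lceil\frac{m-1}{l}\rceil+1$, into a single vertex, called its center. $U_{n,l}^{g,q}$ ($q\ge 0$) is the graph of order $n$ obtained from the cycle $C_g$ and a path $P_{q+1}=w_0w_1\cdots w_q$ by identifying $w_0$ with a vertex $u_1$ of the cycle, and identifying $w_q$ with the center of $BST_{n-q-g+1,l}$ (for $q=0$ the center is identified with $u_1$).
   Formalization: The formal theorem assumes p ≥ 0 (for n=4, g=3, l=1 one has p=-1, yet a minimal element exists), and claims the count p+1 only for l ≥ 2, since for l=1 all the graphs U^{g,q} are isomorphic; the list of minimal elements is proved for every l ≥ 1. *)

theory Defs
  imports "Jordan_Normal_Form.Char_Poly"
begin

section \<open>Finite simple graphs\<close>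

type_synonym 'a ugraph = "'a set \<times> 'a set set"

abbreviation verts :: "'a ugraph \<Rightarrow> 'a set" where "verts \<equiv> fst"
abbreviation edges :: "'a ugraph \<Rightarrow> 'a set set" where "edges \<equiv> snd"

definition simple_graph :: "'a ugraph \<Rightarrow> bool" where
  "simple_graph G \<longleftrightarrow> finite (verts G) \<and> (\<forall>e\<in>edges G. e \<subseteq> verts G \<and> card e = 2)"

definition isomorphic :: "'a ugraph \<Rightarrow> 'b ugraph \<Rightarrow> bool" where
  "isomorphic G H \<longleftrightarrow>
     (\<exists>f. bij_betw f (verts G) (verts H) \<and> edges H = (\<lambda>e. f ` e) ` edges G)"

definition vertex_degree :: "'a ugraph \<Rightarrow> 'a \<Rightarrow> nat" where
  "vertex_degree G v = card {e \<in> edges G. v \<in> e}"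

definition leaves :: "'a ugraph \<Rightarrow> 'a set" where
  "leaves G = {v \<in> verts G. vertex_degree G v = 1}"

definition connected_graph :: "'a ugraph \<Rightarrow> bool" where
  "connected_graph G \<longleftrightarrow> verts G \<noteq> {} \<and>
     (\<forall>u\<in>verts G. \<forall>v\<in>verts G. (u, v) \<in> {(x, y). {x, y} \<in> edges G}\<^sup>*)"

definition path_edges :: "'a list \<Rightarrow> 'a set set" where
  "path_edges vs = {{vs ! i, vs ! Suc i} |i. Suc i < length vs}"

definition cycle_edges :: "'a list \<Rightarrow> 'a set set" where
  "cycle_edges vs = path_edges (vs @ [hd vs])"

definition is_cycle :: "'a ugraph \<Rightarrow> 'a list \<Rightarrow> bool" where
  "is_cycle G vs \<longleftrightarrow> 3 \<le> length vs \<and> distinct vs \<and> cycle_edges vs \<subseteq> edges G"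

definition is_tree :: "'a ugraph \<Rightarrow> bool" where
  "is_tree G \<longleftrightarrow> simple_graph G \<and> connected_graph G \<and> (\<nexists>vs. is_cycle G vs)"

text \<open>A cycle is counted once, as a subgraph: its rotations and reflections
  have the same edge set.\<close>

definition unicyclic :: "'a ugraph \<Rightarrow> bool" where
  "unicyclic G \<longleftrightarrow> (\<exists>!C. \<exists>vs. is_cycle G vs \<and> C = cycle_edges vs)"

text \<open>Unspecified for acyclic graphs.\<close>

definition girth :: "'a ugraph \<Rightarrow> nat" where
  "girth G = (LEAST k. \<exists>vs. is_cycle G vs \<and> length vs = k)"


section \<open>Laplacian coefficients\<close>

text \<open>Graphs of order \<open>n\<close> are taken on the vertex set \<open>{..<n}\<close>, so that vertices
  directly index the rows and columns of the matrices.\<close>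

definition graphs_of_order :: "nat \<Rightarrow> nat ugraph set" where
  "graphs_of_order n = {G. simple_graph G \<and> verts G = {..<n}}"

definition adjacency_matrix :: "nat ugraph \<Rightarrow> real mat" where
  "adjacency_matrix G = mat (card (verts G)) (card (verts G))
     (\<lambda>(i, j). if {i, j} \<in> edges G then 1 else 0)"

definition degree_matrix :: "nat ugraph \<Rightarrow> real mat" where
  "degree_matrix G = mat (card (verts G)) (card (verts G))
     (\<lambda>(i, j). if i = j then real (vertex_degree G i) else 0)"

definition laplacian :: "nat ugraph \<Rightarrow> real mat" where
  "laplacian G = degree_matrix G - adjacency_matrix G"

text \<open>\<open>char_poly A\<close> is the determinant of \<open>x I - A\<close>.\<close>

definition laplacian_coeff :: "nat ugraph \<Rightarrow> nat \<Rightarrow> real" where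
  "laplacian_coeff G k = (- 1) ^ k * coeff (char_poly (laplacian G)) (card (verts G) - k)"

definition lap_le :: "nat ugraph \<Rightarrow> nat ugraph \<Rightarrow> bool"  (infix "\<preceq>" 50) where
  "G \<preceq> H \<longleftrightarrow> card (verts G) = card (verts H) \<and>
     (\<forall>k \<le> card (verts G). laplacian_coeff G k \<le> laplacian_coeff H k)"

definition lap_less :: "nat ugraph \<Rightarrow> nat ugraph \<Rightarrow> bool"  (infix "\<prec>" 50) where
  "G \<prec> H \<longleftrightarrow> G \<preceq> H \<and> (\<exists>k \<le> card (verts G). laplacian_coeff G k < laplacian_coeff H k)"

definition minimal_elements :: "nat ugraph set \<Rightarrow> nat ugraph set" where
  "minimal_elements S = {G \<in> S. \<not> (\<exists>H\<in>S. H \<prec> G)}"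

definition iso_classes :: "'a ugraph set \<Rightarrow> 'a ugraph set set" where
  "iso_classes S = S // {(G, H). G \<in> S \<and> H \<in> S \<and> isomorphic G H}"


section \<open>Unicyclic graphs with given order, number of leaves and girth\<close>

definition unicyclic_graphs :: "nat \<Rightarrow> nat \<Rightarrow> nat \<Rightarrow> nat ugraph set" where
  "unicyclic_graphs n l g = {G \<in> graphs_of_order n.
     connected_graph G \<and> unicyclic G \<and> card (leaves G) = l \<and> girth G = g}"

text \<open>\<open>G\<close> is obtained from the cycle with vertex sequence \<open>us\<close> by attaching, for each \<open>i\<close>,
  the tree \<open>Ts ! i\<close> rooted at \<open>us ! i\<close>.\<close>

definition cycle_with_trees :: "'a list \<Rightarrow> 'a ugraph list \<Rightarrow> 'a ugraph \<Rightarrow> bool" where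
  "cycle_with_trees us Ts G \<longleftrightarrow>
     3 \<le> length us \<and> distinct us \<and> length Ts = length us \<and>
     (\<forall>i < length us. is_tree (Ts ! i) \<and> us ! i \<in> verts (Ts ! i)) \<and>
     (\<forall>i < length us. \<forall>j < length us. i \<noteq> j \<longrightarrow> verts (Ts ! i) \<inter> verts (Ts ! j) = {}) \<and>
     verts G = (\<Union>T\<in>set Ts. verts T) \<and>
     edges G = cycle_edges us \<union> (\<Union>T\<in>set Ts. edges T)"

definition unicyclic_graphs1 :: "nat \<Rightarrow> nat \<Rightarrow> nat \<Rightarrow> nat ugraph set" where
  "unicyclic_graphs1 n l g = {G \<in> unicyclic_graphs n l g.
     \<exists>us Ts. length us = g \<and> cycle_with_trees us Ts G \<and>
       (\<forall>i\<in>{1..<g}. card (verts (Ts ! i)) = 1)}"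


section \<open>The extremal graphs\<close>

text \<open>A copy of the balanced starlike tree of order \<open>m\<close> with center \<open>c\<close>, whose other vertices
  are \<open>s, \<dots>, s + m - 2\<close>. These are dealt to the \<open>l\<close> paths according to their
  residue modulo \<open>l\<close>, so that each path, counted with \<open>c\<close>, has order
  \<open>\<lfloor>(m - 1) / l\<rfloor> + 1\<close> or \<open>\<lceil>(m - 1) / l\<rceil> + 1\<close>.\<close>

definition BST :: "nat \<Rightarrow> nat \<Rightarrow> nat \<Rightarrow> nat \<Rightarrow> nat ugraph" where
  "BST c s m l =
     (insert c {s..<s + (m - 1)},
      \<Union>i<l. path_edges (c # filter (\<lambda>v. (v - s) mod l = i) [s..<s + (m - 1)]))"

text \<open>The cycle is \<open>0, \<dots>, g - 1\<close> with \<open>u\<^sub>1 = 0\<close>; the path is \<open>w\<^sub>0 = 0\<close>,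
  \<open>w\<^sub>i = g + i - 1\<close> for \<open>1 \<le> i \<le> q\<close>. Intended for \<open>g + q \<le> n\<close>, where the subtraction
  in the order of the starlike tree does not truncate.\<close>

definition extremal_graph :: "nat \<Rightarrow> nat \<Rightarrow> nat \<Rightarrow> nat \<Rightarrow> nat ugraph" where
  "extremal_graph n l g q =
     (let ws = 0 # [g..<g + q];
          B = BST (last ws) (g + q) (n + 1 - (q + g)) l
      in ({..<g} \<union> set ws \<union> verts B,
          cycle_edges [0..<g] \<union> path_edges ws \<union> edges B))"

end

theory Submission
  imports Defs
begin

text \<open>Write \<open>det (x I + L) = x (e + b)\<close>, where \<open>b\<close> is the minor at a root vertex. The coefficients of
  \<open>e + b\<close> are the Laplacian coefficients, and the pair \<open>(e, b)\<close> behaves well under gluing rooted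
  graphs: \<open>b\<close> is multiplicative, \<open>e\<close> is a derivation over \<open>b\<close>, and adding an edge at the root is a
  unimodular linear map. When a subgraph \<open>h\<close> slides from one vertex to a neighbouring one, the
  change of \<open>e + b\<close> is \<open>x e\<^sub>h\<close> times a cross term \<open>e\<^sub>1 b\<^sub>2 - e\<^sub>2 b\<^sub>1\<close> of the two sides of the edge. Its
  coefficients are nonnegative as soon as side \<open>2\<close> is a path whose length is at most the height of
  side \<open>1\<close>. Hence in a minimal graph the tree has a single branch vertex with balanced legs. Comparing
  the cycle with a path shows that the tail can be shortened unless its length is at most \<open>p\<close>. For two
  different admissible tails, the lowest and the highest coefficients at which the graphs differ are
  ordered oppositely, so that none of these graphs is below another.\<close>

section \<open>Rooted trees\<close>

text \<open>The cross term is a 2x2 determinant and attaching a path is unimodular, so a path common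
  to both sides cancels from it. This is the origin of \<open>p\<close>. Handing the last edge of a
  tail of length q + 1 to a leg of length a slides all other legs one step towards the cycle. The
  sides of the edge are the cycle with a tail of length q and a path of length a; for q \<le> a,
  cancelling q edges leaves the bare cycle against a path of length a - q. That cross term has
  nonnegative coefficients if a - q < g and coefficients of both signs otherwise. So the tail
  resists shortening when every leg has length at least g + q. Balanced legs share n - g - q - 1
  edges, so this says (g + q) l \<le> n - g - q - 1, which is q + 1 \<le> p.

  The minimality of the candidates is not proved by comparing them with all graphs of the class. In
  a finite class, below any graph that is not minimal lies a minimal one, which is itself a
  candidate by the reduction; hence it suffices that no candidate lies strictly below
  another.\<close>

text \<open>\<open>Graft s t\<close> hangs \<open>t\<close> below the root of \<open>s\<close> by a new edge, so that the children of a vertex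
  are added one at a time.\<close>

datatype rtree = Root | Graft rtree rtree

primrec glue :: "rtree \<Rightarrow> rtree \<Rightarrow> rtree" where
  "glue s Root = s"
| "glue s (Graft t c) = Graft (glue s t) c"

primrec up :: "nat \<Rightarrow> rtree \<Rightarrow> rtree" where
  "up 0 t = t"
| "up (Suc d) t = Graft Root (up d t)"

abbreviation path :: "nat \<Rightarrow> rtree" where "path k \<equiv> up k Root"

primrec star :: "nat list \<Rightarrow> rtree" where
  "star [] = Root"
| "star (a # as) = glue (star as) (path a)"

primrec num_edges :: "rtree \<Rightarrow> nat" where
  "num_edges Root = 0"
| "num_edges (Graft s t) = num_edges s + num_edges t + 1"

text \<open>The root never counts, whatever its degree: it will be a vertex of the cycle.\<close>

primrec num_leaves :: "rtree \<Rightarrow> nat" where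
  "num_leaves Root = 0"
| "num_leaves (Graft s t) = num_leaves s + num_leaves t + (if t = Root then 1 else 0)"

primrec height :: "rtree \<Rightarrow> nat" where
  "height Root = 0"
| "height (Graft s t) = max (height s) (Suc (height t))"

text \<open>\<open>Graft\<close> orders the children of a vertex, which a rooted tree does not.
  Instead of a quotient, the congruence generated by swapping two adjacent children is used; the
  edge and leaf counts, the polynomials and the relation \<open>attach\<close> to actual graphs all
  respect it.\<close>

inductive reordering :: "rtree \<Rightarrow> rtree \<Rightarrow> bool"  (infix "\<approx>" 50) where
  reordering_refl [simp, intro]: "t \<approx> t"
| reordering_sym: "s \<approx> t \<Longrightarrow> t \<approx> s"
| reordering_trans [trans]: "s \<approx> t \<Longrightarrow> t \<approx> u \<Longrightarrow> s \<approx> u"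
| Graft_swap: "Graft (Graft s c) d \<approx> Graft (Graft s d) c"
| Graft_left: "s \<approx> s' \<Longrightarrow> Graft s c \<approx> Graft s' c"
| Graft_right: "c \<approx> c' \<Longrightarrow> Graft s c \<approx> Graft s c'"

lemma glue_Root_left [simp]: "glue Root t = t"
  by (induction t) auto

lemma glue_assoc: "glue (glue s t) u = glue s (glue t u)"
  by (induction u) auto

lemma up_up: "up d (up k t) = up (d + k) t"
  by (induction d) auto

lemma glue_eq_Root_iff [simp]: "glue s t = Root \<longleftrightarrow> s = Root \<and> t = Root"
  by (cases t) auto

lemma up_eq_Root_iff [simp]: "up d t = Root \<longleftrightarrow> d = 0 \<and> t = Root"
  by (cases d) auto

lemma num_edges_glue [simp]: "num_edges (glue s t) = num_edges s + num_edges t"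
  by (induction t) auto

lemma num_edges_up [simp]: "num_edges (up d t) = d + num_edges t"
  by (induction d) auto

lemma num_edges_star [simp]: "num_edges (star as) = sum_list as"
  by (induction as) auto

lemma num_leaves_glue [simp]: "num_leaves (glue s t) = num_leaves s + num_leaves t"
  by (induction t) auto

lemma num_leaves_up: "num_leaves (up d t) = (if t = Root then min d 1 else num_leaves t)"
  by (induction d) auto

lemma num_leaves_star: "0 \<notin> set as \<Longrightarrow> num_leaves (star as) = length as"
  by (induction as) (auto simp: num_leaves_up)

lemma num_leaves_eq_0_iff [simp]: "num_leaves t = 0 \<longleftrightarrow> t = Root"
  by (induction t) auto

lemma height_glue [simp]: "height (glue s t) = max (height s) (height t)"
  by (induction t) auto

lemma height_up [simp]: "height (up d t) = d + height t"
  by (induction d) auto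

lemma height_star: "a \<in> set as \<Longrightarrow> a \<le> height (star as)"
  by (induction as) auto

lemma Root_reordering: "s \<approx> t \<Longrightarrow> s = Root \<longleftrightarrow> t = Root"
  by (induction rule: reordering.induct) auto

lemma num_edges_reordering: "s \<approx> t \<Longrightarrow> num_edges s = num_edges t"
  by (induction rule: reordering.induct) auto

lemma num_leaves_reordering: "s \<approx> t \<Longrightarrow> num_leaves s = num_leaves t"
  by (induction rule: reordering.induct) (auto dest: Root_reordering)

lemma reordering_up: "s \<approx> t \<Longrightarrow> up d s \<approx> up d t"
  by (induction d) (auto intro: Graft_right)

lemma glue_left_reordering: "s \<approx> s' \<Longrightarrow> glue s t \<approx> glue s' t"
  by (induction t) (auto intro: Graft_left)

lemma glue_Graft_left: "glue (Graft s c) t \<approx> Graft (glue s t) c"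
proof (induction t)
  case (Graft t d)
  have "Graft (glue (Graft s c) t) d \<approx> Graft (Graft (glue s t) c) d"
    by (rule Graft_left) (rule Graft)
  also have "\<dots> \<approx> Graft (Graft (glue s t) d) c"
    by (rule Graft_swap)
  finally show ?case by simp
qed auto

lemma glue_commute: "glue s t \<approx> glue t s"
proof (induction s)
  case (Graft s c)
  have "glue (Graft s c) t \<approx> Graft (glue s t) c"
    by (rule glue_Graft_left)
  also have "\<dots> \<approx> Graft (glue t s) c"
    by (rule Graft_left) (rule Graft)
  finally show ?case by simp
qed auto

lemma glue_right_reordering: "t \<approx> t' \<Longrightarrow> glue s t \<approx> glue s t'"
  by (meson glue_commute glue_left_reordering reordering_trans)

lemma glue_reordering: "s \<approx> s' \<Longrightarrow> t \<approx> t' \<Longrightarrow> glue s t \<approx> glue s' t'"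
  by (meson glue_left_reordering glue_right_reordering reordering_trans)

lemma star_append: "star (as @ bs) = glue (star bs) (star as)"
  by (induction as) (auto simp: glue_assoc)

lemma star_reordering: "mset as = mset bs \<Longrightarrow> star as \<approx> star bs"
proof (induction as arbitrary: bs)
  case (Cons a as)
  then have "a \<in> set bs"
    by (metis list.set_intros(1) set_mset_mset)
  then obtain us vs where bs: "bs = us @ a # vs"
    by (meson split_list)
  with Cons.prems have "mset as = mset (us @ vs)" by simp
  then have "star as \<approx> star (us @ vs)" by (rule Cons.IH)
  then have "star (a # as) \<approx> glue (star (us @ vs)) (path a)"
    by (simp add: glue_left_reordering)
  also have "\<dots> = glue (star vs) (glue (star us) (path a))"
    by (simp add: star_append glue_assoc)
  also have "\<dots> \<approx> glue (star vs) (glue (path a) (star us))"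
    by (intro glue_right_reordering glue_commute)
  also have "\<dots> = star bs"
    by (simp add: bs star_append glue_assoc)
  finally show ?case .
qed auto

definition balanced :: "nat list \<Rightarrow> bool" where
  "balanced as \<longleftrightarrow> (\<forall>a\<in>set as. \<forall>b\<in>set as. a \<le> b + 1)"

text \<open>Length and sum determine how often each value occurs: the excess of the sum over
  \<open>m * length as\<close> counts the entries \<open>Suc m\<close>. The two inequalities ensure
  that the subtractions do not truncate.\<close>

lemma mset_two_values:
  assumes "\<forall>a\<in>set as. a = m \<or> a = Suc m"
  shows "mset as = replicate_mset (Suc m * length as - sum_list as) m
           + replicate_mset (sum_list as - m * length as) (Suc m)
         \<and> m * length as \<le> sum_list as \<and> sum_list as \<le> Suc m * length as"
  using assms
proof (induction as)
  case (Cons a as)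
  then have IH: "mset as = replicate_mset (Suc m * length as - sum_list as) m
           + replicate_mset (sum_list as - m * length as) (Suc m)"
    "m * length as \<le> sum_list as" "sum_list as \<le> Suc m * length as" by auto
  from Cons.prems consider "a = m" | "a = Suc m" by auto
  then show ?case
  proof cases
    case 1
    have "Suc m * length (a # as) - sum_list (a # as) = Suc (Suc m * length as - sum_list as)"
      "sum_list (a # as) - m * length (a # as) = sum_list as - m * length as"
      using 1 IH(2,3) by auto
    then show ?thesis using 1 IH by auto
  next
    case 2
    have "Suc m * length (a # as) - sum_list (a # as) = Suc m * length as - sum_list as"
      "sum_list (a # as) - m * length (a # as) = Suc (sum_list as - m * length as)"
      using 2 IH(2,3) by auto
    then show ?thesis using 2 IH by auto
  qed
qed auto

lemma mset_balanced:
  assumes "balanced as" "balanced bs" "length as = length bs" "sum_list as = sum_list bs"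
  shows "mset as = mset bs"
proof (cases "as = []")
  case False
  have *: "\<exists>m. (\<forall>a\<in>set as. a = m \<or> a = Suc m) \<and> m = sum_list as div length as"
    if "balanced as" "as \<noteq> []" for as
  proof (intro exI conjI)
    define m where "m = Min (set as)"
    have m: "m \<in> set as" "\<And>a. a \<in> set as \<Longrightarrow> m \<le> a"
      using that by (auto simp: m_def)
    have two: "\<forall>a\<in>set as. a = m \<or> a = Suc m"
      using that m unfolding balanced_def by (metis Suc_eq_plus1 le_SucE le_antisym)
    from mset_two_values[OF two] have
      ms: "mset as = replicate_mset (Suc m * length as - sum_list as) m
           + replicate_mset (sum_list as - m * length as) (Suc m)"
      and le: "m * length as \<le> sum_list as" "sum_list as \<le> Suc m * length as" by auto
    \<comment> \<open>Since the minimum \<open>m\<close> occurs, not all entries are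
      \<open>Suc m\<close>. The sum is then strictly below \<open>Suc m * length as\<close>, which
      identifies \<open>m\<close> as the quotient of sum and length.\<close>
    have "count (mset as) m > 0" using m(1) by simp
    then have "sum_list as < Suc m * length as"
      unfolding ms by (auto split: if_splits)
    then have "m = sum_list as div length as"
      using le that by (intro sym[OF div_nat_eqI]) (auto simp: algebra_simps)
    with two show "\<forall>a\<in>set as. a = sum_list as div length as \<or> a = Suc (sum_list as div length as)"
      "sum_list as div length as = sum_list as div length as" by auto
  qed
  have "bs \<noteq> []" using assms(3) False by auto
  with * assms False obtain m where "\<forall>a\<in>set as. a = m \<or> a = Suc m" "\<forall>a\<in>set bs. a = m \<or> a = Suc m"
    by metis
  then show ?thesis using mset_two_values assms by metis
qed (use assms in auto)

section \<open>Pairs of polynomials of rooted graphs\<close>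

text \<open>Coefficientwise domination is a partial order and needs its own predicate:
  \<open>\<le>\<close> on \<open>real poly\<close> is the linear order given by the sign of the
  leading coefficient of the difference. That order is used as well, to compare the extremal graphs
  at their highest differing coefficient.\<close>

definition nonneg_coeffs :: "real poly \<Rightarrow> bool" where
  "nonneg_coeffs p \<longleftrightarrow> (\<forall>k. 0 \<le> coeff p k)"

lemma nonneg_coeffs_0 [simp]: "nonneg_coeffs 0"
  and nonneg_coeffs_1 [simp]: "nonneg_coeffs 1"
  and nonneg_coeffs_numeral [simp]: "nonneg_coeffs (numeral w)"
  by (auto simp: nonneg_coeffs_def numeral_poly coeff_pCons split: nat.split)

lemma nonneg_coeffs_add [intro!]: "nonneg_coeffs p \<Longrightarrow> nonneg_coeffs q \<Longrightarrow> nonneg_coeffs (p + q)"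
  by (auto simp: nonneg_coeffs_def)

lemma nonneg_coeffs_mult [intro!]: "nonneg_coeffs p \<Longrightarrow> nonneg_coeffs q \<Longrightarrow> nonneg_coeffs (p * q)"
  by (auto simp: nonneg_coeffs_def coeff_mult intro!: sum_nonneg)

lemma nonneg_coeffs_sum [intro]: "(\<And>i. i \<in> I \<Longrightarrow> nonneg_coeffs (f i)) \<Longrightarrow> nonneg_coeffs (sum f I)"
  by (auto simp: nonneg_coeffs_def coeff_sum intro!: sum_nonneg)

lemma nonneg_coeffs_antisym: "nonneg_coeffs (p - q) \<Longrightarrow> nonneg_coeffs (q - p) \<Longrightarrow> p = q"
  by (auto simp: nonneg_coeffs_def poly_eq_iff intro: antisym)

lemma nonneg_coeffs_add_eq_0_iff:
  "nonneg_coeffs p \<Longrightarrow> nonneg_coeffs q \<Longrightarrow> p + q = 0 \<longleftrightarrow> p = 0 \<and> q = 0"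
  by (auto simp: nonneg_coeffs_def poly_eq_iff add_nonneg_eq_0_iff)

definition X :: "real poly" where "X = [:0, 1:]"

lemma X_nonzero [simp]: "X \<noteq> 0"
  and nonneg_coeffs_X [simp]: "nonneg_coeffs X"
  by (auto simp: X_def nonneg_coeffs_def coeff_pCons split: nat.split)

lemma coeff_X_mult: "coeff (X * p) k = (if k = 0 then 0 else coeff p (k - 1))"
  by (cases k) (auto simp: X_def)

lemma nonneg_coeffs_X_mult_iff [simp]: "nonneg_coeffs (X * p) \<longleftrightarrow> nonneg_coeffs p"
proof
  assume *: "nonneg_coeffs (X * p)"
  have "0 \<le> coeff p k" for k
    using *[unfolded nonneg_coeffs_def, rule_format, of "Suc k"] by (simp add: coeff_X_mult)
  then show "nonneg_coeffs p" by (simp add: nonneg_coeffs_def)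
qed (auto)

text \<open>For a rooted graph with Laplacian matrix \<open>L\<close>, let \<open>b\<close> be the determinant of \<open>x I + L\<close> with
  the row and column of the root deleted, and define \<open>e\<close> by \<open>det (x I + L) = x (e + b)\<close>. Under
  gluing at the root, \<open>b\<close> is multiplicative and \<open>e\<close> is a derivation over \<open>b\<close>;
  adding an edge at the root acts linearly on \<open>(e, b)\<close> by a matrix of determinant \<open>1\<close>.\<close>

fun poly_b :: "rtree \<Rightarrow> real poly" and poly_e :: "rtree \<Rightarrow> real poly" where
  "poly_b Root = 1"
| "poly_b (Graft s t) = poly_b s * (X * poly_e t + (1 + X) * poly_b t)"
| "poly_e Root = 0"
| "poly_e (Graft s t) =
     poly_e s * (X * poly_e t + (1 + X) * poly_b t) + poly_b s * (poly_e t + poly_b t)"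

text \<open>\<open>X * poly_f t\<close> is the full determinant of x I + L for the tree itself, so
  \<open>poly_f t\<close> carries its Laplacian coefficients.\<close>

definition poly_f :: "rtree \<Rightarrow> real poly" where
  "poly_f t = poly_e t + poly_b t"

lemma nonneg_coeffs_poly_b_e [simp]: "nonneg_coeffs (poly_b t)" "nonneg_coeffs (poly_e t)"
  by (induction t) (auto intro!: nonneg_coeffs_add nonneg_coeffs_mult)

lemma poly_0_X [simp]: "poly X 0 = 0"
  by (simp add: X_def)

lemma poly_b_0 [simp]: "poly (poly_b t) 0 = 1"
  by (induction t) auto

lemma poly_e_0 [simp]: "poly (poly_e t) 0 = real (num_edges t)"
  by (induction t) auto

lemma poly_b_nonzero [simp]: "poly_b t \<noteq> 0"
  by (metis poly_0 poly_b_0 zero_neq_one)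

lemma poly_e_nonzero: "t \<noteq> Root \<Longrightarrow> poly_e t \<noteq> 0"
  by (cases t) (auto dest!: arg_cong[of _ _ "\<lambda>p. poly p 0"])

lemma nonneg_coeffs_poly_f [simp]: "nonneg_coeffs (poly_f t)"
  by (auto simp: poly_f_def)

lemma poly_f_nonzero [simp]: "poly_f t \<noteq> 0"
  by (auto simp: poly_f_def dest!: arg_cong[of _ _ "\<lambda>p. poly p 0"])

lemma poly_b_e_glue:
  "poly_b (glue s t) = poly_b s * poly_b t"
  "poly_e (glue s t) = poly_e s * poly_b t + poly_b s * poly_e t"
  by (induction t) (auto simp: algebra_simps)

lemma poly_b_e_reordering: "s \<approx> t \<Longrightarrow> poly_b s = poly_b t \<and> poly_e s = poly_e t"
  by (induction rule: reordering.induct) (auto simp: algebra_simps)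

lemma poly_f_reordering: "s \<approx> t \<Longrightarrow> poly_f s = poly_f t"
  by (simp add: poly_f_def poly_b_e_reordering)

section \<open>Paths and the powers of the edge matrix\<close>

definition path_b :: "nat \<Rightarrow> real poly" where "path_b k = poly_b (path k)"
definition path_e :: "nat \<Rightarrow> real poly" where "path_e k = poly_e (path k)"

lemma path_b_e_0 [simp]: "path_b 0 = 1" "path_e 0 = 0"
  by (simp_all add: path_b_def path_e_def)

lemma nonneg_coeffs_path [simp]: "nonneg_coeffs (path_b k)" "nonneg_coeffs (path_e k)"
  by (simp_all add: path_b_def path_e_def)

lemma path_b_nonzero [simp]: "path_b k \<noteq> 0"
  by (simp add: path_b_def)

lemma path_e_nonzero [simp]: "k > 0 \<Longrightarrow> path_e k \<noteq> 0"
  by (simp add: path_e_def poly_e_nonzero)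

lemma path_b_Suc [simp]: "path_b (Suc k) = X * path_e k + (1 + X) * path_b k"
  and path_e_Suc [simp]: "path_e (Suc k) = path_e k + path_b k"
  by (simp_all add: path_b_def path_e_def)

lemma path_b_eq: "path_b (Suc k) = X * path_e (Suc k) + path_b k"
  by (simp add: algebra_simps)

text \<open>Adding an edge at the root multiplies the column (e, b) by the matrix with rows (1, 1)
  and (X, 1 + X). Its d-th power is a combination of the identity and the matrix itself, hence
  determined by its second column. This column is the image of the pair (0, 1) of
  \<open>Root\<close>, that is, the pair of \<open>path d\<close>.\<close>

lemma poly_e_up: "poly_e (up d t) = (path_b d - X * path_e d) * poly_e t + path_e d * poly_b t"
  and poly_b_up: "poly_b (up d t) = X * path_e d * poly_e t + path_b d * poly_b t"
proof (induction d)
  case (Suc d)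
  {
    case 1
    then show ?case by (simp only: up.simps poly_e.simps poly_b.simps path_e_Suc path_b_Suc Suc) (simp add: algebra_simps)
  next
    case 2
    then show ?case by (simp only: up.simps poly_e.simps poly_b.simps path_e_Suc path_b_Suc Suc) (simp add: algebra_simps)
  }
qed simp_all

lemma path_e_add: "path_e (d + k) = (path_b d - X * path_e d) * path_e k + path_e d * path_b k"
  and path_b_add: "path_b (d + k) = X * path_e d * path_e k + path_b d * path_b k"
  using poly_e_up[of d "path k"] poly_b_up[of d "path k"] by (simp_all add: up_up path_b_def path_e_def)

text \<open>A Cassini-type identity: the left-hand side is the determinant of the d-th power of the
  edge matrix, and each factor has determinant (1 + X) - X = 1.\<close>

lemma path_det: "path_b d * path_b d - X * path_e d * path_b d - X * path_e d * path_e d = 1"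
proof (induction d)
  case (Suc d)
  have "path_b (Suc d) * path_b (Suc d) - X * path_e (Suc d) * path_b (Suc d)
      - X * path_e (Suc d) * path_e (Suc d)
    = path_b d * path_b d - X * path_e d * path_b d - X * path_e d * path_e d"
    by (simp add: algebra_simps)
  with Suc show ?case by simp
qed simp

text \<open>The determinant of the two columns. It does not change when the same \<open>lift\<close>
  acts on both (\<open>cross_lift\<close>), which is how common paths cancel.\<close>

definition cross :: "real poly \<times> real poly \<Rightarrow> real poly \<times> real poly \<Rightarrow> real poly" where
  "cross p q = fst p * snd q - fst q * snd p"

text \<open>The pair \<open>(e, b)\<close> of the graph obtained from a graph with pair \<open>(e, b)\<close> by attaching a
  path of length \<open>d\<close> at the root and moving the root to its other end.\<close>

definition lift :: "nat \<Rightarrow> real poly \<times> real poly \<Rightarrow> real poly \<times> real poly" where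
  "lift d p = ((path_b d - X * path_e d) * fst p + path_e d * snd p,
               X * path_e d * fst p + path_b d * snd p)"

abbreviation tree_eb :: "rtree \<Rightarrow> real poly \<times> real poly" where
  "tree_eb t \<equiv> (poly_e t, poly_b t)"

lemma tree_eb_up: "tree_eb (up d t) = lift d (tree_eb t)"
  by (simp add: lift_def poly_e_up poly_b_up)

lemma lift_0 [simp]: "lift 0 p = p"
  by (simp add: lift_def)

lemma lift_add: "lift (d + k) p = lift d (lift k p)"
  by (simp add: lift_def path_e_add path_b_add algebra_simps)

lemma cross_lift [simp]: "cross (lift d p) (lift d q) = cross p q"
proof -
  have "cross (lift d p) (lift d q) = cross p q *
    (path_b d * path_b d - X * path_e d * path_b d - X * path_e d * path_e d)"
    by (simp add: cross_def lift_def algebra_simps)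
  then show ?thesis by (simp add: path_det)
qed

lemma poly_b_e_path [simp]: "poly_b (path k) = path_b k" "poly_e (path k) = path_e k"
  by (simp_all add: path_b_def path_e_def)

lemma cross_path_path: 
  assumes "b \<le> a" shows "cross (tree_eb (path a)) (tree_eb (path b)) = path_e (a - b)"
proof -
  have "tree_eb (path a) = lift b (tree_eb (path (a - b)))"
    using assms by (simp only: tree_eb_up[symmetric] up_up) simp
  moreover have "tree_eb (path b) = lift b (tree_eb Root)"
    by (simp only: tree_eb_up)
  ultimately show ?thesis by (simp only: cross_lift) (simp add: cross_def)
qed

text \<open>For two trees glued at the root, \<open>cross\<close> is \<open>poly_b\<close> of one
  part times \<open>cross\<close> of the other, plus a product of nonnegative terms. So the
  induction may descend into whichever part contains a path of length \<open>a\<close> from the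
  root. If that is the child \<open>t\<close>, unimodularity strips the connecting edge from the
  tree and one edge from the path, leaving \<open>t\<close> against \<open>path a'\<close>.\<close>

lemma cross_height:
  "a \<le> height t \<Longrightarrow> nonneg_coeffs (cross (tree_eb t) (tree_eb (path a)))"
proof (induction t arbitrary: a)
  case Root
  then show ?case by (simp add: cross_def)
next
  case (Graft s t)
  consider "a = 0" | "a \<le> height s" | a' where "a = Suc a'" "a' \<le> height t"
    using Graft.prems by (cases a) (auto simp: max_def split: if_splits)
  then show ?case
  proof cases
    case 1
    then show ?thesis by (simp add: cross_def del: poly_e.simps(2) poly_b.simps(2))
  next
    case 2
    have "cross (tree_eb (Graft s t)) (tree_eb (path a)) =
        poly_b (Graft Root t) * cross (tree_eb s) (tree_eb (path a))
        + poly_e (Graft Root t) * poly_b s * path_b a"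
      by (simp add: cross_def algebra_simps)
    then show ?thesis
      using Graft.IH(1)[OF 2] by (simp del: poly_e.simps poly_b.simps add: nonneg_coeffs_add nonneg_coeffs_mult)
  next
    case 3
    have "cross (tree_eb (Graft s t)) (tree_eb (path a)) =
        poly_b s * cross (tree_eb t) (tree_eb (path a'))
        + poly_e s * poly_b (Graft Root t) * path_b a"
      unfolding 3 by (simp add: cross_def algebra_simps)
    then show ?thesis
      using Graft.IH(2)[OF 3(2)] by (simp del: poly_e.simps poly_b.simps add: nonneg_coeffs_add nonneg_coeffs_mult)
  qed
qed

text \<open>The value at \<open>0\<close> is the difference of the numbers of edges.\<close>

lemma cross_nonzero: "num_edges t \<noteq> num_edges s \<Longrightarrow> cross (tree_eb s) (tree_eb t) \<noteq> 0"
  by (auto simp: cross_def dest!: arg_cong[of _ _ "\<lambda>p. poly p 0"])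

section \<open>Improving moves on rooted trees\<close>

text \<open>The comparison is made in (f, b) rather than (e, b): \<open>poly_e\<close> may grow
  under an improving move, while \<open>unicyclic_poly\<close> and the recursion along
  \<open>Graft\<close> combine f and b with nonnegative coefficients only. Strictness is demanded of
  b, and in this form it survives grafting.\<close>

definition improves :: "rtree \<Rightarrow> rtree \<Rightarrow> bool" where
  "improves s t \<longleftrightarrow> num_edges s = num_edges t \<and> num_leaves s = num_leaves t \<and>
     nonneg_coeffs (poly_f t - poly_f s) \<and> nonneg_coeffs (poly_b t - poly_b s) \<and>
     poly_b t \<noteq> poly_b s"

definition irreducible_tree :: "rtree \<Rightarrow> bool" where
  "irreducible_tree t \<longleftrightarrow> (\<nexists>s. improves s t)"

lemma improves_Root: "improves s t \<Longrightarrow> s = Root \<longleftrightarrow> t = Root"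
  unfolding improves_def by (metis num_leaves_eq_0_iff)

lemma improves_reordering_right: "improves s t \<Longrightarrow> t \<approx> u \<Longrightarrow> improves s u"
  using num_edges_reordering num_leaves_reordering poly_b_e_reordering poly_f_reordering
  unfolding improves_def by metis

lemma irreducible_reordering: "irreducible_tree t \<Longrightarrow> t \<approx> u \<Longrightarrow> irreducible_tree u"
  unfolding irreducible_tree_def using improves_reordering_right reordering_sym by blast

lemma poly_b_Graft_f: "poly_b (Graft s t) = poly_b s * (X * poly_f t + poly_b t)"
  and poly_f_Graft: "poly_f (Graft s t) =
    poly_f s * (X * poly_f t + poly_b t) + poly_b s * poly_f t"
  by (simp_all add: poly_f_def algebra_simps)

lemma improves_Graft_left:
  assumes "improves s t" shows "improves (Graft s c) (Graft t c)"
proof -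
  have nn: "nonneg_coeffs (X * poly_f c + poly_b c)" by auto
  have nz: "X * poly_f c + poly_b c \<noteq> 0"
    by (subst nonneg_coeffs_add_eq_0_iff) auto
  have "poly_b (Graft t c) - poly_b (Graft s c) =
      (poly_b t - poly_b s) * (X * poly_f c + poly_b c)"
    "poly_f (Graft t c) - poly_f (Graft s c) =
      (poly_f t - poly_f s) * (X * poly_f c + poly_b c) + (poly_b t - poly_b s) * poly_f c"
    unfolding poly_b_Graft_f poly_f_Graft by (simp_all add: algebra_simps)
  with assms nn nz show ?thesis
    unfolding improves_def
    by (metis eq_iff_diff_eq_0 mult_eq_0_iff nonneg_coeffs_add nonneg_coeffs_mult
        nonneg_coeffs_poly_f num_edges.simps(2) num_leaves.simps(2))
qed

lemma improves_Graft_right: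
  assumes "improves s t" shows "improves (Graft c s) (Graft c t)"
proof -
  have b: "poly_b (Graft c t) - poly_b (Graft c s) =
      poly_b c * (X * (poly_f t - poly_f s) + (poly_b t - poly_b s))"
    and f: "poly_f (Graft c t) - poly_f (Graft c s) =
      poly_f c * (X * (poly_f t - poly_f s) + (poly_b t - poly_b s)) + poly_b c * (poly_f t - poly_f s)"
    unfolding poly_b_Graft_f poly_f_Graft by (simp_all add: algebra_simps)
  have nn: "nonneg_coeffs (X * (poly_f t - poly_f s) + (poly_b t - poly_b s))"
    using assms by (auto simp: improves_def)
  have "X * (poly_f t - poly_f s) + (poly_b t - poly_b s) \<noteq> 0"
    using assms by (subst nonneg_coeffs_add_eq_0_iff) (auto simp: improves_def)
  then have "poly_b (Graft c t) - poly_b (Graft c s) \<noteq> 0"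
    unfolding b by simp
  moreover have "nonneg_coeffs (poly_b (Graft c t) - poly_b (Graft c s))"
    unfolding b using nn by auto
  moreover have "nonneg_coeffs (poly_f (Graft c t) - poly_f (Graft c s))"
    unfolding f using nn assms
    by (intro nonneg_coeffs_add nonneg_coeffs_mult) (auto simp: improves_def)
  ultimately show ?thesis
    using assms improves_Root[OF assms] by (auto simp: improves_def simp del: poly_b.simps)
qed

lemma irreducible_GraftD:
  "irreducible_tree (Graft s t) \<Longrightarrow> irreducible_tree s \<and> irreducible_tree t"
  unfolding irreducible_tree_def using improves_Graft_left improves_Graft_right by blast

text \<open>The subtree \<open>h\<close> slides from a branch vertex to a vertex above it, leaving only one
  path below the branch vertex.\<close>

lemma improves_slide_up:
  assumes nn: "nonneg_coeffs (cross (tree_eb y) (tree_eb (path a)))"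
    and h: "h \<noteq> Root" and d: "d > 0" and y: "y \<noteq> Root" and a: "a > 0"
  shows "improves (glue (glue (path (d + a)) h) y) (glue (up d (glue (path a) h)) y)"
proof -
  let ?s = "glue (glue (path (d + a)) h) y" and ?t = "glue (up d (glue (path a) h)) y"
  have p: "path (d + a) = up d (path a)" by (simp add: up_up)
  have f: "poly_f ?t - poly_f ?s = X * path_e d * poly_e h * cross (tree_eb y) (tree_eb (path a))"
    unfolding p by (simp add: poly_f_def poly_b_e_glue poly_e_up poly_b_up cross_def algebra_simps)
  have b: "poly_b ?t - poly_b ?s = poly_b y * (X * path_e d * poly_e h * path_b a)"
    unfolding p by (simp add: poly_b_e_glue poly_b_up algebra_simps)
  have "poly_b ?t - poly_b ?s \<noteq> 0"
    unfolding b using h d by (simp add: poly_e_nonzero)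
  moreover have "nonneg_coeffs (poly_b ?t - poly_b ?s)" unfolding b by auto
  moreover have "nonneg_coeffs (poly_f ?t - poly_f ?s)" unfolding f using nn by auto
  ultimately show ?thesis
    using assms unfolding improves_def by (auto simp: num_leaves_up)
qed

text \<open>The opposite slide: \<open>y\<close> moves together with the root down \<open>d\<close>
  edges to the vertex that carries \<open>z\<close>, and the \<open>path b\<close> left behind grows
  to \<open>path (b + d)\<close>. Because the root moves too, f and b change by the same cross term,
  with factors from \<open>poly_e y\<close> and \<open>poly_b y\<close>. Counting edges, i.e.
  evaluating at 0, shows that the cross term is nonzero.\<close>

lemma improves_slide_down:
  assumes nn: "nonneg_coeffs (cross (tree_eb z) (tree_eb (path b)))"
    and less: "b < num_edges z" and d: "d > 0" and b: "b > 0"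
  shows "improves (glue (glue z (path (b + d))) y) (glue (glue (up d z) (path b)) y)"
proof -
  let ?s = "glue (glue z (path (b + d))) y" and ?t = "glue (glue (up d z) (path b)) y"
  have p: "path (b + d) = up d (path b)" by (simp add: up_up add.commute)
  have f: "poly_f ?t - poly_f ?s = poly_e y * X * path_e d * cross (tree_eb z) (tree_eb (path b))"
    unfolding p by (simp add: poly_f_def poly_b_e_glue poly_e_up poly_b_up cross_def algebra_simps)
  have g: "poly_b ?t - poly_b ?s = poly_b y * X * path_e d * cross (tree_eb z) (tree_eb (path b))"
    unfolding p by (simp add: poly_b_e_glue poly_b_up cross_def algebra_simps)
  have "poly_b ?t - poly_b ?s \<noteq> 0"
    unfolding g using less d cross_nonzero[of "path b" z] by (simp add: poly_e_nonzero)
  moreover have "nonneg_coeffs (poly_b ?t - poly_b ?s)" unfolding g using nn by auto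
  moreover have "nonneg_coeffs (poly_f ?t - poly_f ?s)" unfolding f using nn by auto
  moreover have "z \<noteq> Root" using less by auto
  ultimately show ?thesis
    using assms unfolding improves_def by (auto simp: num_leaves_up)
qed

text \<open>The root and \<open>y\<close> slide by one edge along a path of length
  \<open>a + b\<close>. The cross term compares \<open>path (a - 1)\<close> with
  \<open>path b\<close>; cancelling \<open>b\<close> common edges leaves
  \<open>path_e (a - 1 - b)\<close>.\<close>

lemma improves_balance:
  assumes "b + 1 < a" and b: "b > 0"
  shows "improves (glue (glue (path (a - 1)) (path (b + 1))) y) (glue (glue (path a) (path b)) y)"
proof -
  let ?s = "glue (glue (path (a - 1)) (path (b + 1))) y" and ?t = "glue (glue (path a) (path b)) y"
  obtain d where a: "a = Suc b + d" and d: "d > 0"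
    using assms(1) by (metis less_imp_add_positive Suc_eq_plus1)
  have s: "path a = up 1 (path (a - 1))" "path (b + 1) = up 1 (path b)"
    using a by auto
  have c: "path_e d = cross (tree_eb (path (a - 1))) (tree_eb (path b))"
    by (subst cross_path_path) (auto simp: a)
  have "poly_f ?t - poly_f ?s = poly_e y * X * path_e d"
    "poly_b ?t - poly_b ?s = poly_b y * X * path_e d"
    unfolding c s by (simp_all add: poly_f_def poly_b_e_glue cross_def algebra_simps)
  moreover have "poly_b y * X * path_e d \<noteq> 0"
    using d by (simp add: poly_e_nonzero)
  ultimately show ?thesis
    using assms unfolding improves_def by (auto simp: num_leaves_up)
qed

section \<open>Classification of irreducible trees\<close>

text \<open>The first leg stays as the single path below, and the other legs slide up the
  \<open>d\<close> edges to the root. The height of \<open>y\<close> makes the cross term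
  nonnegative.\<close>

lemma not_irreducible_slide_up:
  assumes "irreducible_tree (glue (up d (star as)) y)"
    and "d > 0" "2 \<le> length as" "0 \<notin> set as" "hd as \<le> height y"
  shows False
proof -
  obtain a b cs where as: "as = a # b # cs"
    using assms(3) by (auto simp: numeral_2_eq_2 Suc_le_length_iff)
  let ?h = "star (b # cs)"
  have "glue (up d (star as)) y \<approx> glue (up d (glue (path a) ?h)) y"
    unfolding as star.simps(2)[of a]
    by (intro glue_left_reordering reordering_up glue_commute)
  with assms(1) have "irreducible_tree (glue (up d (glue (path a) ?h)) y)"
    by (rule irreducible_reordering)
  moreover have "nonneg_coeffs (cross (tree_eb y) (tree_eb (path a)))"
    using assms(5) by (intro cross_height) (simp add: as)
  moreover have "y \<noteq> Root" using assms(4,5) as by auto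
  ultimately show False
    using improves_slide_up[of y a ?h d] assms as unfolding irreducible_tree_def by fastforce
qed

text \<open>If the first leg is no longer than \<open>b\<close>, the other legs slide up, with
  \<open>path b\<close> providing the height. Otherwise the star is higher than
  \<open>path b\<close>, and the root slides down to it together with \<open>y\<close>.\<close>

lemma not_irreducible_path_branch:
  assumes "irreducible_tree (glue (up d (star as)) (glue (path b) y))"
    and "d > 0" "2 \<le> length as" "0 \<notin> set as" "b > 0"
  shows False
proof (cases "hd as \<le> b")
  case True
  then show False
    by (intro not_irreducible_slide_up[OF assms(1-4)]) auto
next
  case False
  obtain a a' cs where as: "as = a # a' # cs"
    using assms(3) by (auto simp: numeral_2_eq_2 Suc_le_length_iff)
  have "b < num_edges (star as)" "b \<le> height (star as)"
    using False by (auto simp: as)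
  with improves_slide_down[of "star as" b d y] assms cross_height[of b "star as"]
  show False
    unfolding irreducible_tree_def by (auto simp: glue_assoc)
qed

text \<open>The branch with the shorter first leg slides up; the other branch provides the
  height.\<close>

lemma not_irreducible_branch_branch:
  assumes "irreducible_tree (glue (up d (star as)) (up d' (star bs)))"
    and "d > 0" "2 \<le> length as" "0 \<notin> set as"
    and "d' > 0" "2 \<le> length bs" "0 \<notin> set bs"
  shows False
proof -
  have ne: "as \<noteq> []" "bs \<noteq> []" using assms by auto
  have h: "hd as \<le> height (star as)" "hd bs \<le> height (star bs)"
    using ne by (auto intro!: height_star)
  show False
  proof (cases "hd as \<le> hd bs")
    case True
    then show False using h by (intro not_irreducible_slide_up[OF assms(1-4)]) auto
  next
    case False
    have "irreducible_tree (glue (up d' (star bs)) (up d (star as)))"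
      using assms(1) glue_commute by (rule irreducible_reordering)
    from this assms(5-7) show False
      by (rule not_irreducible_slide_up) (use False h in auto)
  qed
qed

lemma irreducible_star_balanced:
  assumes "irreducible_tree (star as)" "0 \<notin> set as"
  shows "balanced as"
proof (rule ccontr)
  assume "\<not> balanced as"
  then obtain a b where ab: "a \<in> set as" "b \<in> set as" "b + 1 < a"
    by (auto simp: balanced_def not_le)
  let ?cs = "remove1 b (remove1 a as)"
  have "mset as = mset (b # a # ?cs)"
  proof -
    have "b \<in># mset as - {#a#}"
      using ab by (simp add: in_diff_count)
    from insert_DiffM[OF this] insert_DiffM[of a "mset as"] ab(1) show ?thesis
      by (simp add: add_mset_commute)
  qed
  then have "star as \<approx> star (b # a # ?cs)"
    by (rule star_reordering)
  also have "\<dots> = glue (star ?cs) (glue (path a) (path b))"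
    by (simp add: glue_assoc)
  also have "\<dots> \<approx> glue (glue (path a) (path b)) (star ?cs)"
    by (rule glue_commute)
  finally have "irreducible_tree (glue (glue (path a) (path b)) (star ?cs))"
    using assms irreducible_reordering by blast
  then show False
    using improves_balance[of b a "star ?cs"] ab assms
    unfolding irreducible_tree_def by (metis gr0I)
qed

text \<open>Induction over the children of the root. A path merges with another path, or with a star
  centred at the root (\<open>?broom 0\<close>), into a larger star. In every other combination of
  two nontrivial parts, a branch vertex strictly below the root has a further subtree beside it at
  the root, and an improving move exists.\<close>

lemma irreducible_tree_cases:
  assumes "irreducible_tree t"
  shows "(\<exists>k. t \<approx> path k) \<or>
    (\<exists>q as. t \<approx> up q (star as) \<and> 2 \<le> length as \<and> 0 \<notin> set as \<and> balanced as)"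
  using assms
proof (induction t)
  case (Graft s c)
  let ?path = "\<lambda>t. \<exists>k>0. t \<approx> path k"
  let ?broom = "\<lambda>d t. \<exists>as. t \<approx> up d (star as) \<and> 2 \<le> length as \<and> 0 \<notin> set as \<and> balanced as"
  define c' where "c' = Graft Root c"
  have t: "Graft s c = glue s c'" by (simp add: c'_def)
  have irr: "irreducible_tree u" if "Graft s c \<approx> u" for u
    using Graft.prems that by (rule irreducible_reordering)
  have c': "?path c' \<or> (\<exists>d>0. ?broom d c')"
    using Graft.IH(2) irreducible_GraftD[OF Graft.prems] Graft_right[of c _ Root]
    unfolding c'_def by (metis up.simps(2) zero_less_Suc)
  have "s = Root \<or> ?path s \<or> (\<exists>d. ?broom d s)"
    using Graft.IH(1) irreducible_GraftD[OF Graft.prems] Root_reordering[of s "path 0"]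
    by (metis gr0I up.simps(1))
  then consider "s = Root" | k where "k > 0" "s \<approx> path k" | d as where
    "s \<approx> up d (star as)" "2 \<le> length as" "0 \<notin> set as" "balanced as" by blast
  then show ?case
  proof cases
    case 1
    then show ?thesis using c' unfolding t by (metis glue_Root_left)
  next
    case (2 k)
    from c' consider j where "j > 0" "c' \<approx> path j" | d as where "d > 0"
      "c' \<approx> up d (star as)" "2 \<le> length as" "0 \<notin> set as" "balanced as" by blast
    then show ?thesis
    proof cases
      case (1 j)
      have "Graft s c \<approx> glue (path k) (path j)"
        unfolding t by (intro glue_reordering 1 2)
      also have "\<dots> = star [j, k]" by simp
      finally have *: "Graft s c \<approx> star [j, k]" .
      moreover have "balanced [j, k]"
        by (rule irreducible_star_balanced[OF irr[OF *]]) (use 1 2 in auto)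
      ultimately have "Graft s c \<approx> up 0 (star [j, k]) \<and> 2 \<le> length [j, k] \<and> 0 \<notin> set [j, k]
          \<and> balanced [j, k]"
        using 1 2 by simp
      then show ?thesis by blast
    next
      case b: (2 d as)
      have "Graft s c \<approx> glue c' s" unfolding t by (rule glue_commute)
      also have "\<dots> \<approx> glue (up d (star as)) (glue (path k) Root)"
        unfolding glue.simps by (intro glue_reordering 2 b)
      finally show ?thesis
        using not_irreducible_path_branch[OF irr] b 2 by blast
    qed
  next
    case (3 d as)
    then obtain a cs where as: "as = a # cs" "a > 0" by (cases as) auto
    from c' consider j where "j > 0" "c' \<approx> path j" | d as where "d > 0"
      "c' \<approx> up d (star as)" "2 \<le> length as" "0 \<notin> set as" "balanced as" by blast
    then show ?thesis
    proof cases
      case (1 j)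
      have *: "Graft s c \<approx> glue (up d (star as)) (path j)"
        unfolding t by (intro glue_reordering 1 3)
      show ?thesis
      proof (cases "d = 0")
        case True
        with * have *: "Graft s c \<approx> star (j # as)" by simp
        moreover have "balanced (j # as)"
          by (rule irreducible_star_balanced[OF irr[OF *]]) (use 1 3 in auto)
        ultimately have "Graft s c \<approx> up 0 (star (j # as)) \<and> 2 \<le> length (j # as) \<and> 0 \<notin> set (j # as)
            \<and> balanced (j # as)"
          using 1 3 by simp
        then show ?thesis by blast
      next
        case False
        from * have "irreducible_tree (glue (up d (star as)) (glue (path j) Root))"
          unfolding glue.simps by (rule irr)
        then show ?thesis
          using not_irreducible_path_branch 1 3 False by blast
      qed
    next
      case b: (2 d' bs)
      show ?thesis
      proof (cases "d = 0")
        case True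
        have "Graft s c \<approx> glue c' s" unfolding t by (rule glue_commute)
        also have "\<dots> \<approx> glue (up d' (star bs)) (star as)"
          using 3(1) b(2) True by (intro glue_reordering) auto
        also have "star as \<approx> glue (path a) (star cs)"
          unfolding as by (simp add: glue_commute)
        then have "glue (up d' (star bs)) (star as) \<approx> glue (up d' (star bs)) (glue (path a) (star cs))"
          by (rule glue_right_reordering)
        finally show ?thesis
          using not_irreducible_path_branch[OF irr] b as by blast
      next
        case False
        have "Graft s c \<approx> glue (up d (star as)) (up d' (star bs))"
          unfolding t by (intro glue_reordering b 3)
        then show ?thesis
          using not_irreducible_branch_branch[OF irr] b 3 False by blast
      qed
    qed
  qed
qed (auto intro: exI[of _ 0])

text \<open>The pair \<open>(e, b)\<close> of the cycle of length \<open>g\<close>; see \<open>has_eb_cycle\<close>.\<close>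

definition cycle_eb :: "nat \<Rightarrow> real poly \<times> real poly" where
  "cycle_eb g = (2 * (\<Sum>i<g. path_e i), path_e g)"

text \<open>If \<open>p\<close> is the pair of a base graph, gluing \<open>t\<close> to it yields e
  = \<open>fst p * poly_b t + snd p * poly_e t\<close> and b = \<open>snd p * poly_b t\<close>; this
  is their sum.\<close>

definition unicyclic_poly :: "real poly \<times> real poly \<Rightarrow> rtree \<Rightarrow> real poly" where
  "unicyclic_poly p t = fst p * poly_b t + snd p * poly_f t"

lemma unicyclic_poly_reordering: "s \<approx> t \<Longrightarrow> unicyclic_poly p s = unicyclic_poly p t"
  by (simp add: unicyclic_poly_def poly_b_e_reordering poly_f_reordering)

text \<open>The sum in \<open>cycle_eb\<close> telescopes, because \<open>path_b_eq\<close> writes X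
  times \<open>path_e\<close> as a difference of consecutive values of
  \<open>path_b\<close>.\<close>

lemma X_mult_cycle_eb: "g > 0 \<Longrightarrow> X * fst (cycle_eb g) = 2 * (path_b (g - 1) - 1)"
proof (induction g rule: nat_induct_non_zero)
  case (Suc g)
  then have "path_b g = X * path_e g + path_b (g - 1)"
    using path_b_eq[of "g - 1"] by simp
  with Suc show ?case by (simp add: cycle_eb_def algebra_simps)
qed (simp add: cycle_eb_def)

lemma path_b_e_at_0 [simp]: "poly (path_b k) 0 = 1" "poly (path_e k) 0 = real k"
  using poly_b_0[of "path k"] poly_e_0[of "path k"] by simp_all

lemma cycle_eb_at_0: "poly (fst (cycle_eb g)) 0 = real g * (real g - 1)" "poly (snd (cycle_eb g)) 0 = real g"
  by (induction g) (auto simp: cycle_eb_def algebra_simps)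

lemma nonneg_coeffs_cycle_eb [simp]: "nonneg_coeffs (fst (cycle_eb g))" "nonneg_coeffs (snd (cycle_eb g))"
  by (auto simp: cycle_eb_def)

lemma unicyclic_poly_up: "unicyclic_poly p (up d t) = unicyclic_poly (lift d p) t"
  by (simp add: unicyclic_poly_def lift_def poly_f_def poly_e_up poly_b_up algebra_simps)

text \<open>The subtree \<open>h\<close> slides along the edge between distances
  \<open>q + 1\<close> and \<open>q\<close> from the base graph. The sides of this edge are the base
  graph with a tail of length \<open>q\<close>, whose pair is \<open>lift q p\<close>, and the path
  of length \<open>a\<close>.\<close>

lemma unicyclic_poly_slide:
  "unicyclic_poly p (up (Suc q) (glue (path a) h)) - unicyclic_poly p (up q (glue (path (Suc a)) h))
     = X * poly_e h * cross (lift q p) (path_e a, path_b a)"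
proof -
  have "up (Suc q) (glue (path a) h) = up q (up 1 (glue (path a) h))"
    by (simp add: up_up del: up.simps)
  then show ?thesis
    by (simp only: unicyclic_poly_up[of p q])
      (simp add: unicyclic_poly_def poly_f_def poly_b_e_glue cross_def algebra_simps)
qed

text \<open>The common \<open>min q a\<close> edges cancel. If the tail is the longer one, the path
  shrinks to a single vertex with pair (0, 1), against which \<open>cross\<close> is just the first
  component.\<close>

lemma cross_lift_path:
  "cross (lift q p) (path_e a, path_b a) =
     (if q \<le> a then cross p (path_e (a - q), path_b (a - q)) else fst (lift (q - a) p))"
proof (cases "q \<le> a")
  case True
  then have "(path_e a, path_b a) = lift q (path_e (a - q), path_b (a - q))"
    using tree_eb_up[of q "path (a - q)"] by (simp add: up_up)
  with True show ?thesis by simp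
next
  case False
  then have "lift q p = lift a (lift (q - a) p)"
    by (simp add: lift_add[symmetric])
  moreover have "(path_e a, path_b a) = lift a (0, 1)"
    by (simp add: lift_def)
  ultimately have "cross (lift q p) (path_e a, path_b a) = cross (lift (q - a) p) (0, 1)"
    by simp
  with False show ?thesis by (simp add: cross_def)
qed

lemma nonneg_coeffs_path_b_diff: "nonneg_coeffs (path_b k - X * path_e k)"
  by (induction k) (auto simp: algebra_simps)

lemma nonneg_coeffs_lift: "nonneg_coeffs (fst p) \<Longrightarrow> nonneg_coeffs (snd p) \<Longrightarrow> nonneg_coeffs (fst (lift d p))"
  using nonneg_coeffs_path_b_diff by (auto simp: lift_def)

lemma nonneg_coeffs_path_b_minus_1: "nonneg_coeffs (path_b k - 1)"
proof -
  have "nonneg_coeffs (2 * (path_b k - 1))"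
    using X_mult_cycle_eb[of "Suc k"] by (metis diff_Suc_1 nonneg_coeffs_X_mult_iff nonneg_coeffs_cycle_eb(1) zero_less_Suc)
  then show ?thesis unfolding mult_2 nonneg_coeffs_def coeff_add by simp
qed

section \<open>Cycles versus paths\<close>

text \<open>Up to the term \<open>X e e' b\<close>, the polynomial is \<open>c (b - 1)\<^sup>2 + 2 b (c - 1)\<close>, where \<open>b\<close> and
  \<open>c\<close> belong to arcs of lengths \<open>k\<close> and \<open>m\<close> that together with one more edge form the cycle. Hence
  a cycle dominates every path with fewer edges.\<close>

lemma X_mult_cross_cycle:
  "X * cross (cycle_eb (Suc (k + m))) (path_e k, path_b k) =
     X * path_e k * path_e m * path_b k + path_b m * ((path_b k - 1) * (path_b k - 1))
       + 2 * path_b k * (path_b m - 1)"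
proof -
  let ?g = "Suc (k + m)"
  have "X * cross (cycle_eb ?g) (path_e k, path_b k) =
      X * fst (cycle_eb ?g) * path_b k - X * path_e k * path_e ?g"
    by (simp add: cross_def cycle_eb_def algebra_simps)
  \<comment> \<open>The last summand is zero by \<open>path_det\<close>. It is inserted so that,
    once the polynomials of the longer paths are expanded along the two arcs, only visibly
    nonnegative terms remain.\<close>
  also have "\<dots> = 2 * (path_b (k + m) - 1) * path_b k - X * path_e k * path_e ?g
      - path_b m * (path_b k * path_b k - X * path_e k * path_b k - X * path_e k * path_e k - 1)"
    by (simp add: path_det X_mult_cycle_eb)
  also have "\<dots> = X * path_e k * path_e m * path_b k + path_b m * ((path_b k - 1) * (path_b k - 1))
       + 2 * path_b k * (path_b m - 1)"
    by (simp add: path_e_add path_b_add algebra_simps)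
  finally show ?thesis .
qed

lemma nonneg_coeffs_cross_cycle:
  assumes "k < g" shows "nonneg_coeffs (cross (cycle_eb g) (path_e k, path_b k))"
proof -
  obtain m where g: "g = Suc (k + m)"
    using assms less_iff_Suc_add by auto
  have "nonneg_coeffs (X * cross (cycle_eb g) (path_e k, path_b k))"
    unfolding g X_mult_cross_cycle
    by (intro nonneg_coeffs_add nonneg_coeffs_mult nonneg_coeffs_path_b_minus_1) auto
  then show ?thesis by simp
qed

text \<open>At 0 the cross term equals g (g - 1 - k), which settles every case but
  \<open>k = g - 1\<close>. There \<open>X_mult_cross_cycle\<close> applies with
  \<open>m = 0\<close> and reduces to the square of \<open>path_b k - 1\<close>.\<close>

lemma cross_cycle_nonzero:
  assumes "k < g" "2 \<le> g" shows "cross (cycle_eb g) (path_e k, path_b k) \<noteq> 0"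
proof (cases "Suc k = g")
  case True
  have "poly (fst (cycle_eb g)) 0 \<noteq> 0"
    using assms by (simp add: cycle_eb_at_0)
  then have "path_b k \<noteq> 1"
    using X_mult_cycle_eb[of g] True by auto
  then show ?thesis
    using X_mult_cross_cycle[of k 0] True by auto
next
  case False
  then have "poly (cross (cycle_eb g) (path_e k, path_b k)) 0 \<noteq> 0"
    using assms by (simp add: cross_def cycle_eb_at_0)
  then show ?thesis by auto
qed

text \<open>Against a longer path, the comparison at \<open>0\<close> and the comparison of the leading coefficients
  have opposite signs.\<close>

lemma cross_cycle_at_0_neg:
  "g \<le> k \<Longrightarrow> 0 < g \<Longrightarrow> poly (cross (cycle_eb g) (path_e k, path_b k)) 0 < 0"
  by (simp add: cross_def cycle_eb_at_0 mult.commute)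

text \<open>The passage from the coefficientwise order to the linear order by leading
  coefficients.\<close>

lemma nonneg_coeffs_imp_nonneg: "nonneg_coeffs p \<Longrightarrow> 0 \<le> p"
  by (auto simp: nonneg_coeffs_def less_eq_poly_def pos_poly_def last_coeffs_eq_coeff_degree
      less_le)

lemma path_b_gt_2: "k > 0 \<Longrightarrow> path_b k > 2"
proof (induction k rule: nat_induct_non_zero)
  case 1
  have "X - 1 = [:-1, 1:]" by (simp add: X_def one_pCons)
  then have "0 < X - 1" by (simp add: less_poly_def pos_poly_def)
  then show ?case by simp
next
  case (Suc k)
  have "0 \<le> X * path_e (Suc k)"
    by (intro nonneg_coeffs_imp_nonneg) auto
  with Suc show ?case unfolding path_b_eq by linarith
qed

text \<open>With \<open>h = g - 1\<close> and \<open>m = k - g\<close>, \<open>path_det\<close>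
  eliminates the product of the two \<open>path_e\<close>, and X times the cross term becomes
  \<open>(path_b h - 2) * path_b k + path_b m\<close>. In the order by leading coefficients this is
  positive, since the nonconstant \<open>path_b h\<close> exceeds 2, a constant inherited from the
  factor in \<open>X_mult_cycle_eb\<close>.\<close>

lemma cross_cycle_pos:
  assumes "3 \<le> g" "g \<le> k"
  shows "0 < cross (cycle_eb g) (path_e k, path_b k)"
proof -
  obtain m where k: "k = g + m" using assms le_Suc_ex by blast
  obtain h where g: "g = Suc h" "h > 0" using assms by (cases g) auto
  have "X * path_e g * path_e k = path_b h * path_b k - path_b m *
     (path_b g * path_b g - X * path_e g * path_b g - X * path_e g * path_e g)"
    unfolding k path_e_add path_b_add by (simp add: g algebra_simps)
  also have "\<dots> = path_b h * path_b k - path_b m" by (simp only: path_det mult_1_right)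
  finally have xee: "X * path_e g * path_e k = path_b h * path_b k - path_b m" .
  have "X * cross (cycle_eb g) (path_e k, path_b k) =
      X * fst (cycle_eb g) * path_b k - X * path_e g * path_e k"
    by (simp add: cross_def cycle_eb_def algebra_simps)
  also have "\<dots> = (path_b h - 2) * path_b k + path_b m"
    unfolding xee using g by (simp add: X_mult_cycle_eb algebra_simps)
  finally have "X * cross (cycle_eb g) (path_e k, path_b k) = (path_b h - 2) * path_b k + path_b m" .
  moreover have "0 < (path_b h - 2) * path_b k + path_b m"
    using path_b_gt_2[OF g(2)] path_b_gt_2[of k] assms nonneg_coeffs_imp_nonneg[of "path_b m"]
    by (intro add_pos_nonneg mult_pos_pos) (auto intro: less_trans)
  moreover have "0 < X" by (simp add: X_def less_poly_def pos_poly_def)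
  ultimately show ?thesis by (metis zero_less_mult_pos)
qed

text \<open>The last tail edge is handed to the leg \<open>a\<close>, while all other legs slide one
  step towards the cycle. If \<open>q \<le> a\<close>, the cycle is compared with a path of length
  \<open>a - q < g\<close>; otherwise the cycle keeps a tail of \<open>q - a\<close> edges, and the
  first component of its pair is nonnegative.\<close>

lemma unicyclic_poly_shorten_tail:
  assumes "2 \<le> g" "2 \<le> length as" "0 \<notin> set as" "a \<in> set as" "a < g + q"
  shows "\<exists>t. num_edges t = Suc q + sum_list as \<and> num_leaves t = length as \<and>
    nonneg_coeffs (unicyclic_poly (cycle_eb g) (up (Suc q) (star as)) - unicyclic_poly (cycle_eb g) t) \<and>
    unicyclic_poly (cycle_eb g) t \<noteq> unicyclic_poly (cycle_eb g) (up (Suc q) (star as))"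
proof -
  let ?bs = "remove1 a as" and ?U = "unicyclic_poly (cycle_eb g)"
  let ?h = "star ?bs"
  let ?t = "up q (glue (path (Suc a)) ?h)"
  have ms: "mset as = mset (a # ?bs)"
    using assms(4) by simp
  have "star as \<approx> star (a # ?bs)" by (rule star_reordering[OF ms])
  also have "\<dots> \<approx> glue (path a) ?h" by (simp add: glue_commute)
  finally have r: "star as \<approx> glue (path a) ?h" .
  have "?U (up (Suc q) (star as)) = ?U (up (Suc q) (glue (path a) ?h))"
    by (intro unicyclic_poly_reordering reordering_up r)
  then have eq: "?U (up (Suc q) (star as)) - ?U ?t =
      X * poly_e ?h * cross (lift q (cycle_eb g)) (path_e a, path_b a)"
    by (simp only: unicyclic_poly_slide)
  have ne: "?bs \<noteq> []"
    using assms(2,4) by (metis One_nat_def Suc_1 Suc_n_not_le_n length_0_conv length_remove1 Suc_pred diff_is_0_eq le_trans nat_le_linear)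
  have z: "0 \<notin> set ?bs" "a \<noteq> 0" using assms(3,4) by (auto dest: notin_set_remove1 intro!: gr0I)
  have h: "?h \<noteq> Root"
    using num_leaves_star[OF z(1)] ne by (metis length_0_conv num_leaves_eq_0_iff)
  have "nonneg_coeffs (cross (lift q (cycle_eb g)) (path_e a, path_b a)) \<and>
      cross (lift q (cycle_eb g)) (path_e a, path_b a) \<noteq> 0"
  proof (cases "q \<le> a")
    case True
    then have "a - q < g" using assms by simp
    with True assms(1) show ?thesis
      by (simp add: cross_lift_path nonneg_coeffs_cross_cycle cross_cycle_nonzero)
  next
    case False
    have "poly (fst (lift (q - a) (cycle_eb g))) 0 > 0"
      using assms(1) False by (simp add: lift_def cycle_eb_at_0 add_pos_pos)
    then show ?thesis
      using False by (auto simp: cross_lift_path nonneg_coeffs_lift)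
  qed
  then have "nonneg_coeffs (?U (up (Suc q) (star as)) - ?U ?t)"
    "?U (up (Suc q) (star as)) - ?U ?t \<noteq> 0"
    unfolding eq using h by (auto simp: poly_e_nonzero)
  moreover have "num_edges ?t = Suc q + sum_list as" "num_leaves ?t = length as"
    using assms(4) num_edges_reordering[OF r] num_leaves_reordering[OF r] num_leaves_star[OF assms(3)]
      z h
    by (simp_all add: num_leaves_up)
  ultimately show ?thesis by (metis eq_iff_diff_eq_0)
qed

text \<open>The same slide with a leg too long for the cycle. The difference is
  \<open>X * W\<close>, so the constant coefficients agree and coefficient 1 is the lowest that can
  differ; its sign is that of \<open>W\<close> at 0. The first claim is about leading coefficients,
  and the two point in opposite directions.\<close>

lemma unicyclic_poly_lengthen_tail:
  fixes U :: "rtree \<Rightarrow> real poly" and g :: nat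
  defines "U \<equiv> unicyclic_poly (cycle_eb g)"
  assumes "3 \<le> g" "as \<noteq> []" "0 \<notin> set as" "g + q \<le> a"
  shows "U (up q (star (Suc a # as))) < U (up (Suc q) (star (a # as)))" (is ?th1)
    and "coeff (U (up (Suc q) (star (a # as)))) 1 < coeff (U (up q (star (Suc a # as)))) 1" (is ?th2)
proof -
  let ?h = "star as"
  define W where "W = poly_e ?h * cross (lift q (cycle_eb g)) (path_e a, path_b a)"
  have h: "?h \<noteq> Root"
    using num_leaves_star[of as] assms by (metis length_0_conv num_leaves_eq_0_iff)
  have "U (up q (star (Suc a # as))) = U (up q (glue (path (Suc a)) ?h))"
    "U (up (Suc q) (star (a # as))) = U (up (Suc q) (glue (path a) ?h))"
    unfolding U_def star.simps
    by (rule unicyclic_poly_reordering, rule reordering_up, rule glue_commute)+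
  then have eq: "U (up (Suc q) (star (a # as))) - U (up q (star (Suc a # as))) = X * W"
    unfolding U_def W_def by (simp only: unicyclic_poly_slide mult.assoc)
  have cross: "cross (lift q (cycle_eb g)) (path_e a, path_b a)
      = cross (cycle_eb g) (path_e (a - q), path_b (a - q))"
    using assms by (simp add: cross_lift_path)
  have "g \<le> a - q" using assms by linarith
  then have "0 < cross (cycle_eb g) (path_e (a - q), path_b (a - q))"
    and neg: "poly (cross (cycle_eb g) (path_e (a - q), path_b (a - q))) 0 < 0"
    using assms by (auto intro: cross_cycle_pos cross_cycle_at_0_neg)
  moreover have "0 < poly_e ?h"
    using nonneg_coeffs_imp_nonneg[of "poly_e ?h"] poly_e_nonzero[OF h] by simp
  moreover have "0 < X" by (simp add: X_def less_poly_def pos_poly_def)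
  ultimately have "0 < X * W" unfolding W_def cross by simp
  with eq show ?th1 by (metis diff_gt_0_iff_gt)
  have "num_edges ?h \<noteq> 0" using h num_leaves_eq_0_iff[of ?h] by (cases ?h) auto
  then have "poly W 0 < 0"
    unfolding W_def cross using neg by (simp add: mult_less_0_iff del: num_edges_star)
  then have "coeff (X * W) 1 < 0" by (simp add: coeff_X_mult poly_0_coeff_0[symmetric])
  then show ?th2 unfolding eq[symmetric] by simp
qed

section \<open>Determinants indexed by a finite set\<close>

text \<open>Indexing by an arbitrary finite set allows vertices to be deleted and blocks to be split
  off without renumbering.\<close>

definition det_on :: "'a set \<Rightarrow> ('a \<Rightarrow> 'a \<Rightarrow> 'b :: comm_ring_1) \<Rightarrow> 'b" where
  "det_on V m = (\<Sum>p | p permutes V. of_int (sign p) * (\<Prod>i\<in>V. m i (p i)))"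

lemma det_on_cong:
  assumes "\<And>i j. i \<in> V \<Longrightarrow> j \<in> V \<Longrightarrow> m i j = m' i j"
  shows "det_on V m = det_on V m'"
  unfolding det_on_def
  by (intro sum.cong arg_cong2[of _ _ _ _ "(*)"] prod.cong refl)
     (auto simp: assms permutes_in_image)

lemma det_on_empty [simp]: "det_on {} m = 1"
  by (simp add: det_on_def)

lemma det_on_singleton [simp]: "det_on {v} m = m v v"
proof -
  have "{p. p permutes {v}} = {id}" by auto
  then show ?thesis by (simp add: det_on_def)
qed

lemma det_on_expand_row:
  assumes "finite V" "r \<in> V"
  shows "det_on V (m(r := f)) =
    (\<Sum>p | p permutes V. of_int (sign p) * (\<Prod>i\<in>V - {r}. m i (p i)) * f (p r))"
proof -
  have "(\<Prod>i\<in>V. (m(r := f)) i (p i)) = f (p r) * (\<Prod>i\<in>V - {r}. m i (p i))" for p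
    using assms by (subst prod.remove[of _ r]) (auto intro!: prod.cong)
  then show ?thesis by (simp add: det_on_def mult_ac)
qed

lemma det_on_row_add:
  assumes "finite V" "r \<in> V"
  shows "det_on V (m(r := (\<lambda>j. f j + g j))) = det_on V (m(r := f)) + det_on V (m(r := g))"
  unfolding det_on_expand_row[OF assms] by (simp add: algebra_simps sum.distrib)

lemma det_on_row_diff:
  assumes "finite V" "r \<in> V"
  shows "det_on V (m(r := (\<lambda>j. f j - g j))) = det_on V (m(r := f)) - det_on V (m(r := g))"
  unfolding det_on_expand_row[OF assms] by (simp add: algebra_simps sum_subtractf)

lemma det_on_row_zero:
  assumes "finite V" "r \<in> V" "\<And>j. j \<in> V \<Longrightarrow> m r j = 0"
  shows "det_on V m = 0"
proof -
  have "det_on V m = det_on V (m(r := m r))" by simp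
  also have "\<dots> = 0"
    unfolding det_on_expand_row[OF assms(1,2)]
    using assms by (intro sum.neutral) (simp add: permutes_in_image)
  finally show ?thesis .
qed

lemma det_on_swap_rows:
  assumes "finite V" "r \<in> V" "s \<in> V" "r \<noteq> s"
  shows "det_on V (\<lambda>i. m (transpose r s i)) = - det_on V m"
proof -
  let ?t = "transpose r s"
  have t: "?t permutes V" using assms by (intro permutes_swap_id)
  have "det_on V m = (\<Sum>p | p permutes V. of_int (sign (p \<circ> ?t)) * (\<Prod>i\<in>V. m i ((p \<circ> ?t) i)))"
    unfolding det_on_def by (rule sum_permutations_compose_right[OF t])
  also have "\<dots> = (\<Sum>p | p permutes V. - (of_int (sign p) * (\<Prod>i\<in>V. m (?t i) (p i))))"
  proof (intro sum.cong refl)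
    fix p assume "p \<in> {p. p permutes V}"
    then have "permutation p" using assms(1) permutation_permutes by blast
    then have s: "sign (p \<circ> ?t) = - sign p"
      using assms(4) by (simp add: sign_compose permutation_swap_id sign_swap_id)
    have "(\<Prod>i\<in>V. m i ((p \<circ> ?t) i)) = (\<Prod>i\<in>V. m (?t i) ((p \<circ> ?t) (?t i)))"
      by (rule prod.permute[OF t, unfolded o_def])
    then show "of_int (sign (p \<circ> ?t)) * (\<Prod>i\<in>V. m i ((p \<circ> ?t) i)) =
        - (of_int (sign p) * (\<Prod>i\<in>V. m (?t i) (p i)))"
      by (simp add: s)
  qed
  finally show ?thesis by (simp add: det_on_def sum_negf)
qed

text \<open>Exchanging the equal rows shows that the determinant is its own negative. Cancelling the
  resulting factor 2 is the reason for the concrete entry type \<open>real poly\<close>.\<close>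

lemma det_on_equal_rows:
  fixes m :: "'a \<Rightarrow> 'a \<Rightarrow> real poly"
  assumes "finite V" "r \<in> V" "s \<in> V" "r \<noteq> s" "m r = m s"
  shows "det_on V m = 0"
proof -
  have "(\<lambda>i. m (transpose r s i)) = m"
    using assms(5) by (auto simp: transpose_def)
  with det_on_swap_rows[OF assms(1-4), of m] have "det_on V m = - det_on V m" by simp
  then have "det_on V m + det_on V m = 0" by simp
  then show ?thesis by (simp add: mult_2[symmetric])
qed

text \<open>Permutations that send some element of \<open>V\<close> into \<open>W\<close> contribute
  0. The others preserve both blocks and factor uniquely into a permutation of \<open>V\<close> and
  one of \<open>W\<close>.\<close>

lemma det_on_block:
  assumes fin: "finite V" "finite W" and disj: "V \<inter> W = {}"
    and zero: "\<And>i j. i \<in> V \<Longrightarrow> j \<in> W \<Longrightarrow> m i j = 0"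
  shows "det_on (V \<union> W) m = det_on V m * det_on W m"
proof -
  define P where "P = {p. p permutes V \<union> W \<and> p ` V \<subseteq> V}"
  let ?f = "\<lambda>p. of_int (sign p) * (\<Prod>i\<in>V \<union> W. m i (p i))"
  have "bij_betw (\<lambda>(p, q). p \<circ> q) ({p. p permutes V} \<times> {q. q permutes W}) P"
  proof (rule bij_betwI[where g = "\<lambda>p. (restrict_id p V, restrict_id p W)"])
    show "(\<lambda>(p, q). p \<circ> q) \<in> {p. p permutes V} \<times> {q. q permutes W} \<rightarrow> P"
    proof clarify
      fix p q assume p: "p permutes V" and q: "q permutes W"
      have "q i = i" if "i \<in> V" for i
        using that disj q by (meson disjoint_iff permutes_not_in)
      then have "(p \<circ> q) ` V \<subseteq> V"
        using p by (auto simp: permutes_in_image)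
      moreover have "p \<circ> q permutes V \<union> W"
        using p q by (intro permutes_compose) (auto intro: permutes_subset)
      ultimately show "p \<circ> q \<in> P" by (simp add: P_def)
    qed
    show "(\<lambda>p. (restrict_id p V, restrict_id p W)) \<in> P \<rightarrow> {p. p permutes V} \<times> {q. q permutes W}"
    proof
      fix p assume "p \<in> P"
      then have p: "p permutes V \<union> W" "p ` V \<subseteq> V" by (auto simp: P_def)
      have inj: "inj p" using p by (simp add: permutes_inj)
      then have V: "p ` V = V"
        using p fin by (meson endo_inj_surj inj_on_subset subset_UNIV)
      have "p ` W \<subseteq> W"
      proof
        fix y assume "y \<in> p ` W"
        then obtain x where x: "x \<in> W" "y = p x" by auto
        then have "y \<in> V \<union> W" using permutes_in_image[OF p(1), of x] by simp
        moreover have "y \<notin> V"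
        proof
          assume "y \<in> V"
          then obtain z where "z \<in> V" "p z = p x" using V x by (metis imageE)
          with inj x disj show False by (metis disjoint_iff injD)
        qed
        ultimately show "y \<in> W" by simp
      qed
      with inj fin have "p ` W = W"
        by (meson endo_inj_surj inj_on_subset subset_UNIV)
      with V inj have "bij_betw p V V" "bij_betw p W W"
        by (auto simp: bij_betw_def intro: inj_on_subset)
      then show "(restrict_id p V, restrict_id p W) \<in> {p. p permutes V} \<times> {q. q permutes W}"
        by (simp add: permutes_restrict_id)
    qed
    show "(restrict_id (case x of (p, q) \<Rightarrow> p \<circ> q) V, restrict_id (case x of (p, q) \<Rightarrow> p \<circ> q) W) = x"
      if *: "x \<in> {p. p permutes V} \<times> {q. q permutes W}" for x
    proof -
      obtain p q where x: "x = (p, q)" "p permutes V" "q permutes W" using * by auto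
      have "p i = i" if "i \<notin> V" for i using x that by (meson permutes_not_in)
      moreover have "q i = i" if "i \<notin> W" for i using x that by (meson permutes_not_in)
      moreover have "q i \<in> W" if "i \<in> W" for i using x that by (simp add: permutes_in_image)
      ultimately show ?thesis
        using disj x(1) by (auto simp: restrict_id_def fun_eq_iff) (metis disjoint_iff)+
    qed
    show "(case (restrict_id p V, restrict_id p W) of (p, q) \<Rightarrow> p \<circ> q) = p" if "p \<in> P" for p
    proof -
      have p: "p permutes V \<union> W" "p ` V \<subseteq> V" using that by (auto simp: P_def)
      have inj: "inj p" using p by (simp add: permutes_inj)
      then have V: "p ` V = V"
        using p fin by (meson endo_inj_surj inj_on_subset subset_UNIV)
      have "p x \<notin> V" if "x \<in> W" for x
        using that V inj disj by (metis disjoint_iff imageE injD)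
      moreover have "p x = x" if "x \<notin> V" "x \<notin> W" for x
        using that p by (meson UnE permutes_not_in)
      ultimately show ?thesis
        by (auto simp: restrict_id_def fun_eq_iff)
    qed
  qed
  note bij = this
  have "det_on (V \<union> W) m = sum ?f P"
    unfolding det_on_def
  proof (rule sum.mono_neutral_right)
    show "finite {p. p permutes V \<union> W}" using fin by (intro finite_permutations) auto
    show "\<forall>p\<in>{p. p permutes V \<union> W} - P. ?f p = 0"
    proof
      fix p assume "p \<in> {p. p permutes V \<union> W} - P"
      then obtain i where i: "i \<in> V" "p i \<notin> V" and p: "p permutes V \<union> W" by (auto simp: P_def)
      then have "p i \<in> W" using permutes_in_image[OF p, of i] by auto
      with zero i have "m i (p i) = 0" by blast
      then have "(\<Prod>i\<in>V \<union> W. m i (p i)) = 0" using fin i by (intro prod_zero) auto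
      then show "?f p = 0" by simp
    qed
  qed (auto simp: P_def)
  also have "\<dots> = (\<Sum>x\<in>{p. p permutes V} \<times> {q. q permutes W}. ?f (case x of (p, q) \<Rightarrow> p \<circ> q))"
    by (rule sum.reindex_bij_betw[OF bij, symmetric])
  also have "\<dots> = (\<Sum>(p, q)\<in>{p. p permutes V} \<times> {q. q permutes W}.
      (of_int (sign p) * (\<Prod>i\<in>V. m i (p i))) * (of_int (sign q) * (\<Prod>i\<in>W. m i (q i))))"
  proof (intro sum.cong refl, clarify)
    fix p q assume p: "p permutes V" and q: "q permutes W"
    have s: "sign (p \<circ> q) = sign p * sign q"
      using p q fin by (meson permutation_permutes sign_compose)
    have "(\<Prod>i\<in>V \<union> W. m i ((p \<circ> q) i)) = (\<Prod>i\<in>V. m i ((p \<circ> q) i)) * (\<Prod>i\<in>W. m i ((p \<circ> q) i))"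
      using fin disj by (rule prod.union_disjoint)
    also have "(\<Prod>i\<in>V. m i ((p \<circ> q) i)) = (\<Prod>i\<in>V. m i (p i))"
      using q disj by (intro prod.cong refl) (simp add: disjoint_iff permutes_not_in[OF q])
    also have "(\<Prod>i\<in>W. m i ((p \<circ> q) i)) = (\<Prod>i\<in>W. m i (q i))"
      using p q disj by (intro prod.cong refl) (metis comp_apply disjoint_iff permutes_in_image permutes_not_in)
    finally show "of_int (sign (p \<circ> q)) * (\<Prod>i\<in>V \<union> W. m i ((p \<circ> q) i)) =
        of_int (sign p) * (\<Prod>i\<in>V. m i (p i)) * (of_int (sign q) * (\<Prod>i\<in>W. m i (q i)))"
      by (simp add: s)
  qed
  also have "\<dots> = det_on V m * det_on W m"
    by (simp add: det_on_def sum_product sum.cartesian_product)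
  finally show ?thesis .
qed

definition unit_row :: "'a \<Rightarrow> 'a \<Rightarrow> 'b :: comm_ring_1" where
  "unit_row s = (\<lambda>j. if j = s then 1 else 0)"

lemma det_on_unit_row:
  assumes "finite V" "r \<in> V"
  shows "det_on V (m(r := unit_row r)) = det_on (V - {r}) m"
proof -
  have "det_on ({r} \<union> (V - {r})) (m(r := unit_row r)) =
      det_on {r} (m(r := unit_row r)) * det_on (V - {r}) (m(r := unit_row r))"
    using assms by (intro det_on_block) (auto simp: unit_row_def)
  moreover have "det_on (V - {r}) (m(r := unit_row r)) = det_on (V - {r}) m"
    by (rule det_on_cong) auto
  ultimately show ?thesis using assms by (simp add: insert_absorb unit_row_def)
qed

text \<open>A new edge between \<open>r\<close> and \<open>s\<close> adds to row \<open>r\<close>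
  the same vector that it subtracts from row \<open>s\<close>. When both rows are expanded, the term
  in which both are this vector vanishes; what remains are the two minors and two off-diagonal
  terms.\<close>

lemma det_on_rank_one_update:
  fixes m :: "'a \<Rightarrow> 'a \<Rightarrow> real poly"
  assumes "finite V" "r \<in> V" "s \<in> V" "r \<noteq> s"
  shows "det_on V (m(r := (\<lambda>j. m r j + (unit_row r j - unit_row s j)),
                     s := (\<lambda>j. m s j - (unit_row r j - unit_row s j)))) =
    det_on V m + det_on (V - {r}) m + det_on (V - {s}) m
      - det_on V (m(r := unit_row s)) - det_on V (m(s := unit_row r))"
    (is "det_on V (m(r := ?r, s := (\<lambda>j. m s j - ?b j))) = _")
proof -
  have upd: "m(r := ?r, s := m s) = m(r := ?r)" "m(r := ?r, s := ?b) = m(s := ?b, r := ?r)"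
    "m(s := ?b, r := m r) = m(s := ?b)"
    using assms by (simp_all add: fun_upd_twist fun_upd_idem_iff)
  have "det_on V (m(r := ?r, s := (\<lambda>j. m s j - ?b j))) =
      det_on V (m(r := ?r, s := m s)) - det_on V (m(r := ?r, s := ?b))"
    using assms by (intro det_on_row_diff)
  moreover have "det_on V (m(r := ?r)) = det_on V (m(r := m r)) + det_on V (m(r := ?b))"
    using assms by (intro det_on_row_add)
  moreover have "det_on V (m(s := ?b, r := ?r)) =
      det_on V (m(s := ?b, r := m r)) + det_on V (m(s := ?b, r := ?b))"
    using assms by (intro det_on_row_add)
  moreover have "det_on V (m(s := ?b, r := ?b)) = 0"
    using assms by (intro det_on_equal_rows[of _ r s]) auto
  moreover have "det_on V (m(r := ?b)) = det_on V (m(r := unit_row r)) - det_on V (m(r := unit_row s))"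
    using assms by (intro det_on_row_diff)
  moreover have "det_on V (m(s := ?b)) = det_on V (m(s := unit_row r)) - det_on V (m(s := unit_row s))"
    using assms by (intro det_on_row_diff)
  moreover note det_on_unit_row[OF assms(1,2), of m] det_on_unit_row[OF assms(1,3), of m]
  ultimately show ?thesis
    unfolding upd fun_upd_triv by (simp only:) algebra
qed

text \<open>Joining two blocks by an edge is a rank one update of the Laplacian.\<close>

lemma det_on_join:
  fixes m :: "'a \<Rightarrow> 'a \<Rightarrow> real poly"
  assumes fin: "finite V" "finite W" and disj: "V \<inter> W = {}" and rs: "r \<in> V" "s \<in> W"
    and zero: "\<And>i j. i \<in> V \<Longrightarrow> j \<in> W \<Longrightarrow> m i j = 0" "\<And>i j. i \<in> W \<Longrightarrow> j \<in> V \<Longrightarrow> m i j = 0"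
  shows "det_on (V \<union> W) (m(r := (\<lambda>j. m r j + (unit_row r j - unit_row s j)),
                     s := (\<lambda>j. m s j - (unit_row r j - unit_row s j)))) =
    det_on V m * det_on W m + det_on (V - {r}) m * det_on W m + det_on V m * det_on (W - {s}) m"
proof -
  have "det_on (V \<union> W) (m(r := unit_row s)) = 0"
  proof -
    have "det_on (W \<union> V) (m(r := unit_row s)) =
        det_on W (m(r := unit_row s)) * det_on V (m(r := unit_row s))"
      using fin disj rs zero by (intro det_on_block) auto
    moreover have "det_on V (m(r := unit_row s)) = 0"
      using fin disj rs by (intro det_on_row_zero[of _ r]) (auto simp: unit_row_def)
    ultimately show ?thesis by (simp add: Un_commute)
  qed
  moreover have "det_on (V \<union> W) (m(s := unit_row r)) = 0"
  proof -
    have "det_on (V \<union> W) (m(s := unit_row r)) =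
        det_on V (m(s := unit_row r)) * det_on W (m(s := unit_row r))"
      using fin disj rs zero by (intro det_on_block) auto
    moreover have "det_on W (m(s := unit_row r)) = 0"
      using fin disj rs by (intro det_on_row_zero[of _ s]) (auto simp: unit_row_def)
    ultimately show ?thesis by simp
  qed
  moreover have "det_on (V \<union> W) m = det_on V m * det_on W m"
    using fin disj zero by (intro det_on_block) auto
  moreover have "V \<union> W - {r} = (V - {r}) \<union> W" "V \<union> W - {s} = V \<union> (W - {s})"
    using disj rs by auto
  moreover have "det_on ((V - {r}) \<union> W) m = det_on (V - {r}) m * det_on W m"
    using fin disj zero by (intro det_on_block) auto
  moreover have "det_on (V \<union> (W - {s})) m = det_on V m * det_on (W - {s}) m"
    using fin disj zero by (intro det_on_block) auto
  moreover have "r \<noteq> s" using disj rs by auto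
  ultimately show ?thesis
    using fin rs by (subst det_on_rank_one_update) auto
qed

text \<open>Along the path the matrix is upper Hessenberg. Exchanging the first two rows splits off
  the first vertex with diagonal entry -1, and this sign cancels that of the exchange.\<close>

lemma det_on_path_corner:
  fixes m :: "'a \<Rightarrow> 'a \<Rightarrow> 'b :: comm_ring_1"
  assumes "distinct vs" "vs \<noteq> []"
    and "\<And>i. Suc i < length vs \<Longrightarrow> m (vs ! Suc i) (vs ! i) = - 1"
    and "\<And>i j. Suc j < i \<Longrightarrow> i < length vs \<Longrightarrow> m (vs ! i) (vs ! j) = 0"
  shows "det_on (set vs) (m(hd vs := unit_row (last vs))) = 1"
  using assms
proof (induction vs rule: induct_list012)
  case (2 v)
  then show ?case by (simp add: unit_row_def)
next
  case (3 v w vs)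
  let ?l = "last (w # vs)" and ?V = "set (w # vs)"
  let ?m = "m(v := m w, w := unit_row ?l)"
  have vw: "v \<noteq> w" "v \<notin> set (w # vs)" "v \<noteq> ?l" using "3.prems"(1) by auto
  have "det_on (set (v # w # vs)) (m(v := unit_row ?l)) =
      - det_on (set (v # w # vs)) (\<lambda>i. (m(v := unit_row ?l)) (transpose v w i))"
    using vw by (subst det_on_swap_rows) auto
  also have "det_on (set (v # w # vs)) (\<lambda>i. (m(v := unit_row ?l)) (transpose v w i)) =
      det_on (?V \<union> {v}) ?m"
    by (rule arg_cong2[of _ _ _ _ det_on]) (use vw in \<open>auto simp: transpose_def fun_eq_iff\<close>)
  also have "\<dots> = det_on ?V ?m * det_on {v} ?m"
  proof (rule det_on_block)
    fix i j assume i: "i \<in> ?V" and j: "j \<in> {v}"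
    show "?m i j = 0"
    proof (cases "i = w")
      case True
      then show ?thesis using j vw by (simp add: unit_row_def)
    next
      case False
      with i obtain k where k: "k < length vs" "i = vs ! k" by (auto simp: in_set_conv_nth)
      have "m i v = 0" using "3.prems"(4)[of 0 "Suc (Suc k)"] k by simp
      then show ?thesis using False i j vw by auto
    qed
  qed (use vw in auto)
  also have "det_on ?V ?m = det_on ?V (m(w := unit_row ?l))"
    by (rule det_on_cong) (use vw in auto)
  also have "\<dots> = 1"
  proof -
    have "m ((w # vs) ! Suc i) ((w # vs) ! i) = - 1" if "Suc i < length (w # vs)" for i
      using "3.prems"(3)[of "Suc i"] that by simp
    moreover have "m ((w # vs) ! i) ((w # vs) ! j) = 0" if "Suc j < i" "i < length (w # vs)" for i j
      using "3.prems"(4)[of "Suc j" "Suc i"] that by simp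
    ultimately have "det_on ?V (m(hd (w # vs) := unit_row ?l)) = 1"
      using "3.prems"(1) by (intro "3.IH"(2)) auto
    then show ?thesis unfolding list.sel .
  qed
  also have "det_on {v} ?m = - 1"
    using vw "3.prems"(3)[of 0] by simp
  finally show ?case by simp
qed simp

section \<open>Hanging trees on graphs\<close>

text \<open>\<open>attach U F r t V E\<close>: the graph \<open>(V, E)\<close> arises from the graph \<open>(U, F)\<close> by hanging a copy of
  the tree \<open>t\<close> at the vertex \<open>r\<close>.\<close>

inductive attach :: "'a set \<Rightarrow> 'a set set \<Rightarrow> 'a \<Rightarrow> rtree \<Rightarrow> 'a set \<Rightarrow> 'a set set \<Rightarrow> bool" where
  attach_Root: "attach U F r Root U F"
| attach_Graft: "attach U F r s V E \<Longrightarrow> attach {v} {} v t W D \<Longrightarrow> V \<inter> W = {} \<Longrightarrow>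
    attach U F r (Graft s t) (V \<union> W) (insert {r, v} (E \<union> D))"

inductive_cases attach_RootE: "attach U F r Root V E"
inductive_cases attach_GraftE: "attach U F r (Graft s t) V E"

abbreviation tree_at :: "rtree \<Rightarrow> 'a \<Rightarrow> 'a set \<Rightarrow> 'a set set \<Rightarrow> bool" where
  "tree_at t r \<equiv> attach {r} {} r t"

lemma simple_graphD:
  assumes "simple_graph (V, E)"
  shows "finite V" "e \<in> E \<Longrightarrow> e \<subseteq> V" "e \<in> E \<Longrightarrow> card e = 2" "finite E"
proof -
  show "finite V" "e \<in> E \<Longrightarrow> e \<subseteq> V" "e \<in> E \<Longrightarrow> card e = 2"
    using assms by (auto simp: simple_graph_def)
  have "E \<subseteq> Pow V" using assms by (auto simp: simple_graph_def)
  then show "finite E" using \<open>finite V\<close> by (meson finite_Pow_iff finite_subset)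
qed

lemma simple_graph_singleton [simp]: "simple_graph ({v}, {})"
  by (simp add: simple_graph_def)

lemma simple_graph_join:
  assumes "simple_graph (V, E)" "simple_graph (W, D)" "V \<inter> W = {}" "r \<in> V" "v \<in> W"
  shows "simple_graph (V \<union> W, insert {r, v} (E \<union> D))"
proof -
  have "r \<noteq> v" using assms by auto
  then show ?thesis using assms by (auto simp: simple_graph_def)
qed

lemma attach_simple:
  assumes "attach U F r t V E" "simple_graph (U, F)" "r \<in> U"
  shows "simple_graph (V, E)" "U \<subseteq> V" "F \<subseteq> E"
proof -
  have "simple_graph (V, E) \<and> U \<subseteq> V \<and> F \<subseteq> E"
    using assms
  proof (induction rule: attach.induct)
    case (attach_Graft U F r s V E v t W D)
    then have "simple_graph (V \<union> W, insert {r, v} (E \<union> D))"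
      by (intro simple_graph_join) auto
    with attach_Graft show ?case by auto
  qed auto
  then show "simple_graph (V, E)" "U \<subseteq> V" "F \<subseteq> E" by auto
qed

lemma tree_at_simple:
  assumes "tree_at t r V E" shows "simple_graph (V, E)" "r \<in> V"
  using attach_simple[OF assms] by auto

lemma card_attach:
  assumes "attach U F r t V E" "simple_graph (U, F)" "r \<in> U"
  shows "card V = card U + num_edges t"
  using assms
proof (induction rule: attach.induct)
  case (attach_Graft U F r s V E v t W D)
  then have "finite V" "finite W" using attach_simple(1) simple_graphD(1) tree_at_simple(1) by metis+
  with attach_Graft show ?case by (simp add: card_Un_disjoint)
qed auto

lemma vertex_degree_join:
  assumes "simple_graph (V, E)" "simple_graph (W, D)" "V \<inter> W = {}" "r \<in> V" "v \<in> W"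
  shows "x \<in> V \<Longrightarrow> vertex_degree (A, insert {r, v} (E \<union> D)) x =
      vertex_degree (B, E) x + (if x = r then 1 else 0)"
    and "x \<in> W \<Longrightarrow> vertex_degree (A, insert {r, v} (E \<union> D)) x =
      vertex_degree (C, D) x + (if x = v then 1 else 0)"
proof -
  let ?E = "insert {r, v} (E \<union> D)"
  have E: "e \<subseteq> V" if "e \<in> E" for e using simple_graphD(2)[OF assms(1) that] .
  have D: "e \<subseteq> W" if "e \<in> D" for e using simple_graphD(2)[OF assms(2) that] .
  have fin: "finite {e \<in> E. x \<in> e}" "finite {e \<in> D. x \<in> e}" for x
    using simple_graphD(4)[OF assms(1)] simple_graphD(4)[OF assms(2)] by auto
  have new: "{r, v} \<notin> E" "{r, v} \<notin> D" using E D assms(3-5) by blast+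
  show "vertex_degree (A, ?E) x = vertex_degree (B, E) x + (if x = r then 1 else 0)" if "x \<in> V"
  proof -
    have "{e \<in> ?E. x \<in> e} = (if x = r then insert {r, v} {e \<in> E. x \<in> e} else {e \<in> E. x \<in> e})"
      using that D assms(3-5) by auto
    then show ?thesis using fin new by (simp add: vertex_degree_def)
  qed
  show "vertex_degree (A, ?E) x = vertex_degree (C, D) x + (if x = v then 1 else 0)" if "x \<in> W"
  proof -
    have "{e \<in> ?E. x \<in> e} = (if x = v then insert {r, v} {e \<in> D. x \<in> e} else {e \<in> D. x \<in> e})"
      using that E assms(3-5) by auto
    then show ?thesis using fin new by (simp add: vertex_degree_def)
  qed
qed

lemma vertex_degree_attach_root:
  assumes "attach U F r t V E" "simple_graph (U, F)" "r \<in> U"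
  shows "vertex_degree (A, E) r \<ge> vertex_degree (B, F) r + (if t = Root then 0 else 1)"
  using assms
proof (induction arbitrary: A rule: attach.induct)
  case (attach_Root U F r)
  then show ?case by (simp add: vertex_degree_def)
next
  case (attach_Graft U F r s V E v t W D)
  have V: "simple_graph (V, E)" "r \<in> V" and W: "simple_graph (W, D)" "v \<in> W"
    using attach_Graft attach_simple[of U F r s V E] tree_at_simple[of v t W D] by auto
  have "vertex_degree (A, insert {r, v} (E \<union> D)) r = vertex_degree (A, E) r + 1"
    using vertex_degree_join(1)[OF V(1) W(1) attach_Graft(3) V(2) W(2) V(2)] by simp
  moreover have "vertex_degree (B, F) r \<le> vertex_degree (A, E) r"
    using attach_Graft.IH(1)[OF attach_Graft.prems, of A] by linarith
  ultimately show ?case by simp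
qed

lemma vertex_degree_tree_root:
  assumes "tree_at t r V E" shows "vertex_degree (A, E) r = 0 \<longleftrightarrow> t = Root"
proof (cases t)
  case Root
  with assms show ?thesis by (auto simp: vertex_degree_def elim: attach_RootE)
next
  case (Graft s u)
  then show ?thesis using vertex_degree_attach_root[OF assms, of A A] by auto
qed

text \<open>The root is left out on both sides because its degree changes with every child. The
  joining edge adds 1 to the degree of \<open>v\<close>, which thereby becomes a leaf exactly when
  \<open>t = Root\<close>.\<close>

lemma leaves_attach:
  assumes "attach U F r t V E" "simple_graph (U, F)" "r \<in> U"
  shows "card (leaves (V, E) - {r}) = card (leaves (U, F) - {r}) + num_leaves t"
  using assms
proof (induction rule: attach.induct)
  case (attach_Graft U F r s V E v t W D)
  let ?E = "insert {r, v} (E \<union> D)"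
  have V: "simple_graph (V, E)" "r \<in> V" and W: "simple_graph (W, D)" "v \<in> W"
    using attach_Graft attach_simple[of U F r s V E] tree_at_simple[of v t W D] by auto
  have fin: "finite (leaves (V, E))" "finite (leaves (W, D))"
    using simple_graphD(1)[OF V(1)] simple_graphD(1)[OF W(1)] by (auto simp: leaves_def)
  note deg = vertex_degree_join[OF V(1) W(1) attach_Graft(3) V(2) W(2)]
  have 1: "x \<in> leaves (V \<union> W, ?E) \<longleftrightarrow> x \<in> leaves (V, E)" if "x \<in> V" "x \<noteq> r" for x
    using that deg(1)[of x "V \<union> W" V] by (simp add: leaves_def)
  have 2: "x \<in> leaves (V \<union> W, ?E) \<longleftrightarrow> x \<in> leaves (W, D)" if "x \<in> W" "x \<noteq> v" for x
    using that deg(2)[of x "V \<union> W" W] by (simp add: leaves_def)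
  have 3: "v \<in> leaves (V \<union> W, ?E) \<longleftrightarrow> t = Root"
    using W deg(2)[of v "V \<union> W" W] vertex_degree_tree_root[OF attach_Graft(2)]
    by (simp add: leaves_def)
  have sub: "leaves (V, E) \<subseteq> V" "leaves (W, D) \<subseteq> W" "leaves (V \<union> W, ?E) \<subseteq> V \<union> W"
    by (auto simp: leaves_def)
  have "leaves (V \<union> W, ?E) - {r} =
      (leaves (V, E) - {r}) \<union> ((leaves (W, D) - {v}) \<union> (if t = Root then {v} else {}))" (is "?L = ?R")
  proof (rule Set.set_eqI)
    fix x
    consider "x = r" | "x \<in> V" "x \<noteq> r" | "x = v" | "x \<in> W" "x \<noteq> v" | "x \<notin> V \<union> W" by blast
    then show "x \<in> ?L \<longleftrightarrow> x \<in> ?R"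
    proof cases
      case 1
      then show ?thesis using sub(2) V(2) W(2) attach_Graft(3) by auto
    next
      case 2
      then show ?thesis using 1[of x] sub(2) W(2) attach_Graft(3) by auto
    next
      case 3
      then show ?thesis using \<open>v \<in> leaves (V \<union> W, ?E) \<longleftrightarrow> t = Root\<close> sub(1) V(2) W(2) attach_Graft(3)
        by auto
    next
      case 4
      then show ?thesis using 2[of x] sub(1) V(2) attach_Graft(3) by auto
    next
      case 5
      then show ?thesis using sub W(2) by auto
    qed
  qed
  moreover have "(leaves (V, E) - {r}) \<inter> ((leaves (W, D) - {v}) \<union> (if t = Root then {v} else {})) = {}"
    using sub W(2) attach_Graft(3) by auto
  ultimately have "card (leaves (V \<union> W, ?E) - {r}) =
      card (leaves (V, E) - {r}) + (card (leaves (W, D) - {v}) + (if t = Root then 1 else 0))"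
    using fin by (simp add: card_Un_disjoint)
  moreover have "leaves ({v}, {}) = {}" by (auto simp: leaves_def vertex_degree_def)
  ultimately show ?case using attach_Graft by simp
qed simp

section \<open>Connectivity and cycles\<close>

abbreviation adj :: "'a set set \<Rightarrow> ('a \<times> 'a) set" where
  "adj E \<equiv> {(x, y). {x, y} \<in> E}"

lemma sym_adj: "(x, y) \<in> (adj E)\<^sup>* \<Longrightarrow> (y, x) \<in> (adj E)\<^sup>*"
proof -
  have "sym (adj E)" by (auto simp: sym_def insert_commute)
  then show "(x, y) \<in> (adj E)\<^sup>* \<Longrightarrow> (y, x) \<in> (adj E)\<^sup>*" by (meson symD sym_rtrancl)
qed

lemma adj_mono: "E \<subseteq> D \<Longrightarrow> (x, y) \<in> (adj E)\<^sup>* \<Longrightarrow> (x, y) \<in> (adj D)\<^sup>*"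
  by (rule set_mp[OF rtrancl_mono]) auto

lemma connected_graphI:
  assumes "r \<in> V" "\<And>v. v \<in> V \<Longrightarrow> (r, v) \<in> (adj E)\<^sup>*"
  shows "connected_graph (V, E)"
  unfolding connected_graph_def using assms by (auto intro: rtrancl_trans sym_adj)

lemma connected_graph_join:
  assumes "connected_graph (V, E)" "connected_graph (W, D)" "r \<in> V" "v \<in> W"
  shows "connected_graph (V \<union> W, insert {r, v} (E \<union> D))"
proof (rule connected_graphI[of r])
  let ?E = "insert {r, v} (E \<union> D)"
  fix x assume "x \<in> V \<union> W"
  then show "(r, x) \<in> (adj ?E)\<^sup>*"
  proof
    assume "x \<in> V"
    then have "(r, x) \<in> (adj E)\<^sup>*" using assms by (auto simp: connected_graph_def)
    then show ?thesis by (rule adj_mono[rotated]) auto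
  next
    assume "x \<in> W"
    then have "(v, x) \<in> (adj D)\<^sup>*" using assms by (auto simp: connected_graph_def)
    then have "(v, x) \<in> (adj ?E)\<^sup>*" by (rule adj_mono[rotated]) auto
    then show ?thesis by (rule converse_rtrancl_into_rtrancl[rotated]) auto
  qed
qed (use assms in auto)

lemma connected_attach:
  assumes "attach U F r t V E" "simple_graph (U, F)" "r \<in> U" "connected_graph (U, F)"
  shows "connected_graph (V, E)"
  using assms
proof (induction rule: attach.induct)
  case (attach_Graft U F r s V E v t W D)
  have "connected_graph ({v}, {})" by (simp add: connected_graph_def)
  with attach_Graft attach_simple[of U F r s V E] tree_at_simple[of v t W D] show ?case
    by (intro connected_graph_join) auto
qed auto

lemma path_edges_Nil [simp]: "path_edges [] = {}"
  and path_edges_singleton [simp]: "path_edges [v] = {}"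
  by (auto simp: path_edges_def)

lemma path_edges_Cons [simp]: "path_edges (v # w # vs) = insert {v, w} (path_edges (w # vs))"
proof -
  have "e \<in> insert {v, w} (path_edges (w # vs))" if "e \<in> path_edges (v # w # vs)" for e
  proof -
    obtain i where "Suc i < length (v # w # vs)" "e = {(v # w # vs) ! i, (v # w # vs) ! Suc i}"
      using \<open>e \<in> path_edges (v # w # vs)\<close> by (auto simp: path_edges_def)
    then show ?thesis by (cases i) (auto simp: path_edges_def)
  qed
  moreover have "{v, w} \<in> path_edges (v # w # vs)"
    by (auto simp: path_edges_def intro!: exI[of _ 0])
  moreover have "e \<in> path_edges (v # w # vs)" if "e \<in> path_edges (w # vs)" for e
  proof -
    obtain i where "i < length vs" "e = {(w # vs) ! i, vs ! i}"
      using \<open>e \<in> path_edges (w # vs)\<close> by (auto simp: path_edges_def)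
    then show ?thesis unfolding path_edges_def by (auto intro!: exI[of _ "Suc i"])
  qed
  ultimately show ?thesis by blast
qed

lemma path_edges_snoc: "vs \<noteq> [] \<Longrightarrow> path_edges (vs @ [w]) = insert {last vs, w} (path_edges vs)"
  by (induction vs rule: induct_list012) auto

lemma path_edges_subset: "e \<in> path_edges vs \<Longrightarrow> e \<subseteq> set vs"
  by (auto simp: path_edges_def)

lemma cycle_edges_alt:
  "vs \<noteq> [] \<Longrightarrow> cycle_edges vs = insert {hd vs, last vs} (path_edges vs)"
  by (simp add: cycle_edges_def path_edges_snoc insert_commute)

lemma cycle_edges_mod:
  assumes "vs \<noteq> []"
  shows "cycle_edges vs = {{vs ! i, vs ! (Suc i mod length vs)} |i. i < length vs}"
proof -
  have "(vs @ [hd vs]) ! Suc i = vs ! (Suc i mod length vs)" if "i < length vs" for i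
    using that assms by (cases "Suc i = length vs") (auto simp: nth_append hd_conv_nth)
  then show ?thesis
    unfolding cycle_edges_def path_edges_def by (auto simp: nth_append)
qed

lemma cycle_edges_degree:
  assumes "distinct vs" "3 \<le> length vs" "v \<in> set vs"
  shows "card {e \<in> cycle_edges vs. v \<in> e} = 2"
proof -
  let ?k = "length vs"
  obtain i where i: "i < ?k" "v = vs ! i" using assms(3) by (auto simp: in_set_conv_nth)
  define p where "p = (if i = 0 then ?k - 1 else i - 1)"
  have p: "p < ?k" "Suc p mod ?k = i" using i assms by (auto simp: p_def)
  have suc: "Suc i mod ?k < ?k" "Suc i mod ?k \<noteq> i" "Suc i mod ?k \<noteq> p" "p \<noteq> i"
    using i assms by (auto simp: p_def mod_Suc split: if_splits)
  have *: "j = i \<or> j = p" if "j < ?k" "vs ! i \<in> {vs ! j, vs ! (Suc j mod ?k)}" for j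
  proof -
    have "Suc j mod ?k < ?k" using that(1) by (intro mod_less_divisor) auto
    then have "i = j \<or> i = Suc j mod ?k" using that i assms(1) by (auto simp: nth_eq_iff_index_eq)
    then show ?thesis using that by (auto simp: p_def mod_Suc split: if_splits)
  qed
  have "{e \<in> cycle_edges vs. v \<in> e} = {{vs ! i, vs ! (Suc i mod ?k)}, {vs ! p, vs ! (Suc p mod ?k)}}"
  proof (intro equalityI subsetI)
    fix e assume "e \<in> {e \<in> cycle_edges vs. v \<in> e}"
    then obtain j where "j < ?k" "e = {vs ! j, vs ! (Suc j mod ?k)}" "v \<in> e"
      using assms by (subst (asm) cycle_edges_mod) auto
    with *[of j] i show "e \<in> {{vs ! i, vs ! (Suc i mod ?k)}, {vs ! p, vs ! (Suc p mod ?k)}}" by auto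
  next
    fix e assume "e \<in> {{vs ! i, vs ! (Suc i mod ?k)}, {vs ! p, vs ! (Suc p mod ?k)}}"
    then show "e \<in> {e \<in> cycle_edges vs. v \<in> e}"
      using assms i p by (subst cycle_edges_mod) auto
  qed
  moreover have "{vs ! i, vs ! (Suc i mod ?k)} \<noteq> {vs ! p, vs ! (Suc p mod ?k)}"
    using assms(1) i p suc by (auto simp: doubleton_eq_iff nth_eq_iff_index_eq)
  ultimately show ?thesis by simp
qed

lemma simple_graph_cycle:
  assumes "distinct us" "3 \<le> length us" shows "simple_graph (set us, cycle_edges us)"
proof -
  have "vs ! i \<noteq> vs ! (Suc i mod length vs)" if "distinct vs" "3 \<le> length vs" "i < length vs" for vs :: "'a list" and i
    using that by (subst nth_eq_iff_index_eq) (auto simp: mod_Suc)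
  moreover have "us \<noteq> []" using assms by auto
  ultimately show ?thesis using assms
    by (auto simp: simple_graph_def cycle_edges_mod)
qed

lemma connected_path:
  "vs \<noteq> [] \<Longrightarrow> connected_graph (set vs, path_edges vs)"
proof (induction vs rule: induct_list012)
  case (3 v w vs)
  have "connected_graph ({v}, {})" by (simp add: connected_graph_def)
  from connected_graph_join[OF this "3.IH"(2), of v w] show ?case by (simp add: insert_commute)
qed (auto simp: connected_graph_def)

lemma connected_cycle:
  assumes "us \<noteq> []" shows "connected_graph (set us, cycle_edges us)"
proof (rule connected_graphI[of "hd us"])
  fix v assume "v \<in> set us"
  then have "(hd us, v) \<in> (adj (path_edges us))\<^sup>*"
    using connected_path[OF assms] assms by (auto simp: connected_graph_def)
  then show "(hd us, v) \<in> (adj (cycle_edges us))\<^sup>*"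
    by (rule adj_mono[rotated]) (use assms in \<open>auto simp: cycle_edges_alt\<close>)
qed (use assms in auto)

lemma exists_step:
  fixes a b :: nat
  assumes "P a" "\<not> P b" "a \<le> b"
  shows "\<exists>i. P i \<and> \<not> P (Suc i)"
  using assms(3,1,2) by (induction rule: dec_induct) auto

text \<open>A cycle crosses a cut an even number of times, so it avoids bridges.\<close>

lemma is_cycle_join:
  assumes "simple_graph (V, E)" "simple_graph (W, D)" "V \<inter> W = {}" "r \<in> V" "v \<in> W"
    and cyc: "is_cycle (A, insert {r, v} (E \<union> D)) vs"
  shows "is_cycle (V, E) vs \<or> is_cycle (W, D) vs"
proof -
  let ?E = "insert {r, v} (E \<union> D)" and ?k = "length vs"
  have vs: "3 \<le> ?k" "distinct vs" "cycle_edges vs \<subseteq> ?E" "vs \<noteq> []"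
    using cyc by (auto simp: is_cycle_def)
  have E: "a \<in> V \<and> b \<in> V" if "{a, b} \<in> E" for a b using simple_graphD(2)[OF assms(1) that] by simp
  have D: "a \<in> W \<and> b \<in> W" if "{a, b} \<in> D" for a b using simple_graphD(2)[OF assms(2) that] by simp
  define f where "f i = vs ! (i mod ?k)" for i
  have per: "f (i + j * ?k) = f i" for i j by (simp add: f_def)
  have edge: "{f i, f (Suc i)} \<in> ?E" for i
  proof -
    have "i mod ?k < ?k" using vs by (auto intro: mod_less_divisor)
    then have "{vs ! (i mod ?k), vs ! (Suc (i mod ?k) mod ?k)} \<in> cycle_edges vs"
      using vs(4) by (auto simp: cycle_edges_mod)
    then show ?thesis using vs(3) by (auto simp: f_def mod_Suc_eq)
  qed
  have all: "f i \<in> V \<union> W" for i using edge[of i] E[of "f i"] D[of "f i"] assms(4,5) by (auto simp: doubleton_eq_iff)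
  have inj: "i mod ?k = j mod ?k" if "f i = f j" for i j
  proof -
    have "i mod ?k < ?k" "j mod ?k < ?k" using vs by (auto intro: mod_less_divisor)
    then show ?thesis using that vs(2) by (simp add: f_def nth_eq_iff_index_eq)
  qed
  have cross: "f i = r \<and> f (Suc i) = v" if "f i \<in> V" "f (Suc i) \<notin> V" for i
    using that edge[of i] E[of "f i"] D[of "f i"] assms(3-5) by (auto simp: doubleton_eq_iff)
  have cross': "f i = v \<and> f (Suc i) = r" if "f i \<notin> V" "f (Suc i) \<in> V" for i
    using that edge[of i] E[of "f i"] D[of "f i"] assms(3-5) by (auto simp: doubleton_eq_iff)
  \<comment> \<open>The periodic walk \<open>f\<close> leaves \<open>V\<close> only by stepping from
    \<open>r\<close> to \<open>v\<close> and re-enters only by stepping from \<open>v\<close> to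
    \<open>r\<close>. As \<open>f\<close> is injective modulo the length, two steps after
    \<open>r\<close> it is back at \<open>r\<close>, so the length divides 2.\<close>
  have "(\<forall>i. f i \<in> V) \<or> (\<forall>i. f i \<notin> V)"
  proof (rule ccontr)
    assume "\<not> ?thesis"
    then obtain a b where ab: "f a \<in> V" "f b \<notin> V" by auto
    \<comment> \<open>Adding full periods places either of the indices \<open>a\<close>,
      \<open>b\<close> after the other, as \<open>exists_step\<close> requires.\<close>
    have "k \<le> k' + k * ?k" for k k' using vs(1) by (metis le_add2 le_trans mult.right_neutral mult_le_mono2 One_nat_def Suc_leD numeral_3_eq_3)
    note le = this
    have "\<exists>i. f i \<in> V \<and> \<not> f (Suc i) \<in> V"
      by (rule exists_step[of _ a "b + a * ?k"]) (use ab le in \<open>auto simp: per\<close>)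
    moreover have "\<exists>i. \<not> f i \<in> V \<and> \<not> \<not> f (Suc i) \<in> V"
      by (rule exists_step[of _ b "a + b * ?k"]) (use ab le in \<open>auto simp: per\<close>)
    ultimately obtain i j where "f i = r" "f (Suc i) = v" "f j = v" "f (Suc j) = r"
      using cross cross' by metis
    then have "Suc i mod ?k = j mod ?k" "Suc j mod ?k = i mod ?k" using inj by auto
    then have "Suc (Suc i) mod ?k = i mod ?k" by (metis mod_Suc_eq)
    then have "?k dvd Suc (Suc i) - i" by (subst mod_eq_dvd_iff_nat[symmetric]) auto
    then show False using vs(1) by (auto dest: dvd_imp_le)
  qed
  moreover have cyc_edge: "\<exists>i. e = {f i, f (Suc i)}" if "e \<in> cycle_edges vs" for e
  proof -
    obtain i where "i < ?k" "e = {vs ! i, vs ! (Suc i mod ?k)}"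
      using \<open>e \<in> cycle_edges vs\<close> vs(4) by (auto simp: cycle_edges_mod)
    then show ?thesis by (auto simp: f_def intro!: exI[of _ i])
  qed
  ultimately show ?thesis
  proof (elim disjE)
    assume V: "\<forall>i. f i \<in> V"
    have "cycle_edges vs \<subseteq> E"
    proof
      fix e assume "e \<in> cycle_edges vs"
      then obtain i where "e = {f i, f (Suc i)}" using cyc_edge by blast
      then show "e \<in> E" using V edge[of i] D[of "f i"] assms(3-5) by (auto simp: doubleton_eq_iff)
    qed
    then show ?thesis using vs by (simp add: is_cycle_def)
  next
    assume W: "\<forall>i. f i \<notin> V"
    have "cycle_edges vs \<subseteq> D"
    proof
      fix e assume "e \<in> cycle_edges vs"
      then obtain i where "e = {f i, f (Suc i)}" using cyc_edge by blast
      then show "e \<in> D" using W edge[of i] E[of "f i"] assms(3-5) by (auto simp: doubleton_eq_iff)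
    qed
    then show ?thesis using vs by (simp add: is_cycle_def)
  qed
qed

lemma not_is_cycle_singleton [simp]: "\<not> is_cycle ({v}, {}) vs"
proof
  assume "is_cycle ({v}, {}) vs"
  then have "vs \<noteq> []" "cycle_edges vs = {}" by (auto simp: is_cycle_def)
  then show False by (simp add: cycle_edges_alt)
qed

lemma is_cycle_attach:
  assumes "attach U F r t V E" "simple_graph (U, F)" "r \<in> U"
  shows "is_cycle (V, E) vs \<longleftrightarrow> is_cycle (U, F) vs"
proof
  show "is_cycle (V, E) vs \<Longrightarrow> is_cycle (U, F) vs"
    using assms
  proof (induction rule: attach.induct)
    case (attach_Graft U F r s V E v t W D)
    have "is_cycle (V, E) vs \<or> is_cycle (W, D) vs"
      using attach_Graft attach_simple[of U F r s V E] tree_at_simple[of v t W D]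
      by (intro is_cycle_join[of V E W D r v "V \<union> W"]) auto
    with attach_Graft show ?case by auto
  qed
  show "is_cycle (U, F) vs \<Longrightarrow> is_cycle (V, E) vs"
    using attach_simple(3)[OF assms] by (auto simp: is_cycle_def)
qed

lemma is_tree_tree_at:
  assumes "tree_at t r V E" shows "is_tree (V, E)"
  using tree_at_simple[OF assms] connected_attach[OF assms] is_cycle_attach[OF assms]
  by (auto simp: is_tree_def connected_graph_def)

text \<open>Both cycles are 2-regular, so at a common vertex they have the same two edges. Walking
  along \<open>us\<close> from such a vertex therefore never leaves \<open>vs\<close>, and the edge
  sets coincide.\<close>

lemma is_cycle_cycle:
  assumes "distinct us" "3 \<le> length us"
  shows "is_cycle (set us, cycle_edges us) us"
    and "is_cycle (set us, cycle_edges us) vs \<Longrightarrow> cycle_edges vs = cycle_edges us \<and> length vs = length us"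
proof -
  show "is_cycle (set us, cycle_edges us) us" using assms by (simp add: is_cycle_def)
  assume "is_cycle (set us, cycle_edges us) vs"
  then have vs: "distinct vs" "3 \<le> length vs" "cycle_edges vs \<subseteq> cycle_edges us"
    by (auto simp: is_cycle_def)
  have ne: "vs \<noteq> []" "us \<noteq> []" using assms vs by auto
  have fin: "finite (cycle_edges us)"
    using simple_graphD(4) simple_graph_cycle[OF assms] by blast
  have sub: "e \<subseteq> set us" if "e \<in> cycle_edges us" for e
    using simple_graphD(2)[OF simple_graph_cycle[OF assms] that] .
  have sub': "e \<subseteq> set vs" if "e \<in> cycle_edges vs" for e
    using simple_graphD(2)[OF simple_graph_cycle[OF vs(1,2)] that] .
  have "set vs \<subseteq> set us"
  proof
    fix v assume "v \<in> set vs"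
    then have "{e \<in> cycle_edges vs. v \<in> e} \<noteq> {}"
      using cycle_edges_degree[OF vs(1,2)] by (metis card.empty zero_neq_numeral)
    then show "v \<in> set us" using vs(3) sub by blast
  qed
  have nbh: "{e \<in> cycle_edges vs. v \<in> e} = {e \<in> cycle_edges us. v \<in> e}" if "v \<in> set vs" for v
    using that \<open>set vs \<subseteq> set us\<close> fin vs(3) cycle_edges_degree[OF vs(1,2), of v]
      cycle_edges_degree[OF assms, of v]
    by (intro card_subset_eq) auto
  have step: "us ! (Suc i mod length us) \<in> set vs" if "i < length us" "us ! i \<in> set vs" for i
  proof -
    have "{us ! i, us ! (Suc i mod length us)} \<in> cycle_edges us"
      using that(1) ne by (auto simp: cycle_edges_mod)
    then have "{us ! i, us ! (Suc i mod length us)} \<in> cycle_edges vs"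
      using nbh[OF that(2)] by blast
    then show ?thesis using sub' by blast
  qed
  obtain i where i: "i < length us" "us ! i \<in> set vs"
    using \<open>set vs \<subseteq> set us\<close> ne by (metis in_set_conv_nth last_in_set subsetD)
  have "us ! ((i + j) mod length us) \<in> set vs" for j
  proof (induction j)
    case (Suc j)
    then show ?case using step[of "(i + j) mod length us"] ne by (simp add: mod_Suc_eq)
  qed (use i in simp)
  moreover have "\<exists>j. k = (i + j) mod length us" if "k < length us" for k
    using that i by (intro exI[of _ "length us - i + k"]) simp
  ultimately have "set us \<subseteq> set vs" by (metis in_set_conv_nth subsetI)
  with \<open>set vs \<subseteq> set us\<close> have eq: "set vs = set us" by simp
  have "cycle_edges us \<subseteq> cycle_edges vs"
  proof
    fix e assume e: "e \<in> cycle_edges us"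
    then obtain v where "v \<in> e" using ne by (auto simp: cycle_edges_mod)
    then show "e \<in> cycle_edges vs" using nbh[of v] e sub eq by blast
  qed
  then show "cycle_edges vs = cycle_edges us \<and> length vs = length us"
    using vs(1,3) assms(1) eq by (metis distinct_card subset_antisym)
qed

section \<open>Copies of rooted trees inside graphs\<close>

lemma attach_glue:
  "attach V E r t V' E' \<Longrightarrow> attach U F r s V E \<Longrightarrow> attach U F r (glue s t) V' E'"
  by (induction rule: attach.induct) (auto intro: attach.intros)

lemma attach_swap:
  assumes "attach U F r (Graft (Graft s c) d) V E"
  shows "attach U F r (Graft (Graft s d) c) V E"
  using assms
proof (elim attach_GraftE)
  fix V1 E1 v W D V2 E2 v' W' D'
  assume *: "V = V1 \<union> W" "E = insert {r, v} (E1 \<union> D)" "tree_at d v W D" "V1 \<inter> W = {}"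
    "V1 = V2 \<union> W'" "E1 = insert {r, v'} (E2 \<union> D')" "attach U F r s V2 E2" "tree_at c v' W' D'"
    "V2 \<inter> W' = {}"
  then have "attach U F r (Graft s d) (V2 \<union> W) (insert {r, v} (E2 \<union> D))"
    by (intro attach.intros) auto
  then have "attach U F r (Graft (Graft s d) c) (V2 \<union> W \<union> W')
      (insert {r, v'} (insert {r, v} (E2 \<union> D) \<union> D'))"
    using * by (intro attach_Graft) auto
  also have "V2 \<union> W \<union> W' = V" using * by auto
  also have "insert {r, v'} (insert {r, v} (E2 \<union> D) \<union> D') = E" using * by auto
  finally show ?thesis .
qed

lemma attach_Graft_iff:
  "attach U F r (Graft s t) V E \<longleftrightarrow> (\<exists>V1 E1 v W D. attach U F r s V1 E1 \<and> tree_at t v W D \<and>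
     V1 \<inter> W = {} \<and> V = V1 \<union> W \<and> E = insert {r, v} (E1 \<union> D))" (is "?L \<longleftrightarrow> ?R")
proof
  show "?L \<Longrightarrow> ?R" by (erule attach_GraftE) blast
  show "?R \<Longrightarrow> ?L" by (elim exE conjE) (simp only: attach_Graft)
qed

lemma attach_reordering:
  "s \<approx> t \<Longrightarrow> attach U F r s V E \<longleftrightarrow> attach U F r t V E"
proof (induction arbitrary: U F r V E rule: reordering.induct)
  case (Graft_swap s c d)
  show ?case using attach_swap[of U F r s c d V E] attach_swap[of U F r s d c V E] by (rule iffI)
next
  case (Graft_left s s' c)
  show ?case unfolding attach_Graft_iff Graft_left.IH ..
next
  case (Graft_right c c' s)
  show ?case unfolding attach_Graft_iff Graft_right.IH ..
qed simp_all

text \<open>Together with \<open>attach_split\<close>, this moves between two descriptions: growing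
  the tree on the base graph, and overlaying a separate copy of it that meets the base in
  \<open>r\<close> only.\<close>

lemma attach_base:
  assumes "tree_at t r V E" "U \<inter> V = {r}"
  shows "attach U F r t (U \<union> V) (F \<union> E)"
proof -
  have "attach U F r t (U \<union> V) (F \<union> E)"
    if "attach U0 F0 r t V E" "U0 = {r}" "F0 = {}" "U \<inter> V = {r}" for U0 F0
    using that
  proof (induction rule: attach.induct)
    case (attach_Root U0 F0 r)
    then have "U \<union> U0 = U" "F \<union> F0 = F" by auto
    then show ?case by (simp add: attach.attach_Root)
  next
    case (attach_Graft U0 F0 r s V E v t W D)
    have r: "r \<in> V" using attach_Graft by (auto intro: tree_at_simple)
    have "attach U F r s (U \<union> V) (F \<union> E)"
      using attach_Graft r by (intro attach_Graft.IH(1)) auto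
    then have "attach U F r (Graft s t) ((U \<union> V) \<union> W) (insert {r, v} ((F \<union> E) \<union> D))"
      by (rule attach.attach_Graft) (use attach_Graft r in auto)
    then show ?case by (simp add: Un_assoc)
  qed
  with assms show ?thesis by blast
qed

lemma attach_split:
  assumes "attach U F r t V E" "r \<in> U"
  shows "\<exists>V' E'. tree_at t r V' E' \<and> U \<inter> V' = {r} \<and> V = U \<union> V' \<and> E = F \<union> E'"
  using assms
proof (induction rule: attach.induct)
  case (attach_Root U F r)
  then show ?case by (intro exI[of _ "{r}"] exI[of _ "{}"]) (auto intro: attach.intros)
next
  case (attach_Graft U F r s V E v t W D)
  then obtain V' E' where *: "tree_at s r V' E'" "U \<inter> V' = {r}" "V = U \<union> V'" "E = F \<union> E'"
    by auto
  have "tree_at (Graft s t) r (V' \<union> W) (insert {r, v} (E' \<union> D))"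
    using * attach_Graft by (intro attach.attach_Graft) auto
  then show ?case using * attach_Graft
    by (intro exI[of _ "V' \<union> W"] exI[of _ "insert {r, v} (E' \<union> D)"]) auto
qed

lemma attach_image:
  assumes "attach U F r t V E" "inj_on f V"
  shows "attach (f ` U) ((`) f ` F) (f r) t (f ` V) ((`) f ` E)"
  using assms
proof (induction rule: attach.induct)
  case (attach_Graft U F r s V E v t W D)
  have "f ` V \<inter> f ` W = {}"
    using inj_on_image_Int[OF attach_Graft.prems, of V W] attach_Graft(3) by auto
  moreover have "tree_at t (f v) (f ` W) ((`) f ` D)"
    using attach_Graft by (auto intro: inj_on_subset)
  ultimately show ?case
    using attach_Graft attach.attach_Graft[of "f ` U" "(`) f ` F" "f r" s "f ` V" "(`) f ` E" "f v" t "f ` W" "(`) f ` D"]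
    by (simp add: image_Un inj_on_Un)
qed (auto intro: attach.intros)

lemma attach_isomorphic:
  assumes "attach U F r t V E" "attach U' F' (f r) t V' E'" "simple_graph (U, F)" "r \<in> U"
    and "bij_betw f U U'" "F' = (`) f ` F"
  shows "\<exists>h. bij_betw h V V' \<and> (\<forall>x\<in>U. h x = f x) \<and> E' = (`) h ` E"
  using assms
proof (induction arbitrary: U' F' f V' E' rule: attach.induct)
  case (attach_Root U F r)
  then show ?case by (auto elim!: attach_RootE)
next
  case (attach_Graft U F r s V E v t W D)
  from attach_Graft.prems(1) obtain V1 E1 v' W' D' where *: "V' = V1 \<union> W'"
    "E' = insert {f r, v'} (E1 \<union> D')" "attach U' F' (f r) s V1 E1" "tree_at t v' W' D'" "V1 \<inter> W' = {}"
    by (auto elim: attach_GraftE)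
  obtain h1 where h1: "bij_betw h1 V V1" "\<forall>x\<in>U. h1 x = f x" "E1 = (`) h1 ` E"
    using attach_Graft.IH(1)[of U' F' f V1 E1] *(3) attach_Graft.prems by blast
  obtain h2 where h2: "bij_betw h2 W W'" "h2 v = v'" "D' = (`) h2 ` D"
    using attach_Graft.IH(2)[of "{v'}" "{}" "\<lambda>_. v'" W' D'] *(4) by (auto simp: bij_betw_def)
  have V: "simple_graph (V, E)" "r \<in> V" "U \<subseteq> V" and W: "simple_graph (W, D)" "v \<in> W"
    using attach_Graft attach_simple[of U F r s V E] tree_at_simple[of v t W D] by auto
  define h where "h x = (if x \<in> V then h1 x else h2 x)" for x
  have hV: "h ` A = h1 ` A" if "A \<subseteq> V" for A using that by (auto simp: h_def image_iff)
  have hW: "h ` A = h2 ` A" if "A \<subseteq> W" for A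
    using that attach_Graft(3) by (intro image_cong) (auto simp: h_def)
  have "bij_betw h (V \<union> W) (V1 \<union> W')"
  proof (rule bij_betw_combine)
    show "bij_betw h V V1"
      using h1(1) by (subst bij_betw_cong[of V h h1]) (auto simp: h_def)
    show "bij_betw h W W'"
      using h2(1) attach_Graft(3) by (subst bij_betw_cong[of W h h2]) (auto simp: h_def)
  qed (use * in auto)
  moreover have "\<forall>x\<in>U. h x = f x" using h1(2) V(3) by (auto simp: h_def)
  moreover have "(`) h ` insert {r, v} (E \<union> D) = E'"
  proof -
    have "(`) h ` E = (`) h1 ` E"
      using simple_graphD(2)[OF V(1)] by (intro image_cong refl hV) auto
    moreover have "(`) h ` D = (`) h2 ` D"
      using simple_graphD(2)[OF W(1)] by (intro image_cong refl hW) auto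
    moreover have "h ` {r, v} = {f r, v'}"
      using h1(2) h2(2) V(2) W(2) attach_Graft(3) attach_Graft.prems by (auto simp: h_def)
    ultimately show ?thesis using * h1(3) h2(3) by (simp add: image_Un)
  qed
  ultimately show ?case using *(1) by auto
qed

lemma tree_at_exists:
  "finite V \<Longrightarrow> card V = Suc (num_edges t) \<Longrightarrow> r \<in> V \<Longrightarrow> \<exists>E. tree_at t r V E"
proof (induction t arbitrary: V r)
  case Root
  then have "V = {r}" by (auto simp: card_1_singleton_iff)
  then show ?case by (auto intro: attach.intros)
next
  case (Graft s c)
  have "Suc (num_edges c) \<le> card (V - {r})" using Graft.prems by simp
  then obtain W where W: "W \<subseteq> V - {r}" "card W = Suc (num_edges c)" "finite W"
    by (rule obtain_subset_with_card_n)
  then obtain v where v: "v \<in> W" by (metis card.empty equals0I nat.distinct(1))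
  obtain D where D: "tree_at c v W D" using Graft.IH(2)[of W v] W v by blast
  have "card (V - W) = Suc (num_edges s)"
    using W Graft.prems by (subst card_Diff_subset) auto
  then obtain E where E: "tree_at s r (V - W) E" using Graft.IH(1)[of "V - W" r] W Graft.prems by auto
  have "tree_at (Graft s c) r ((V - W) \<union> W) (insert {r, v} (E \<union> D))"
    using E D by (intro attach_Graft) auto
  moreover have "(V - W) \<union> W = V" using W by auto
  ultimately show ?case by auto
qed

lemma path_edges_prefix: "path_edges (us @ [w]) \<subseteq> path_edges (us @ w # vs)"
proof
  fix e assume "e \<in> path_edges (us @ [w])"
  then obtain i where i: "Suc i < length (us @ [w])" "e = {(us @ [w]) ! i, (us @ [w]) ! Suc i}"
    by (auto simp: path_edges_def)
  then have "(us @ [w]) ! i = (us @ w # vs) ! i" "(us @ [w]) ! Suc i = (us @ w # vs) ! Suc i"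
    by (auto simp: nth_append nth_Cons split: nat.splits)
  then show "e \<in> path_edges (us @ w # vs)" using i by (auto simp: path_edges_def)
qed

lemma adj_rtrancl_path:
  assumes "(u, v) \<in> (adj E)\<^sup>*"
  shows "\<exists>vs. vs \<noteq> [] \<and> hd vs = u \<and> last vs = v \<and> distinct vs \<and> path_edges vs \<subseteq> E"
  using assms
proof (induction rule: rtrancl_induct)
  case base
  show ?case by (intro exI[of _ "[u]"]) auto
next
  case (step y z)
  then obtain vs where vs: "vs \<noteq> []" "hd vs = u" "last vs = y" "distinct vs" "path_edges vs \<subseteq> E"
    by auto
  show ?case
  proof (cases "z \<in> set vs")
    case True
    then obtain as bs where "vs = as @ z # bs" by (meson split_list)
    with vs show ?thesis
      using path_edges_prefix[of as z bs]
      by (intro exI[of _ "as @ [z]"]) (auto simp: hd_append)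
  next
    case False
    with vs step show ?thesis
      by (intro exI[of _ "vs @ [z]"]) (auto simp: path_edges_snoc)
  qed
qed

text \<open>Deleting an edge \<open>{r, v}\<close> at the root leaves the components
  \<open>C r\<close> and \<open>C v\<close>. They cover \<open>V\<close> by connectedness, and they
  are disjoint because another path from \<open>r\<close> to \<open>v\<close> would close up to a
  cycle. Both are smaller trees, and joining them again is \<open>Graft\<close>.\<close>

lemma tree_at_decompose:
  assumes "is_tree (V, E)" "r \<in> V"
  shows "\<exists>t. tree_at t r V E"
  using assms
proof (induction "card V" arbitrary: V E r rule: less_induct)
  case less
  have simple: "simple_graph (V, E)" and conn: "connected_graph (V, E)"
    and acyc: "\<And>vs. \<not> is_cycle (V, E) vs"
    using less.prems by (auto simp: is_tree_def)
  show ?case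
  proof (cases "V = {r}")
    case True
    have "E = {}"
    proof (rule ccontr)
      assume "E \<noteq> {}"
      then obtain e where "e \<in> E" by auto
      then have "e \<subseteq> {r}" "card e = 2" using simple_graphD[OF simple] True by auto
      then show False using card_mono[of "{r}" e] by simp
    qed
    then show ?thesis using True by (auto intro: attach.intros)
  next
    case False
    then obtain x where x: "x \<in> V" "x \<noteq> r" using less.prems by auto
    then have "(r, x) \<in> (adj E)\<^sup>*" using conn less.prems by (auto simp: connected_graph_def)
    then obtain v where rv: "{r, v} \<in> E" using x by (auto elim: converse_rtranclE)
    have edge: "a \<in> V \<and> b \<in> V \<and> a \<noteq> b" if "{a, b} \<in> E" for a b
      using simple_graphD(2,3)[OF simple that] by (auto simp: card_insert_if split: if_splits)
    define E' where "E' = E - {{r, v}}"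
    define C where "C x = {y. (x, y) \<in> (adj E')\<^sup>*}" for x
    have C_step: "z \<in> C x" if "y \<in> C x" "{y, z} \<in> E'" for x y z
      using that unfolding C_def by (auto intro: rtrancl_into_rtrancl)
    have C_refl: "x \<in> C x" for x by (simp add: C_def)
    have C_sub: "C x \<subseteq> V" if "x \<in> V" for x
    proof
      fix y assume "y \<in> C x"
      then have "(x, y) \<in> (adj E')\<^sup>*" by (simp add: C_def)
      then show "y \<in> V" using that by (induction rule: rtrancl_induct) (auto simp: E'_def dest: edge)
    qed
    have V: "V \<subseteq> C r \<union> C v"
    proof
      fix y assume "y \<in> V"
      then have "(r, y) \<in> (adj E)\<^sup>*" using conn less.prems by (auto simp: connected_graph_def)
      then show "y \<in> C r \<union> C v"
      proof (induction rule: rtrancl_induct)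
        case (step y z)
        then show ?case
          using C_refl C_step[of y _ z] by (cases "{y, z} = {r, v}") (auto simp: E'_def doubleton_eq_iff)
      qed (simp add: C_refl)
    qed
    have disj: "C r \<inter> C v = {}"
    proof (rule ccontr)
      assume "C r \<inter> C v \<noteq> {}"
      then have "(r, v) \<in> (adj E')\<^sup>*" unfolding C_def by (auto intro: rtrancl_trans sym_adj)
      then obtain vs where vs: "vs \<noteq> []" "hd vs = r" "last vs = v" "distinct vs" "path_edges vs \<subseteq> E'"
        using adj_rtrancl_path by metis
      have "3 \<le> length vs"
      proof (rule ccontr)
        assume "\<not> 3 \<le> length vs"
        then consider "vs = [r]" | "vs = [r, v]"
          using vs(1-3) by (cases vs rule: list.exhaust; cases "tl vs"; cases "tl (tl vs)") auto
        then show False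
          using vs edge[OF rv] by cases (auto simp: E'_def)
      qed
      moreover have "cycle_edges vs \<subseteq> E"
        using vs rv by (auto simp: cycle_edges_alt E'_def)
      ultimately have "is_cycle (V, E) vs" using vs by (simp add: is_cycle_def)
      with acyc show False by blast
    qed
    define D where "D x = {e \<in> E'. e \<subseteq> C x}" for x
    have tree: "is_tree (C x, D x)" if "x \<in> V" for x
    proof -
      have "simple_graph (C x, D x)"
        using simple C_sub[OF that] by (auto simp: simple_graph_def D_def E'_def intro: finite_subset)
      moreover have "connected_graph (C x, D x)"
      proof (rule connected_graphI[of x])
        fix y assume "y \<in> C x"
        then have "(x, y) \<in> (adj E')\<^sup>*" by (simp add: C_def)
        then show "(x, y) \<in> (adj (D x))\<^sup>*"
        proof (induction rule: rtrancl_induct)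
          case (step y z)
          then have "y \<in> C x" "z \<in> C x" by (auto simp: C_def intro: rtrancl_into_rtrancl)
          then have "(y, z) \<in> adj (D x)" using step by (auto simp: D_def)
          then show ?case using step by (auto intro: rtrancl_into_rtrancl)
        qed simp
      qed (rule C_refl)
      moreover have "\<not> is_cycle (C x, D x) vs" for vs
        using acyc[of vs] by (auto simp: is_cycle_def D_def E'_def)
      ultimately show ?thesis by (simp add: is_tree_def)
    qed
    have rv': "r \<in> V" "v \<in> V" using edge[OF rv] by auto
    have fin: "finite V" using simple_graphD[OF simple] by simp
    have "C r \<subset> V" "C v \<subset> V"
      using C_sub[OF rv'(1)] C_sub[OF rv'(2)] C_refl disj rv' by blast+
    then have "card (C r) < card V" "card (C v) < card V"
      using fin by (auto intro: psubset_card_mono)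
    then obtain s t where "tree_at s r (C r) (D r)" "tree_at t v (C v) (D v)"
      using less.hyps tree rv' C_refl by metis
    then have "tree_at (Graft s t) r (C r \<union> C v) (insert {r, v} (D r \<union> D v))"
      using disj by (rule attach_Graft)
    moreover have "C r \<union> C v = V" using V C_sub rv' by blast
    moreover have "insert {r, v} (D r \<union> D v) = E"
    proof -
      have "e \<in> D r \<union> D v" if e: "e \<in> E'" for e
      proof -
        have "card e = 2" using e simple_graphD(3)[OF simple] by (auto simp: E'_def)
        then obtain a b where ab: "e = {a, b}" by (auto simp: card_2_iff)
        then have "a \<in> C r \<union> C v" using V edge[of a b] e by (auto simp: E'_def)
        then show ?thesis using ab e C_step[of a _ b] by (auto simp: D_def)
      qed
      then show ?thesis using rv by (auto simp: D_def E'_def)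
    qed
    ultimately show ?thesis by metis
  qed
qed

lemma tree_at_path:
  "distinct (v # vs) \<Longrightarrow> tree_at (path (length vs)) v (set (v # vs)) (path_edges (v # vs))"
proof (induction vs arbitrary: v)
  case (Cons w vs)
  then have "tree_at (Graft Root (path (length vs))) v ({v} \<union> set (w # vs))
      (insert {v, w} ({} \<union> path_edges (w # vs)))"
    by (intro attach.intros) auto
  then show ?case by (simp add: insert_commute)
qed (auto intro: attach.intros)

lemma tree_at_star:
  "distinct (c # concat vss) \<Longrightarrow>
    tree_at (star (map length vss)) c (insert c (set (concat vss))) (\<Union>vs\<in>set vss. path_edges (c # vs))"
proof (induction vss)
  case (Cons vs vss)
  let ?V = "insert c (set (concat vss))" and ?E = "\<Union>vs\<in>set vss. path_edges (c # vs)"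
  have "attach ?V ?E c (path (length vs)) (?V \<union> set (c # vs)) (?E \<union> path_edges (c # vs))"
    using Cons.prems by (intro attach_base tree_at_path) auto
  moreover have "tree_at (star (map length vss)) c ?V ?E" using Cons by auto
  ultimately have "tree_at (glue (star (map length vss)) (path (length vs))) c
     (?V \<union> set (c # vs)) (?E \<union> path_edges (c # vs))"
    by (rule attach_glue)
  moreover have "?V \<union> set (c # vs) = insert c (set (concat (vs # vss)))" by auto
  moreover have "?E \<union> path_edges (c # vs) = (\<Union>vs\<in>set (vs # vss). path_edges (c # vs))" by auto
  ultimately show ?case by simp
qed (auto intro: attach.intros)

lemma tree_at_up:
  assumes "tree_at t (last ws) V E" "ws \<noteq> []" "distinct ws" "set ws \<inter> V = {last ws}"
  shows "tree_at (up (length ws - 1) t) (hd ws) (set ws \<union> V) (path_edges ws \<union> E)"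
  using assms
proof (induction ws rule: induct_list012)
  case (2 w)
  then have "set [w] \<union> V = V" by auto
  with 2 show ?case by simp
next
  case (3 v w ws)
  define l where "l = last (w # ws)"
  have l: "last (v # w # ws) = l" "l \<in> set (w # ws)" by (simp_all add: l_def)
  have *: "set (v # w # ws) \<inter> V = {l}" using "3.prems"(4) unfolding l(1) .
  have "v \<noteq> l" using "3.prems"(3) l(2) by auto
  then have inter: "set (w # ws) \<inter> V = {last (w # ws)}" "v \<notin> V"
    unfolding l_def[symmetric] using * l(2) by (auto simp del: last.simps)
  have t: "tree_at t (last (w # ws)) V E" using "3.prems"(1) by simp
  have "tree_at (up (length (w # ws) - 1) t) (hd (w # ws)) (set (w # ws) \<union> V)
      (path_edges (w # ws) \<union> E)"
    by (rule "3.IH"(2)[OF t _ _ inter(1)]) (use "3.prems"(3) in simp_all)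
  moreover have "{v} \<inter> (set (w # ws) \<union> V) = {}" using "3.prems"(3) inter by auto
  ultimately have "tree_at (Graft Root (up (length (w # ws) - 1) t)) v ({v} \<union> (set (w # ws) \<union> V))
     (insert {v, hd (w # ws)} ({} \<union> (path_edges (w # ws) \<union> E)))"
    by (rule attach_Graft[OF attach_Root])
  then show ?case by (simp add: insert_commute)
qed simp

section \<open>Laplacian determinants\<close>

text \<open>The matrix x I + L rather than x I - L, so that the determinant carries the Laplacian
  coefficients without alternating signs.\<close>

definition lap_mat :: "'a set set \<Rightarrow> 'a \<Rightarrow> 'a \<Rightarrow> real poly" where
  "lap_mat E i j = (if i = j then X + of_nat (card {e \<in> E. i \<in> e})
     else if {i, j} \<in> E then - 1 else 0)"

definition has_eb :: "'a set \<Rightarrow> 'a set set \<Rightarrow> 'a \<Rightarrow> real poly \<times> real poly \<Rightarrow> bool" where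
  "has_eb V E r p \<longleftrightarrow> det_on V (lap_mat E) = X * (fst p + snd p) \<and> det_on (V - {r}) (lap_mat E) = snd p"

lemma lap_mat_insert_edge:
  assumes "finite E" "r \<noteq> s" "{r, s} \<notin> E"
  shows "lap_mat (insert {r, s} E) =
    (lap_mat E)(r := (\<lambda>j. lap_mat E r j + (unit_row r j - unit_row s j)),
                s := (\<lambda>j. lap_mat E s j - (unit_row r j - unit_row s j)))"
proof (intro ext)
  fix i j
  have "{e \<in> insert {r, s} E. i \<in> e} =
      (if i = r \<or> i = s then insert {r, s} {e \<in> E. i \<in> e} else {e \<in> E. i \<in> e})"
    by auto
  then have "card {e \<in> insert {r, s} E. i \<in> e} = card {e \<in> E. i \<in> e} + (if i = r \<or> i = s then 1 else 0)"
    using assms(1,3) by simp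
  then show "lap_mat (insert {r, s} E) i j =
    ((lap_mat E)(r := (\<lambda>j. lap_mat E r j + (unit_row r j - unit_row s j)),
                s := (\<lambda>j. lap_mat E s j - (unit_row r j - unit_row s j)))) i j"
    using assms(2,3)
    by (auto simp: lap_mat_def unit_row_def doubleton_eq_iff insert_commute)
qed

lemma lap_mat_union:
  assumes "simple_graph (V, E)" "simple_graph (W, D)" "V \<inter> W = {}"
  shows "i \<in> V \<Longrightarrow> j \<in> V \<Longrightarrow> lap_mat (E \<union> D) i j = lap_mat E i j"
    and "i \<in> W \<Longrightarrow> j \<in> W \<Longrightarrow> lap_mat (E \<union> D) i j = lap_mat D i j"
    and "i \<in> V \<Longrightarrow> j \<in> W \<Longrightarrow> lap_mat (E \<union> D) i j = 0"
    and "i \<in> W \<Longrightarrow> j \<in> V \<Longrightarrow> lap_mat (E \<union> D) i j = 0"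
proof -
  have E: "i \<notin> e" if "e \<in> E" "i \<in> W" for e i using simple_graphD(2)[OF assms(1) that(1)] that(2) assms(3) by auto
  have D: "i \<notin> e" if "e \<in> D" "i \<in> V" for e i using simple_graphD(2)[OF assms(2) that(1)] that(2) assms(3) by auto
  show "lap_mat (E \<union> D) i j = lap_mat E i j" if "i \<in> V" "j \<in> V"
  proof -
    have "{e \<in> E \<union> D. i \<in> e} = {e \<in> E. i \<in> e}" "{i, j} \<notin> D" using D that by auto
    then show ?thesis by (cases "i = j") (simp_all add: lap_mat_def)
  qed
  show "lap_mat (E \<union> D) i j = lap_mat D i j" if "i \<in> W" "j \<in> W"
  proof -
    have "{e \<in> E \<union> D. i \<in> e} = {e \<in> D. i \<in> e}" "{i, j} \<notin> E" using E that by auto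
    then show ?thesis by (cases "i = j") (simp_all add: lap_mat_def)
  qed
  show "lap_mat (E \<union> D) i j = 0" if "i \<in> V" "j \<in> W"
    using that E[of "{i, j}" j] D[of "{i, j}" i] assms(3) by (auto simp: lap_mat_def)
  show "lap_mat (E \<union> D) i j = 0" if "i \<in> W" "j \<in> V"
    using that E[of "{i, j}" i] D[of "{i, j}" j] assms(3) by (auto simp: lap_mat_def)
qed

text \<open>The source of the recursion of \<open>poly_e\<close> and \<open>poly_b\<close> along
  \<open>Graft\<close>.\<close>

lemma has_eb_join:
  assumes simple: "simple_graph (V, E)" "simple_graph (W, D)" and disj: "V \<inter> W = {}"
    and rv: "r \<in> V" "v \<in> W" and eb: "has_eb V E r (e, b)" "has_eb W D v (e', b')"
  shows "has_eb (V \<union> W) (insert {r, v} (E \<union> D)) r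
    (e * (X * e' + (1 + X) * b') + b * (e' + b'), b * (X * e' + (1 + X) * b'))"
proof -
  let ?m = "lap_mat (E \<union> D)"
  let ?b = "\<lambda>j. unit_row r j - unit_row v j"
  let ?m' = "?m(r := (\<lambda>j. ?m r j + ?b j), v := (\<lambda>j. ?m v j - ?b j))"
  have fin: "finite V" "finite W" "finite E" "finite D" using simple simple_graphD by metis+
  have ne: "r \<noteq> v" using rv disj by auto
  have "{r, v} \<notin> E \<union> D"
    using simple_graphD(2)[OF simple(1), of "{r, v}"] simple_graphD(2)[OF simple(2), of "{r, v}"] rv disj
    by auto
  then have m': "lap_mat (insert {r, v} (E \<union> D)) = ?m'"
    using fin ne by (intro lap_mat_insert_edge) auto
  note un = lap_mat_union[OF simple disj]
  have det: "det_on A ?m = det_on A (lap_mat E)" if "A \<subseteq> V" for A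
    using that un(1) by (intro det_on_cong) auto
  have det': "det_on A ?m = det_on A (lap_mat D)" if "A \<subseteq> W" for A
    using that un(2) by (intro det_on_cong) auto
  have "det_on (V \<union> W) ?m' = det_on V ?m * det_on W ?m + det_on (V - {r}) ?m * det_on W ?m
      + det_on V ?m * det_on (W - {v}) ?m"
    using fin disj rv un by (intro det_on_join) auto
  also have "\<dots> = X * (e + b) * (X * (e' + b')) + b * (X * (e' + b')) + X * (e + b) * b'"
    using eb by (simp add: det det' has_eb_def)
  also have "\<dots> = X * (e * (X * e' + (1 + X) * b') + b * (e' + b') + b * (X * e' + (1 + X) * b'))"
    by (simp add: algebra_simps)
  finally have 1: "det_on (V \<union> W) ?m' = \<dots>" .
  \<comment> \<open>Once \<open>r\<close> is deleted, the new edge survives only as an extra unit on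
    the diagonal at \<open>v\<close>. The determinant splits, and the factor of \<open>W\<close> is
    its full determinant plus the minor at \<open>v\<close>.\<close>
  have "V \<union> W - {r} = (V - {r}) \<union> W" using disj rv by auto
  moreover have "det_on ((V - {r}) \<union> W) ?m' = det_on (V - {r}) ?m' * det_on W ?m'"
    using fin disj rv ne un by (intro det_on_block) auto
  moreover have "det_on (V - {r}) ?m' = b"
  proof -
    have "det_on (V - {r}) ?m' = det_on (V - {r}) ?m"
      using disj rv by (intro det_on_cong) auto
    then show ?thesis using eb by (simp add: det has_eb_def)
  qed
  moreover have "det_on W ?m' = X * (e' + b') + b'"
  proof -
    have "det_on W ?m' = det_on W (?m(v := (\<lambda>j. ?m v j + unit_row v j)))"
      using disj rv by (intro det_on_cong) (auto simp: unit_row_def)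
    also have "\<dots> = det_on W (?m(v := ?m v)) + det_on W (?m(v := unit_row v))"
      using fin rv by (intro det_on_row_add)
    also have "\<dots> = det_on W ?m + det_on (W - {v}) ?m"
      using fin rv by (simp add: det_on_unit_row)
    finally show ?thesis using eb by (simp add: det' has_eb_def)
  qed
  ultimately have "det_on (V \<union> W - {r}) ?m' = b * (X * (e' + b') + b')"
    by (simp only:)
  with 1 show ?thesis
    unfolding has_eb_def m' by (simp add: algebra_simps)
qed

lemma has_eb_singleton: "has_eb {v} {} v (0, 1)"
  by (simp add: has_eb_def lap_mat_def)

lemma has_eb_attach:
  assumes "attach U F r t V E" "simple_graph (U, F)" "r \<in> U" "has_eb U F r p"
  shows "has_eb V E r (fst p * poly_b t + snd p * poly_e t, snd p * poly_b t)"
  using assms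
proof (induction arbitrary: p rule: attach.induct)
  case (attach_Graft U F r s V E v t W D)
  have simple: "simple_graph (V, E)" "r \<in> V" "simple_graph (W, D)" "v \<in> W"
    using attach_Graft attach_simple[of U F r s V E] tree_at_simple[of v t W D] by auto
  have "has_eb V E r (fst p * poly_b s + snd p * poly_e s, snd p * poly_b s)"
    using attach_Graft by blast
  moreover have "has_eb W D v (poly_e t, poly_b t)"
    using attach_Graft.IH(2)[OF simple_graph_singleton singletonI has_eb_singleton] by simp
  ultimately have "has_eb (V \<union> W) (insert {r, v} (E \<union> D)) r
     ((fst p * poly_b s + snd p * poly_e s) * (X * poly_e t + (1 + X) * poly_b t)
        + snd p * poly_b s * (poly_e t + poly_b t),
      snd p * poly_b s * (X * poly_e t + (1 + X) * poly_b t))"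
    by (rule has_eb_join[OF simple(1,3) attach_Graft(3) simple(2,4)])
  then show ?case by (simp add: algebra_simps)
qed simp

lemma has_eb_tree_at: "tree_at t r V E \<Longrightarrow> has_eb V E r (poly_e t, poly_b t)"
  using has_eb_attach[OF _ simple_graph_singleton singletonI has_eb_singleton] by fastforce

lemma path_edges_rev: "path_edges (rev vs) = path_edges vs"
proof (induction vs rule: induct_list012)
  case (3 v w vs)
  have "path_edges (rev (v # w # vs)) = path_edges (rev (w # vs) @ [v])" by simp
  also have "\<dots> = insert {w, v} (path_edges (rev (w # vs)))"
    by (subst path_edges_snoc) (simp_all only: last_rev, simp_all)
  finally show ?case using "3.IH"(2) by (simp add: insert_commute)
qed simp_all

lemma has_eb_path:
  assumes "distinct vs" "vs \<noteq> []"
  shows "has_eb (set vs) (path_edges vs) (hd vs) (path_e (length vs - 1), path_b (length vs - 1))"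
  using has_eb_tree_at[OF tree_at_path[of "hd vs" "tl vs"]] assms by simp

lemma path_edge_iff:
  assumes "distinct vs" "i < length vs" "j < length vs"
  shows "{vs ! i, vs ! j} \<in> path_edges vs \<longleftrightarrow> j = Suc i \<or> i = Suc j"
  using assms by (auto simp: path_edges_def doubleton_eq_iff nth_eq_iff_index_eq)

lemma det_path_corner:
  assumes "distinct vs" "vs \<noteq> []"
  shows "det_on (set vs) ((lap_mat (path_edges vs))(hd vs := unit_row (last vs))) = 1"
  using assms
  by (intro det_on_path_corner) (auto simp: lap_mat_def path_edge_iff nth_eq_iff_index_eq)

lemma simple_graph_path: "distinct vs \<Longrightarrow> vs \<noteq> [] \<Longrightarrow> simple_graph (set vs, path_edges vs)"
  using tree_at_simple(1)[OF tree_at_path[of "hd vs" "tl vs"]] by simp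

text \<open>When the first vertex is deleted, its edge survives as a unit on the diagonal at
  \<open>w\<close>. Expanding there yields the end minor of the remaining path plus its interior
  determinant, which is the recursion \<open>path_e_Suc\<close>.\<close>

lemma det_path_interior:
  assumes "distinct vs" "2 \<le> length vs"
  shows "det_on (set vs - {hd vs, last vs}) (lap_mat (path_edges vs)) = path_e (length vs - 1)"
  using assms
proof (induction vs rule: induct_list012)
  case (3 v w vs)
  let ?V = "set (w # vs)" and ?m = "lap_mat (path_edges (w # vs))"
  have dist: "distinct (w # vs)" "v \<notin> ?V" "v \<noteq> w" using "3.prems" by auto
  show ?case
  proof (cases "vs = []")
    case False
    let ?l = "last vs"
    have l: "?l \<in> set vs" using False by simp
    have simple: "simple_graph (?V, path_edges (w # vs))"
      using dist by (intro simple_graph_path) auto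
    have notin: "{v, w} \<notin> path_edges (w # vs)"
      using path_edges_subset[of "{v, w}" "w # vs"] dist by auto
    have m': "lap_mat (path_edges (v # w # vs)) =
      ?m(v := (\<lambda>j. ?m v j + (unit_row v j - unit_row w j)),
         w := (\<lambda>j. ?m w j - (unit_row v j - unit_row w j)))"
      unfolding path_edges_Cons
      using simple_graphD(4)[OF simple] dist(3) notin by (rule lap_mat_insert_edge)
    have set: "set (v # w # vs) - {hd (v # w # vs), last (v # w # vs)} = ?V - {?l}"
      using dist False l by auto
    have w: "w \<in> ?V - {?l}" using dist l by auto
    have "det_on (?V - {?l}) (lap_mat (path_edges (v # w # vs))) =
        det_on (?V - {?l}) (?m(w := (\<lambda>j. ?m w j + unit_row w j)))"
      unfolding m' using dist by (intro det_on_cong) (auto simp: unit_row_def)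
    also have "\<dots> = det_on (?V - {?l}) (?m(w := ?m w)) + det_on (?V - {?l}) (?m(w := unit_row w))"
      by (rule det_on_row_add[OF _ w]) simp
    also have "det_on (?V - {?l}) (?m(w := unit_row w)) = det_on (?V - {?l} - {w}) ?m"
      by (rule det_on_unit_row[OF _ w]) simp
    also have "?V - {?l} - {w} = set (w # vs) - {hd (w # vs), last (w # vs)}"
      using False by auto
    also have "det_on \<dots> ?m = path_e (length (w # vs) - 1)"
      using "3.IH"(2) dist False by (cases vs) auto
    also have "det_on (?V - {?l}) (?m(w := ?m w)) = path_b (length (w # vs) - 1)"
    proof -
      have "has_eb (set (rev (w # vs))) (path_edges (rev (w # vs))) (hd (rev (w # vs)))
          (path_e (length (rev (w # vs)) - 1), path_b (length (rev (w # vs)) - 1))"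
        by (rule has_eb_path) (use dist in auto)
      then have "has_eb ?V (path_edges (w # vs)) ?l (path_e (length vs), path_b (length vs))"
        unfolding path_edges_rev hd_rev using False by simp
      then show ?thesis by (simp add: has_eb_def)
    qed
    finally show ?thesis unfolding set by (simp add: add.commute)
  qed (use dist in \<open>auto simp: insert_Diff_if\<close>)
qed auto

text \<open>The cycle is a path with joined ends. In the rank one update the two end minors
  contribute \<open>path_b k\<close> each and the two corner determinants 1 each; together they give
  \<open>2 * (path_b k - 1)\<close>, the telescoped sum in \<open>cycle_eb\<close>. With the root
  deleted, the end minor and the interior add up to \<open>path_e (Suc k)\<close>.\<close>

lemma has_eb_cycle:
  assumes "distinct us" "3 \<le> length us"
  shows "has_eb (set us) (cycle_edges us) (hd us) (cycle_eb (length us))"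
proof -
  let ?r = "hd us" and ?s = "last us" and ?V = "set us" and ?m = "lap_mat (path_edges us)"
  obtain k where k: "length us = Suc k" "2 \<le> k" using assms by (cases "length us") auto
  have ne: "us \<noteq> []" using assms by auto
  have nth: "?r = us ! 0" "?s = us ! k" using ne k by (auto simp: hd_conv_nth last_conv_nth)
  have rs: "?r \<noteq> ?s" "{?r, ?s} \<notin> path_edges us"
    unfolding nth using assms(1) k by (auto simp: nth_eq_iff_index_eq path_edge_iff)
  have V: "finite ?V" "?r \<in> ?V" "?s \<in> ?V" using ne by auto
  have eb: "has_eb ?V (path_edges us) ?r (path_e k, path_b k)"
    using has_eb_path[OF assms(1) ne] k by simp
  have eb': "has_eb ?V (path_edges us) ?s (path_e k, path_b k)"
    using has_eb_path[of "rev us"] assms(1) ne k by (simp add: path_edges_rev hd_rev)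
  have m': "lap_mat (cycle_edges us) = ?m(?r := (\<lambda>j. ?m ?r j + (unit_row ?r j - unit_row ?s j)),
         ?s := (\<lambda>j. ?m ?s j - (unit_row ?r j - unit_row ?s j)))"
    unfolding cycle_edges_alt[OF ne]
    by (rule lap_mat_insert_edge[OF simple_graphD(4)[OF simple_graph_path[OF assms(1) ne]] rs])
  have corner: "det_on ?V (?m(?r := unit_row ?s)) = 1" "det_on ?V (?m(?s := unit_row ?r)) = 1"
    using det_path_corner[OF assms(1) ne] det_path_corner[of "rev us"] assms(1) ne
    by (simp_all add: path_edges_rev hd_rev last_rev)
  have "det_on ?V (lap_mat (cycle_edges us)) = X * (path_e k + path_b k) + 2 * (path_b k - 1)"
    unfolding m' det_on_rank_one_update[OF V rs(1)] corner using eb eb' by (simp add: has_eb_def)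
  also have "2 * (path_b k - 1) = X * fst (cycle_eb (Suc k))"
    using X_mult_cycle_eb[of "Suc k"] by simp
  finally have 1: "det_on ?V (lap_mat (cycle_edges us)) =
      X * (fst (cycle_eb (Suc k)) + snd (cycle_eb (Suc k)))"
    by (simp add: cycle_eb_def algebra_simps)
  have s: "?s \<in> ?V - {?r}" using V rs by auto
  have "det_on (?V - {?r}) (lap_mat (cycle_edges us)) =
      det_on (?V - {?r}) (?m(?s := (\<lambda>j. ?m ?s j + unit_row ?s j)))"
    unfolding m' by (intro det_on_cong) (auto simp: unit_row_def)
  also have "\<dots> = det_on (?V - {?r}) (?m(?s := ?m ?s)) + det_on (?V - {?r}) (?m(?s := unit_row ?s))"
    by (rule det_on_row_add[OF _ s]) simp
  also have "det_on (?V - {?r}) (?m(?s := unit_row ?s)) = det_on (?V - {?r} - {?s}) ?m"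
    by (rule det_on_unit_row[OF _ s]) simp
  also have "?V - {?r} - {?s} = ?V - {?r, ?s}" by auto
  also have "det_on (?V - {?r, ?s}) ?m = path_e k"
    using det_path_interior[OF assms(1)] assms(2) k by simp
  finally have "det_on (?V - {?r}) (lap_mat (cycle_edges us)) = snd (cycle_eb (Suc k))"
    using eb by (simp add: has_eb_def cycle_eb_def)
  with 1 show ?thesis by (simp add: has_eb_def k)
qed

text \<open>Substituting -x turns the entries of x I - L into the negatives of those of x I + L, and
  the resulting sign accounts for the alternating signs in \<open>laplacian_coeff\<close>. The
  second part bounds the degree, so that comparing the coefficients up to \<open>n\<close> compares
  all of them.\<close>

lemma laplacian_coeff_det:
  assumes "G \<in> graphs_of_order n"
  shows "k \<le> n \<Longrightarrow> laplacian_coeff G k = coeff (det_on {..<n} (lap_mat (edges G))) (n - k)"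
    and "n < i \<Longrightarrow> coeff (det_on {..<n} (lap_mat (edges G))) i = 0"
proof -
  let ?L = "laplacian G" and ?M = "lap_mat (edges G)"
  let ?D = "det_on {..<n} ?M"
  have n: "card (verts G) = n" using assms by (simp add: graphs_of_order_def)
  have L: "?L \<in> carrier_mat n n"
    by (auto simp: laplacian_def degree_matrix_def adjacency_matrix_def n intro!: minus_carrier_mat)
  have "{j} \<notin> edges G" for j
    using assms by (auto simp: graphs_of_order_def simple_graph_def)
  then have loop: "{j} \<in> edges G \<longleftrightarrow> False" for j by simp
  have entry: "pcompose (char_poly_matrix ?L $$ (i, j)) [:0, - 1:] = - ?M i j" if "i < n" "j < n" for i j
    using that n by (auto simp: loop char_poly_matrix_def laplacian_def degree_matrix_def adjacency_matrix_def
        lap_mat_def X_def vertex_degree_def pcompose_pCons of_nat_poly one_pCons)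
  have "pcompose (char_poly ?L) [:0, - 1:] =
      (\<Sum>p | p permutes {..<n}. of_int (sign p) * (\<Prod>i<n. - ?M i (p i)))"
  proof -
    have "char_poly ?L = (\<Sum>p | p permutes {..<n}. of_int (sign p) *
        (\<Prod>i<n. char_poly_matrix ?L $$ (i, p i)))"
      unfolding char_poly_def det_def'[OF char_poly_matrix_closed[OF L]] by (simp add: atLeast0LessThan)
    also have "pcompose \<dots> [:0, - 1:] = (\<Sum>p | p permutes {..<n}. of_int (sign p) *
        (\<Prod>i<n. pcompose (char_poly_matrix ?L $$ (i, p i)) [:0, - 1:]))"
      unfolding pcompose_sum pcompose_mult pcompose_prod of_int_poly pcompose_const ..
    also have "\<dots> = (\<Sum>p | p permutes {..<n}. of_int (sign p) * (\<Prod>i<n. - ?M i (p i)))"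
    proof (intro sum.cong refl arg_cong2[of _ _ _ _ "(*)"] prod.cong)
      fix p i assume "p \<in> {p. p permutes {..<n}}" "i \<in> {..<n}"
      then have "i < n" "p i < n" using permutes_in_image[of p "{..<n}" i] by auto
      then show "pcompose (char_poly_matrix ?L $$ (i, p i)) [:0, - 1:] = - ?M i (p i)"
        by (rule entry)
    qed
    finally show ?thesis .
  qed
  also have "\<dots> = (- 1) ^ n * ?D"
    by (simp add: prod_uminus det_on_def sum_distrib_left mult_ac)
  finally have eq: "pcompose (char_poly ?L) [:0, - 1:] = (- 1) ^ n * ?D" .
  have coeff: "(- 1) ^ i * coeff (char_poly ?L) i = (- 1) ^ n * coeff ?D i" for i
  proof -
    have "(- 1) ^ n * ?D = Polynomial.smult ((- 1) ^ n) ?D" by (cases "even n") auto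
    then show ?thesis using arg_cong[OF eq, of "\<lambda>p. coeff p i"] by (simp add: coeff_pcompose_linear)
  qed
  show "laplacian_coeff G k = coeff ?D (n - k)" if "k \<le> n"
  proof -
    have "(- 1) ^ (n - k) * coeff (char_poly ?L) (n - k) = (- 1) ^ k * ((- 1) ^ (n - k) * coeff ?D (n - k))"
      using coeff[of "n - k"] that by (metis le_add_diff_inverse mult.assoc power_add)
    then show ?thesis
      unfolding laplacian_coeff_def n by (cases "even (n - k)"; cases "even k") auto
  qed
  have "coeff (char_poly ?L) i = 0" if "n < i"
    using degree_monic_char_poly[OF L] that by (intro coeff_eq_0) auto
  then show "n < i \<Longrightarrow> coeff ?D i = 0" using coeff[of i] by auto
qed

lemma lap_le_iff:
  assumes "G \<in> graphs_of_order n" "H \<in> graphs_of_order n"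
  shows "G \<preceq> H \<longleftrightarrow> nonneg_coeffs (det_on {..<n} (lap_mat (edges H)) - det_on {..<n} (lap_mat (edges G)))"
proof -
  have n: "card (verts G) = n" "card (verts H) = n" using assms by (auto simp: graphs_of_order_def)
  let ?P = "\<lambda>i. coeff (det_on {..<n} (lap_mat (edges G))) i \<le> coeff (det_on {..<n} (lap_mat (edges H))) i"
  have "G \<preceq> H \<longleftrightarrow> (\<forall>k\<le>n. ?P (n - k))"
    unfolding lap_le_def n using laplacian_coeff_det(1)[OF assms(1)] laplacian_coeff_det(1)[OF assms(2)] by simp
  also have "\<dots> \<longleftrightarrow> (\<forall>i\<le>n. ?P i)"
    by (metis diff_diff_cancel diff_le_self)
  also have "\<dots> \<longleftrightarrow> (\<forall>i. ?P i)"
    using laplacian_coeff_det(2)[OF assms(1)] laplacian_coeff_det(2)[OF assms(2)]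
    by (metis not_le order_refl)
  finally show ?thesis by (simp add: nonneg_coeffs_def)
qed

lemma lap_less_iff: "G \<prec> H \<longleftrightarrow> G \<preceq> H \<and> \<not> H \<preceq> G"
  unfolding lap_less_def lap_le_def by (metis not_le)

section \<open>Trees hanging from a cycle\<close>

text \<open>By \<open>tree_on_cycle_isomorphic\<close> and \<open>isomorphic_tree_on_cycle\<close>,
  \<open>g\<close> and \<open>t\<close> fix the graph up to isomorphism, so that questions about the
  class become questions about rooted trees.\<close>

definition tree_on_cycle :: "nat \<Rightarrow> rtree \<Rightarrow> 'a ugraph \<Rightarrow> bool" where
  "tree_on_cycle g t G \<longleftrightarrow> (\<exists>us. length us = g \<and> 3 \<le> g \<and> distinct us \<and>
     attach (set us) (cycle_edges us) (hd us) t (verts G) (edges G))"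

lemma tree_on_cycle_reordering: "s \<approx> t \<Longrightarrow> tree_on_cycle g s G \<longleftrightarrow> tree_on_cycle g t G"
  by (simp add: tree_on_cycle_def attach_reordering)

lemma tree_on_cycle_unicyclic:
  assumes "G \<in> graphs_of_order n" "tree_on_cycle g t G"
  shows "G \<in> unicyclic_graphs1 n (num_leaves t) g" and "n = g + num_edges t"
proof -
  obtain V E where G: "G = (V, E)" by (cases G)
  obtain us where us: "length us = g" "3 \<le> g" "distinct us"
    and att: "attach (set us) (cycle_edges us) (hd us) t V E"
    using assms(2) by (auto simp: tree_on_cycle_def G)
  let ?r = "hd us"
  have len: "3 \<le> length us" using us by simp
  then have ne: "us \<noteq> []" by auto
  then have r: "?r \<in> set us" by simp
  have simple: "simple_graph (set us, cycle_edges us)"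
    using us(3) len by (rule simple_graph_cycle)
  have V: "V = {..<n}" using assms(1) by (simp add: graphs_of_order_def G)
  show "n = g + num_edges t"
    using card_attach[OF att simple r] us by (simp add: V distinct_card)
  have conn: "connected_graph G"
    unfolding G by (rule connected_attach[OF att simple r connected_cycle[OF ne]])
  have cyc: "is_cycle G vs \<longleftrightarrow> is_cycle (set us, cycle_edges us) vs" for vs
    unfolding G by (rule is_cycle_attach[OF att simple r])
  note cyc' = is_cycle_cycle[OF us(3) len]
  have "unicyclic G"
    unfolding unicyclic_def cyc
    using cyc'(1) by (intro ex1I[of _ "cycle_edges us"] exI[of _ us]) (simp, blast dest: cyc'(2))
  moreover have "girth G = g"
    unfolding girth_def cyc
  proof (rule Least_equality)
    show "\<exists>vs. is_cycle (set us, cycle_edges us) vs \<and> length vs = g" using cyc'(1) us(1) by blast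
    show "\<exists>vs. is_cycle (set us, cycle_edges us) vs \<and> length vs = k \<Longrightarrow> g \<le> k" for k
      using us(1) by (elim exE conjE) (drule cyc'(2), simp)
  qed
  moreover have "card (leaves G) = num_leaves t"
  proof -
    have deg: "vertex_degree (A, cycle_edges us) v = 2" if "v \<in> set us" for A v
      unfolding vertex_degree_def snd_conv using us(3) len that by (rule cycle_edges_degree)
    then have "leaves (set us, cycle_edges us) = {}" by (auto simp: leaves_def)
    moreover have "?r \<notin> leaves (V, E)"
      using vertex_degree_attach_root[OF att simple r, of V V] deg[OF r] by (auto simp: leaves_def)
    ultimately show ?thesis
      using leaves_attach[OF att simple r] by (simp add: G)
  qed
  moreover have "\<exists>us Ts. length us = g \<and> cycle_with_trees us Ts G \<and>
       (\<forall>i\<in>{1..<g}. card (verts (Ts ! i)) = 1)"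
  proof -
    obtain V' E' where V': "tree_at t ?r V' E'" "set us \<inter> V' = {?r}" "V = set us \<union> V'"
      "E = cycle_edges us \<union> E'"
      using attach_split[OF att r] by blast
    obtain u ws where ws: "us = u # ws" using ne by (cases us) auto
    define Ts where "Ts = (V', E') # map (\<lambda>u. ({u}, {})) ws"
    have Ts0: "Ts ! 0 = (V', E')" by (simp add: Ts_def)
    have TsS: "Ts ! i = ({us ! i}, {})" if "i < g" "i \<noteq> 0" for i
    proof -
      obtain j where "i = Suc j" using \<open>i \<noteq> 0\<close> by (cases i) auto
      then show ?thesis using that(1) us(1) by (simp add: Ts_def ws)
    qed
    have us0: "us ! 0 = ?r" using ne by (simp add: hd_conv_nth)
    have sing: "is_tree ({v}, {} :: nat set set)" for v :: nat
      by (rule is_tree_tree_at[OF attach_Root])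
    have tree: "is_tree (Ts ! i) \<and> us ! i \<in> verts (Ts ! i)" if "i < g" for i
    proof (cases "i = 0")
      case True
      then show ?thesis
        using is_tree_tree_at[OF V'(1)] tree_at_simple(2)[OF V'(1)] by (simp add: Ts0 us0)
    next
      case False
      then show ?thesis using sing by (simp add: TsS[OF that])
    qed
    have notin: "us ! i \<notin> V'" if "i < g" "i \<noteq> 0" for i
    proof
      assume "us ! i \<in> V'"
      moreover have "us ! i \<in> set us" using that us(1) by simp
      ultimately have "us ! i \<in> set us \<inter> V'" by (rule IntI[rotated])
      then have "us ! i = us ! 0" unfolding V'(2) us0 by simp
      then show False using us that by (simp add: nth_eq_iff_index_eq)
    qed
    have disj: "verts (Ts ! i) \<inter> verts (Ts ! j) = {}" if "i < g" "j < g" "i \<noteq> j" for i j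
    proof -
      consider "i = 0" "j \<noteq> 0" | "i \<noteq> 0" "j = 0" | "i \<noteq> 0" "j \<noteq> 0" using \<open>i \<noteq> j\<close> by metis
      then show ?thesis
      proof cases
        case 1
        then show ?thesis using that Ts0 TsS[of j] notin[of j] by simp
      next
        case 2
        then show ?thesis using that Ts0 TsS[of i] notin[of i] by simp
      next
        case 3
        then show ?thesis using that TsS[of i] TsS[of j] us by (simp add: nth_eq_iff_index_eq)
      qed
    qed
    have "u \<in> V'" using tree_at_simple(2)[OF V'(1)] by (simp add: ws)
    then have "V = (\<Union>T\<in>set Ts. verts T)" unfolding V'(3) by (auto simp: Ts_def ws)
    moreover have "E = cycle_edges us \<union> (\<Union>T\<in>set Ts. edges T)" unfolding V'(4) by (auto simp: Ts_def)
    moreover have "length Ts = length us" by (simp add: Ts_def ws)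
    ultimately have "cycle_with_trees us Ts G"
      using us tree disj unfolding cycle_with_trees_def G by simp
    moreover have "\<forall>i\<in>{1..<g}. card (verts (Ts ! i)) = 1" using TsS by auto
    ultimately show ?thesis using us(1) by blast
  qed
  ultimately show "G \<in> unicyclic_graphs1 n (num_leaves t) g"
    using assms(1) conn by (simp add: unicyclic_graphs1_def unicyclic_graphs_def)
qed

lemma unicyclic_tree_on_cycle:
  assumes "G \<in> unicyclic_graphs1 n l g"
  shows "\<exists>t. tree_on_cycle g t G \<and> num_leaves t = l \<and> n = g + num_edges t"
proof -
  have G: "G \<in> graphs_of_order n" "card (leaves G) = l"
    and ex: "\<exists>us Ts. length us = g \<and> cycle_with_trees us Ts G \<and> (\<forall>i\<in>{1..<g}. card (verts (Ts ! i)) = 1)"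
    using assms by (simp_all add: unicyclic_graphs1_def unicyclic_graphs_def)
  from ex obtain us Ts where us: "length us = g" and cwt: "cycle_with_trees us Ts G"
    and one: "\<forall>i\<in>{1..<g}. card (verts (Ts ! i)) = 1" by blast
  note cwt' = cwt[unfolded cycle_with_trees_def us]
  note c = cwt'[THEN conjunct1] cwt'[THEN conjunct2, THEN conjunct1]
    cwt'[THEN conjunct2, THEN conjunct2, THEN conjunct1]
  note cwt2 = cwt'[THEN conjunct2, THEN conjunct2, THEN conjunct2]
  note tree' = cwt2[THEN conjunct1] and disj' = cwt2[THEN conjunct2, THEN conjunct1]
    and VE = cwt2[THEN conjunct2, THEN conjunct2]
  have tree: "is_tree (Ts ! i) \<and> us ! i \<in> verts (Ts ! i)" if "i < g" for i
    by (rule tree'[THEN spec, THEN mp, OF that])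
  have disj: "verts (Ts ! i) \<inter> verts (Ts ! j) = {}" if "i < g" "j < g" "i \<noteq> j" for i j
    by (rule disj'[THEN spec, THEN mp, OF that(1), THEN spec, THEN mp, OF that(2), THEN mp, OF that(3)])
  have ne: "us \<noteq> []" using us c(1) by auto
  let ?V = "verts (Ts ! 0)" and ?E = "edges (Ts ! 0)"
  have hd: "hd us = us ! 0" using ne by (simp add: hd_conv_nth)
  have "0 < g" using c(1) by simp
  have V0: "is_tree (?V, ?E)" "hd us \<in> ?V" using tree[OF \<open>0 < g\<close>] by (simp_all add: hd)
  from tree_at_decompose[OF V0] obtain t where t: "tree_at t (hd us) ?V ?E" ..
  have only: "x \<in> {hd us}" if x: "x \<in> set us" "x \<in> ?V" for x
  proof -
    from x(1) obtain i where i: "i < g" "x = us ! i" unfolding in_set_conv_nth us by metis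
    have "i = 0"
    proof (rule ccontr)
      assume "i \<noteq> 0"
      then have "verts (Ts ! i) \<inter> ?V = {}" by (rule disj[OF i(1) \<open>0 < g\<close>])
      moreover have "us ! i \<in> verts (Ts ! i) \<inter> ?V" using x(2) i(2) tree[OF i(1)] by simp
      ultimately show False by simp
    qed
    then show ?thesis by (simp add: i(2) hd)
  qed
  have "set us \<inter> ?V = {hd us}"
  proof
    show "set us \<inter> ?V \<subseteq> {hd us}" by (rule subsetI, elim IntE) (rule only)
    show "{hd us} \<subseteq> set us \<inter> ?V" using V0(2) hd_in_set[OF ne] by simp
  qed
  then have att: "attach (set us) (cycle_edges us) (hd us) t (set us \<union> ?V) (cycle_edges us \<union> ?E)"
    by (rule attach_base[OF t])
  have T: "verts (Ts ! i) = {us ! i} \<and> edges (Ts ! i) = {}" if "i < g" "i \<noteq> 0" for i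
  proof
    show V: "verts (Ts ! i) = {us ! i}"
    proof -
      have "card (verts (Ts ! i)) = 1" using one that by simp
      then obtain x where "verts (Ts ! i) = {x}" by (rule card_1_singletonE)
      then show ?thesis using tree[OF that(1)] by simp
    qed
    have simple: "simple_graph (verts (Ts ! i), edges (Ts ! i))"
      using tree[OF that(1)] by (simp add: is_tree_def)
    show "edges (Ts ! i) = {}"
    proof (rule ccontr)
      assume "edges (Ts ! i) \<noteq> {}"
      then obtain e where "e \<in> edges (Ts ! i)" by auto
      then have "e \<subseteq> {us ! i}" "card e = 2" using simple_graphD[OF simple] V by auto
      then show False using card_mono[of "{us ! i}" e] by simp
    qed
  qed
  have split: "(\<Union>T\<in>set Ts. f T) = f (Ts ! 0) \<union> (\<Union>i\<in>{1..<g}. f (Ts ! i))" for f :: "nat ugraph \<Rightarrow> 'b set"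
  proof -
    have "set Ts = (!) Ts ` {..<g}" using c(3) by (auto simp: set_conv_nth)
    also have "{..<g} = insert 0 {1..<g}" using c(1) by auto
    finally show ?thesis by simp
  qed
  have "set us = insert (us ! 0) ((!) us ` {1..<g})"
  proof -
    have "set us = (!) us ` {..<g}" using us by (auto simp: set_conv_nth)
    also have "{..<g} = insert 0 {1..<g}" using c(1) by auto
    finally show ?thesis by simp
  qed
  then have "verts G = set us \<union> ?V"
    unfolding VE[THEN conjunct1] split using T V0(2) hd by auto
  moreover have "edges G = cycle_edges us \<union> ?E"
    unfolding VE[THEN conjunct2] split using T by auto
  ultimately have tc: "tree_on_cycle g t G"
    unfolding tree_on_cycle_def using att us c by auto
  then show ?thesis
    using tree_on_cycle_unicyclic[OF G(1) tc] G(2)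
    by (auto simp: unicyclic_graphs1_def unicyclic_graphs_def)
qed

lemma det_tree_on_cycle:
  assumes "G \<in> graphs_of_order n" "tree_on_cycle g t G"
  shows "det_on {..<n} (lap_mat (edges G)) = X * unicyclic_poly (cycle_eb g) t"
proof -
  have V: "verts G = {..<n}" using assms(1) by (simp add: graphs_of_order_def)
  obtain us where us: "length us = g" "3 \<le> length us" "distinct us"
    and att: "attach (set us) (cycle_edges us) (hd us) t {..<n} (edges G)"
    using assms(2) by (auto simp: tree_on_cycle_def V)
  have "hd us \<in> set us" using us by (intro hd_in_set) auto
  from has_eb_attach[OF att simple_graph_cycle[OF us(3,2)] this has_eb_cycle[OF us(3,2)]]
  show ?thesis
    by (simp add: has_eb_def us(1) unicyclic_poly_def poly_f_def algebra_simps)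
qed

lemma lap_le_tree_on_cycle:
  assumes "G \<in> graphs_of_order n" "tree_on_cycle g s G" "H \<in> graphs_of_order n" "tree_on_cycle g t H"
  shows "G \<preceq> H \<longleftrightarrow>
    nonneg_coeffs (unicyclic_poly (cycle_eb g) t - unicyclic_poly (cycle_eb g) s)"
proof -
  have "det_on {..<n} (lap_mat (edges H)) - det_on {..<n} (lap_mat (edges G)) =
      X * (unicyclic_poly (cycle_eb g) t - unicyclic_poly (cycle_eb g) s)"
    using det_tree_on_cycle[OF assms(1,2)] det_tree_on_cycle[OF assms(3,4)]
    by (simp only: right_diff_distrib)
  then show ?thesis
    using lap_le_iff[OF assms(1,3)] by (simp only: nonneg_coeffs_X_mult_iff)
qed

lemma lap_less_tree_on_cycle:
  assumes "G \<in> graphs_of_order n" "tree_on_cycle g s G" "H \<in> graphs_of_order n" "tree_on_cycle g t H"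
  shows "G \<prec> H \<longleftrightarrow>
    nonneg_coeffs (unicyclic_poly (cycle_eb g) t - unicyclic_poly (cycle_eb g) s) \<and>
    unicyclic_poly (cycle_eb g) s \<noteq> unicyclic_poly (cycle_eb g) t"
  unfolding lap_less_iff lap_le_tree_on_cycle[OF assms] lap_le_tree_on_cycle[OF assms(3,4,1,2)]
  using nonneg_coeffs_antisym by fastforce

lemma path_edges_map: "path_edges (map f vs) = (`) f ` path_edges vs"
  by (induction vs rule: induct_list012) auto

lemma cycle_edges_map: "vs \<noteq> [] \<Longrightarrow> cycle_edges (map f vs) = (`) f ` cycle_edges vs"
  by (simp add: cycle_edges_alt path_edges_map hd_map last_map)

lemma tree_on_cycle_isomorphic:
  assumes "tree_on_cycle g t G" "tree_on_cycle g t H"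
  shows "isomorphic G H"
proof -
  obtain us where us: "length us = g" "3 \<le> length us" "distinct us"
    "attach (set us) (cycle_edges us) (hd us) t (verts G) (edges G)"
    using assms(1) by (auto simp: tree_on_cycle_def)
  obtain vs where vs: "length vs = g" "distinct vs"
    "attach (set vs) (cycle_edges vs) (hd vs) t (verts H) (edges H)"
    using assms(2) by (auto simp: tree_on_cycle_def)
  define f where "f x = the (map_of (zip us vs) x)" for x
  have f: "vs = map f us"
    using us vs by (intro nth_equalityI) (auto simp: f_def map_of_zip_nth)
  have ne: "us \<noteq> []" using us by auto
  have "bij_betw f (set us) (set vs)"
    using vs(2) unfolding f by (simp add: bij_betw_def distinct_map)
  moreover have "cycle_edges vs = (`) f ` cycle_edges us"
    unfolding f by (rule cycle_edges_map[OF ne])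
  moreover have "attach (set vs) (cycle_edges vs) (f (hd us)) t (verts H) (edges H)"
    using vs(3) ne by (simp add: f hd_map)
  ultimately obtain h where "bij_betw h (verts G) (verts H)" "edges H = (`) h ` edges G"
    using attach_isomorphic[OF us(4) _ simple_graph_cycle[OF us(3,2)] hd_in_set[OF ne], of "set vs" "cycle_edges vs" f "verts H" "edges H"]
    by blast
  then show ?thesis unfolding isomorphic_def by blast
qed

lemma isomorphic_tree_on_cycle:
  assumes "isomorphic G H" "simple_graph G" "tree_on_cycle g t H"
  shows "tree_on_cycle g t G"
proof -
  obtain f where f: "bij_betw f (verts G) (verts H)" "edges H = (`) f ` edges G"
    using assms(1) by (auto simp: isomorphic_def)
  obtain us where us: "length us = g" "3 \<le> g" "distinct us"
    "attach (set us) (cycle_edges us) (hd us) t (verts H) (edges H)"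
    using assms(3) by (auto simp: tree_on_cycle_def)
  define h where "h = inv_into (verts G) f"
  have h: "bij_betw h (verts H) (verts G)"
    unfolding h_def using f(1) by (rule bij_betw_inv_into)
  have inj: "inj_on h (verts H)" and img: "h ` verts H = verts G"
    using h by (auto simp: bij_betw_def)
  have hf: "h ` f ` e = e" if "e \<in> edges G" for e
  proof -
    have "e \<subseteq> verts G" using assms(2) that by (simp add: simple_graph_def)
    then have "h (f x) = x" if "x \<in> e" for x
      using that f(1) unfolding h_def by (meson bij_betw_inv_into_left subsetD)
    then show ?thesis by (force simp: image_image)
  qed
  have edges: "(`) h ` edges H = edges G"
    unfolding f(2) image_image[of "(`) h" "(`) f"] using hf by simp
  have ne: "us \<noteq> []" using us by auto
  have "set us \<subseteq> verts H"
    using attach_simple(2)[OF us(4) simple_graph_cycle hd_in_set[OF ne]] us by auto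
  then have "distinct (map h us)"
    using us(3) inj by (auto simp: distinct_map intro: inj_on_subset)
  moreover have "attach (set (map h us)) (cycle_edges (map h us)) (hd (map h us)) t (verts G) (edges G)"
    using attach_image[OF us(4) inj] ne by (simp add: edges img cycle_edges_map hd_map)
  ultimately show ?thesis
    unfolding tree_on_cycle_def using us by (intro exI[of _ "map h us"]) auto
qed

lemma tree_on_cycle_exists:
  assumes "3 \<le> g" "n = g + num_edges t"
  shows "\<exists>G\<in>graphs_of_order n. tree_on_cycle g t G"
proof -
  let ?us = "[0..<g]" and ?V = "insert 0 {g..<n}"
  have "card ?V = Suc (num_edges t)" using assms by simp
  then obtain E where E: "tree_at t 0 ?V E"
    using tree_at_exists[of ?V t 0] by auto
  have hd: "hd ?us = 0" using assms by (simp add: hd_conv_nth)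
  have "attach (set ?us) (cycle_edges ?us) (hd ?us) t (set ?us \<union> ?V) (cycle_edges ?us \<union> E)"
    unfolding hd using assms by (intro attach_base[OF E]) auto
  moreover have V: "set ?us \<union> ?V = {..<n}" using assms by auto
  ultimately have att: "attach (set ?us) (cycle_edges ?us) (hd ?us) t {..<n} (cycle_edges ?us \<union> E)"
    by simp
  have "hd ?us \<in> set ?us" using assms hd by simp
  with attach_simple(1)[OF att simple_graph_cycle] assms
  have "({..<n}, cycle_edges ?us \<union> E) \<in> graphs_of_order n"
    by (simp add: graphs_of_order_def)
  moreover have "tree_on_cycle g t ({..<n}, cycle_edges ?us \<union> E)"
    unfolding tree_on_cycle_def using att assms by (intro exI[of _ ?us]) auto
  ultimately show ?thesis by blast
qed

section \<open>The extremal graphs as trees on a cycle\<close>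

definition legs :: "nat \<Rightarrow> nat \<Rightarrow> nat list" where
  "legs N l = map (\<lambda>i. N div l + (if i < N mod l then 1 else 0)) [0..<l]"

lemma length_legs [simp]: "length (legs N l) = l"
  by (simp add: legs_def)

lemma balanced_legs: "balanced (legs N l)"
  by (auto simp: balanced_def legs_def)

text \<open>\<open>BST\<close> deals its vertices to the legs by residue; hence leg \<open>i\<close>
  has the length recorded at position \<open>i\<close> of \<open>legs N l\<close>.\<close>

lemma length_filter_residue:
  assumes "i < l"
  shows "length (filter (\<lambda>v. (v - s) mod l = i) [s..<s + N]) = N div l + (if i < N mod l then 1 else 0)"
proof (induction N)
  case (Suc N)
  have "N mod l < l" using assms by (intro mod_less_divisor) auto
  with Suc assms show ?case by (auto simp: div_Suc mod_Suc)
qed simp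

definition extremal_tree :: "nat \<Rightarrow> nat \<Rightarrow> nat \<Rightarrow> nat \<Rightarrow> rtree" where
  "extremal_tree n l g q = up q (star (legs (n - g - q) l))"

lemma extremal_graph_tree_on_cycle:
  assumes "3 \<le> g" "0 < l" "g + q \<le> n"
  shows "tree_on_cycle g (extremal_tree n l g q) (extremal_graph n l g q)"
    and "verts (extremal_graph n l g q) = {..<n}"
proof -
  define ws where "ws = 0 # [g..<g + q]"
  define c where "c = last ws"
  define s where "s = g + q"
  define N where "N = n - g - q"
  define L where "L i = filter (\<lambda>v. (v - s) mod l = i) [s..<s + N]" for i
  have ext: "extremal_graph n l g q = ({..<g} \<union> set ws \<union> insert c {s..<s + N},
      cycle_edges [0..<g] \<union> path_edges ws \<union> (\<Union>i<l. path_edges (c # L i)))"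
    by (simp add: extremal_graph_def BST_def Let_def ws_def c_def s_def L_def N_def add.commute)
  have c: "c = 0 \<or> c \<in> {g..<g + q}" "c \<in> set ws" "c < s"
  proof -
    show "c \<in> set ws" unfolding c_def by (rule last_in_set) (simp add: ws_def)
    then show "c = 0 \<or> c \<in> {g..<g + q}" by (auto simp: ws_def)
    then show "c < s" using assms by (auto simp: s_def)
  qed
  have set_concat: "set (concat (map L [0..<l])) = {s..<s + N}"
    using assms(2) by (auto simp: L_def intro!: bexI[of _ "(_ - s) mod l"])
  have "distinct (c # concat (map L [0..<l]))"
  proof -
    have "distinct (concat (map L ks))" if "distinct ks" for ks
      using that by (induction ks) (auto simp: L_def)
    then show ?thesis using set_concat c by auto
  qed
  then have "tree_at (star (map length (map L [0..<l]))) c (insert c (set (concat (map L [0..<l]))))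
      (\<Union>vs\<in>set (map L [0..<l]). path_edges (c # vs))"
    by (rule tree_at_star)
  moreover have "map length (map L [0..<l]) = legs N l"
    using length_filter_residue[of _ l s N] by (simp add: legs_def L_def)
  moreover have "(\<Union>vs\<in>set (map L [0..<l]). path_edges (c # vs)) = (\<Union>i<l. path_edges (c # L i))"
    by (simp add: atLeast0LessThan)
  ultimately have "tree_at (star (legs N l)) (last ws) (insert c {s..<s + N}) (\<Union>i<l. path_edges (c # L i))"
    by (simp only: set_concat c_def)
  then have "tree_at (up (length ws - 1) (star (legs N l))) (hd ws) (set ws \<union> insert c {s..<s + N})
      (path_edges ws \<union> (\<Union>i<l. path_edges (c # L i)))"
  proof (rule tree_at_up)
    show "set ws \<inter> insert c {s..<s + N} = {last ws}"
      unfolding c_def[symmetric] using c(2,3) assms by (auto simp: ws_def s_def)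
  qed (use assms in \<open>auto simp: ws_def\<close>)
  then have tree: "tree_at (extremal_tree n l g q) 0 (set ws \<union> insert c {s..<s + N})
      (path_edges ws \<union> (\<Union>i<l. path_edges (c # L i)))"
    by (simp add: ws_def extremal_tree_def N_def)
  have hd: "hd [0..<g] = 0" using assms by (simp add: hd_conv_nth)
  have "attach (set [0..<g]) (cycle_edges [0..<g]) (hd [0..<g]) (extremal_tree n l g q)
      (set [0..<g] \<union> (set ws \<union> insert c {s..<s + N}))
      (cycle_edges [0..<g] \<union> (path_edges ws \<union> (\<Union>i<l. path_edges (c # L i))))"
    unfolding hd by (rule attach_base[OF tree]) (use c assms in \<open>auto simp: ws_def s_def\<close>)
  then show "tree_on_cycle g (extremal_tree n l g q) (extremal_graph n l g q)"
    unfolding tree_on_cycle_def ext using assms(1)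
    by (intro exI[of _ "[0..<g]"]) (simp add: atLeast0LessThan Un_assoc)
  show "verts (extremal_graph n l g q) = {..<n}"
    unfolding ext using c assms by (auto simp: ws_def s_def N_def)
qed

section \<open>The extremal trees\<close>

text \<open>For \<open>g + q \<le> n\<close>, admissibility says that \<open>q \<le> p\<close>, that is, the average length
  \<open>(n - g - q) / l\<close> of the legs is at least \<open>g + q - 1\<close>.\<close>

definition admissible :: "nat \<Rightarrow> nat \<Rightarrow> nat \<Rightarrow> nat \<Rightarrow> bool" where
  "admissible n l g q \<longleftrightarrow> q * (l + 1) + g + g * l \<le> n + l"

lemma admissible_iff:
  assumes "p = \<lfloor>(real n - real g - real g * real l + real l) / (real l + 1)\<rfloor>"
  shows "admissible n l g q \<longleftrightarrow> int q \<le> p"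
proof -
  have "int q \<le> p \<longleftrightarrow> real q \<le> (real n - real g - real g * real l + real l) / (real l + 1)"
    unfolding assms by (simp add: le_floor_iff)
  also have "\<dots> \<longleftrightarrow> real q * (real l + 1) \<le> real n - real g - real g * real l + real l"
    by (simp add: pos_le_divide_eq)
  also have "\<dots> \<longleftrightarrow> real (q * (l + 1) + g + g * l) \<le> real (n + l)"
    by (simp add: algebra_simps)
  finally show ?thesis unfolding admissible_def of_nat_le_iff by simp
qed

lemma admissibleD:
  assumes "admissible n l g q" "0 < l" "3 \<le> g"
  shows "g + q + (g + q - 1) * l \<le> n"
proof -
  obtain h where h: "g = Suc h" using assms(3) by (cases g) auto
  show ?thesis using assms(1) by (simp add: admissible_def h algebra_simps)
qed

lemma admissible_mono: "admissible n l g q \<Longrightarrow> q' \<le> q \<Longrightarrow> admissible n l g q'"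
  unfolding admissible_def by (meson add_le_mono1 le_trans mult_le_mono1)

lemma sum_list_legs [simp]: "0 < l \<Longrightarrow> sum_list (legs N l) = N"
proof -
  assume "0 < l"
  have "sum_list (legs N l) = (\<Sum>i<l. N div l + (if i < N mod l then 1 else 0))"
    by (simp add: legs_def interv_sum_list_conv_sum_set_nat atLeast0LessThan)
  also have "\<dots> = l * (N div l) + card {i. i < l \<and> i < N mod l}"
    by (simp add: sum.distrib sum.If_cases Int_def)
  also have "{i. i < l \<and> i < N mod l} = {..<N mod l}"
    using mod_less_divisor[OF \<open>0 < l\<close>, of N] by auto
  finally show ?thesis by simp
qed

lemma legs_ge: "0 < l \<Longrightarrow> k * l \<le> N \<Longrightarrow> a \<in> set (legs N l) \<Longrightarrow> k \<le> a"
proof -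
  assume *: "0 < l" "k * l \<le> N" "a \<in> set (legs N l)"
  then have "k \<le> N div l" by (simp add: less_eq_div_iff_mult_less_eq)
  with *(3) show "k \<le> a" by (auto simp: legs_def)
qed

lemma num_edges_extremal_tree:
  "0 < l \<Longrightarrow> g + q \<le> n \<Longrightarrow> g + num_edges (extremal_tree n l g q) = n"
  by (simp add: extremal_tree_def)

lemma num_leaves_extremal_tree:
  assumes "admissible n l g q" "0 < l" "3 \<le> g"
  shows "num_leaves (extremal_tree n l g q) = l"
proof -
  have "1 * l \<le> (g + q - 1) * l" using assms(3) by (intro mult_le_mono1) simp
  then have "1 * l \<le> n - g - q" using admissibleD[OF assms] by linarith
  then have "0 \<notin> set (legs (n - g - q) l)"
    using legs_ge[OF assms(2), of 1 "n - g - q" 0] by auto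
  then have "num_leaves (star (legs (n - g - q) l)) = l"
    by (simp add: num_leaves_star)
  moreover have "star (legs (n - g - q) l) \<noteq> Root"
    using calculation assms(2) by auto
  ultimately show ?thesis by (simp add: extremal_tree_def num_leaves_up)
qed

abbreviation extremal_poly :: "nat \<Rightarrow> nat \<Rightarrow> nat \<Rightarrow> nat \<Rightarrow> real poly" where
  "extremal_poly n l g q \<equiv> unicyclic_poly (cycle_eb g) (extremal_tree n l g q)"

text \<open>Admissibility of \<open>Suc q\<close> gives the legs for \<open>q\<close> more than
  \<open>l * (g + q)\<close> edges in total, so a longest leg is \<open>Suc a\<close> with
  \<open>g + q \<le> a\<close>. Shortening it by one edge keeps the list balanced, and by
  \<open>mset_balanced\<close> the result is the list of legs for \<open>Suc q\<close> up to order.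
  The step is thus exactly the slide of \<open>unicyclic_poly_lengthen_tail\<close>.\<close>

lemma extremal_poly_step:
  assumes "admissible n l g (Suc q)" "2 \<le> l" "3 \<le> g"
  shows "extremal_poly n l g q < extremal_poly n l g (Suc q)"
    and "coeff (extremal_poly n l g (Suc q)) 1 < coeff (extremal_poly n l g q) 1"
proof -
  define N where "N = n - g - q"
  define A where "A = Max (set (legs N l))"
  have l: "0 < l" using assms by simp
  have le: "Suc (g + q) + (g + q) * l \<le> n"
    using admissibleD[OF assms(1) l assms(3)] by simp
  have ne: "legs N l \<noteq> []" using l by (metis length_0_conv length_legs less_numeral_extra(3))
  have A: "A \<in> set (legs N l)" "\<And>a. a \<in> set (legs N l) \<Longrightarrow> a \<le> A"
    using ne by (auto simp: A_def)
  have "\<not> A \<le> g + q"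
  proof
    assume "A \<le> g + q"
    then have "sum_list (map (\<lambda>a. a) (legs N l)) \<le> sum_list (map (\<lambda>_. g + q) (legs N l))"
      using A(2) by (intro sum_list_mono) (auto intro: order_trans)
    then have "N \<le> l * (g + q)" using l by (simp add: sum_list_triv)
    then show False using le by (simp add: N_def mult.commute)
  qed
  then obtain a where a: "A = Suc a" "g + q \<le> a" by (cases A) auto
  let ?bs = "remove1 A (legs N l)"
  have ms: "mset (legs N l) = mset (Suc a # ?bs)" using A(1) a(1) by simp
  have len: "length ?bs = l - 1" using A(1) by (simp add: length_remove1)
  have bs: "?bs \<noteq> []" using len assms(2) by (metis One_nat_def Suc_1 diff_is_0_eq length_0_conv not_less_eq_eq)
  have sub: "b \<in> set (legs N l)" if "b \<in> set ?bs" for b by (rule subsetD[OF set_remove1_subset that])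
  have zero: "0 \<notin> set ?bs"
  proof
    assume "0 \<in> set ?bs"
    then have "A \<le> 0 + 1" using sub A(1) balanced_legs[of N l] unfolding balanced_def by blast
    then show False using a assms(3) by simp
  qed
  have sum: "sum_list ?bs + A = N"
    using ms sum_list_legs[OF l, of N] a by (metis add.commute sum_list.Cons sum_mset_sum_list)
  have "balanced (a # ?bs)"
  proof -
    have "A \<le> b + 1 \<and> b \<le> A" if "b \<in> set ?bs" for b
      using sub[OF that] A balanced_legs[of N l] unfolding balanced_def by blast
    moreover have "b \<le> c + 1" if "b \<in> set ?bs" "c \<in> set ?bs" for b c
      using sub[OF that(1)] sub[OF that(2)] balanced_legs[of N l] unfolding balanced_def by blast
    ultimately show ?thesis using a(1) by (fastforce simp: balanced_def)
  qed
  then have "mset (a # ?bs) = mset (legs (n - g - Suc q) l)"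
    using len sum a l assms(2) by (intro mset_balanced balanced_legs) (auto simp: N_def)
  then have 2: "extremal_poly n l g (Suc q) = unicyclic_poly (cycle_eb g) (up (Suc q) (star (a # ?bs)))"
    unfolding extremal_tree_def
    by (intro unicyclic_poly_reordering reordering_up star_reordering) simp
  have 1: "extremal_poly n l g q = unicyclic_poly (cycle_eb g) (up q (star (Suc a # ?bs)))"
    unfolding extremal_tree_def N_def[symmetric]
    by (intro unicyclic_poly_reordering reordering_up star_reordering ms)
  show "extremal_poly n l g q < extremal_poly n l g (Suc q)"
    "coeff (extremal_poly n l g (Suc q)) 1 < coeff (extremal_poly n l g q) 1"
    unfolding 1 2 by (rule unicyclic_poly_lengthen_tail[OF assms(3) bs zero a(2)])+
qed

lemma extremal_poly_strict:
  assumes "q < q'" "admissible n l g q'" "2 \<le> l" "3 \<le> g"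
  shows "extremal_poly n l g q < extremal_poly n l g q' \<and>
    coeff (extremal_poly n l g q') 1 < coeff (extremal_poly n l g q) 1"
  using assms(1,2)
proof (induction rule: less_Suc_induct)
  case (1 q)
  then show ?case using extremal_poly_step assms by blast
next
  case (2 i j k)
  then show ?case using admissible_mono[of n l g k j] by (auto intro: less_trans)
qed

text \<open>Coefficientwise domination implies domination in the order by leading coefficients and
  at coefficient 1. By \<open>extremal_poly_strict\<close>, the former excludes
  \<open>q < q'\<close> and the latter \<open>q' < q\<close>.\<close>

lemma extremal_poly_antichain:
  assumes "admissible n l g q" "admissible n l g q'" "2 \<le> l" "3 \<le> g"
    and nn: "nonneg_coeffs (extremal_poly n l g q - extremal_poly n l g q')"
  shows "q = q'"
proof (rule ccontr)
  assume "q \<noteq> q'"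
  then consider "q < q'" | "q' < q" by linarith
  then show False
  proof cases
    case 1
    then show False
      using extremal_poly_strict[OF 1 assms(2-4)] nonneg_coeffs_imp_nonneg[OF nn] by simp
  next
    case 2
    have "0 \<le> coeff (extremal_poly n l g q - extremal_poly n l g q') 1"
      using nn by (simp only: nonneg_coeffs_def)
    with extremal_poly_strict[OF 2 assms(1,3,4)] show False by simp
  qed
qed

text \<open>With a single leg, tail and leg form one path, so the graphs for different
  \<open>q\<close> are isomorphic. This is why the number of minimal elements is asserted for
  \<open>l \<ge> 2\<close>.\<close>

lemma extremal_tree_one_leg:
  assumes "g + q \<le> n" shows "extremal_tree n (Suc 0) g q = path (n - g)"
  using assms by (simp add: extremal_tree_def legs_def up_up)

section \<open>Minimal elements of the class\<close>

lemma not_minimalI: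
  assumes G: "G \<in> unicyclic_graphs1 n l g" "tree_on_cycle g t G"
    and t': "g + num_edges t' = n" "num_leaves t' = l"
    and nn: "nonneg_coeffs (unicyclic_poly (cycle_eb g) t - unicyclic_poly (cycle_eb g) t')"
    and ne: "unicyclic_poly (cycle_eb g) t' \<noteq> unicyclic_poly (cycle_eb g) t"
  shows "G \<notin> minimal_elements (unicyclic_graphs1 n l g)"
proof -
  have "3 \<le> g" using G(2) by (auto simp: tree_on_cycle_def)
  then obtain H where H: "H \<in> graphs_of_order n" "tree_on_cycle g t' H"
    using tree_on_cycle_exists[of g n t'] t'(1) by auto
  have "H \<in> unicyclic_graphs1 n l g"
    using tree_on_cycle_unicyclic(1)[OF H] t'(2) by simp
  moreover have "G \<in> graphs_of_order n"
    using G(1) by (simp add: unicyclic_graphs1_def unicyclic_graphs_def)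
  then have "H \<prec> G" using lap_less_tree_on_cycle[OF H _ G(2)] nn ne by simp
  ultimately show ?thesis by (auto simp: minimal_elements_def)
qed

text \<open>Strictness comes from b alone: its change is multiplied by the first component of
  \<open>cycle_eb g\<close>, which is g (g - 1) at 0 and hence nonzero.\<close>

lemma improves_unicyclic_poly:
  assumes "improves s t" "2 \<le> g"
  shows "nonneg_coeffs (unicyclic_poly (cycle_eb g) t - unicyclic_poly (cycle_eb g) s)"
    and "unicyclic_poly (cycle_eb g) s \<noteq> unicyclic_poly (cycle_eb g) t"
proof -
  let ?p = "fst (cycle_eb g) * (poly_b t - poly_b s)" and ?q = "snd (cycle_eb g) * (poly_f t - poly_f s)"
  have eq: "unicyclic_poly (cycle_eb g) t - unicyclic_poly (cycle_eb g) s = ?p + ?q"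
    by (simp add: unicyclic_poly_def algebra_simps)
  have nn: "nonneg_coeffs ?p" "nonneg_coeffs ?q"
    using assms(1) by (auto simp: improves_def)
  then show "nonneg_coeffs (unicyclic_poly (cycle_eb g) t - unicyclic_poly (cycle_eb g) s)"
    unfolding eq by (rule nonneg_coeffs_add)
  have "fst (cycle_eb g) \<noteq> 0"
    using cycle_eb_at_0(1)[of g] assms(2) by auto
  then have "?p \<noteq> 0" using assms(1) by (simp add: improves_def)
  then have "unicyclic_poly (cycle_eb g) t - unicyclic_poly (cycle_eb g) s \<noteq> 0"
    unfolding eq using nonneg_coeffs_add_eq_0_iff[OF nn] by simp
  then show "unicyclic_poly (cycle_eb g) s \<noteq> unicyclic_poly (cycle_eb g) t" by auto
qed

lemma minimal_imp_extremal:
  assumes min: "G \<in> minimal_elements (unicyclic_graphs1 n l g)"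
    and l: "0 < l" and g: "3 \<le> g" and ok: "admissible n l g 0"
  shows "\<exists>q. admissible n l g q \<and> tree_on_cycle g (extremal_tree n l g q) G"
proof -
  have G: "G \<in> unicyclic_graphs1 n l g" using min by (simp add: minimal_elements_def)
  then obtain t where t: "tree_on_cycle g t G" "num_leaves t = l" "n = g + num_edges t"
    using unicyclic_tree_on_cycle by blast
  have "irreducible_tree t"
    unfolding irreducible_tree_def
  proof
    assume "\<exists>s. improves s t"
    then obtain s where s: "improves s t" ..
    have "g + num_edges s = n" "num_leaves s = l" using s t by (auto simp: improves_def)
    from not_minimalI[OF G t(1) this] improves_unicyclic_poly[OF s] g min show False by simp
  qed
  then consider k where "t \<approx> path k" | q as where "t \<approx> up q (star as)" "2 \<le> length as" "0 \<notin> set as" "balanced as"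
    using irreducible_tree_cases by blast
  then show ?thesis
  proof cases
    case (1 k)
    have "min k 1 = l" "k = n - g"
      using t num_leaves_reordering[OF 1] num_edges_reordering[OF 1] by (auto simp: num_leaves_up)
    then have "l = 1" "extremal_tree n l g 0 = path k"
      using l t(3) extremal_tree_one_leg[of g 0 n] by auto
    moreover have "tree_on_cycle g (path k) G"
      using t(1) tree_on_cycle_reordering[OF 1, of g G] by simp
    ultimately show ?thesis using ok by (intro exI[of _ 0]) simp
  next
    case (2 q as)
    have nr: "star as \<noteq> Root" using num_leaves_star[OF 2(3)] 2(2) by auto
    have len: "length as = l"
      using t(2) num_leaves_reordering[OF 2(1)] num_leaves_star[OF 2(3)] nr by (simp add: num_leaves_up)
    have sum: "n = g + (q + sum_list as)"
      using t(3) num_edges_reordering[OF 2(1)] by simp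
    have "admissible n l g q"
    proof (rule ccontr)
      assume no: "\<not> admissible n l g q"
      \<comment> \<open>Admissibility of 0 excludes \<open>q = 0\<close>, so the tail has an edge to
        give away.\<close>
      with ok obtain q' where q: "q = Suc q'" by (cases q) auto
      \<comment> \<open>If all \<open>l\<close> legs had length at least \<open>g + q'\<close>, the
        edge count would make \<open>Suc q'\<close> admissible.\<close>
      have "\<exists>a\<in>set as. a < g + q'"
      proof (rule ccontr)
        assume "\<not> ?thesis"
        then have "sum_list (map (\<lambda>_. g + q') as) \<le> sum_list (map (\<lambda>a. a) as)"
          by (intro sum_list_mono) auto
        then have "l * (g + q') \<le> sum_list as" by (simp add: sum_list_triv len)
        then show False using no sum by (simp add: admissible_def q algebra_simps)
      qed
      then obtain a where a: "a \<in> set as" "a < g + q'" by blast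
      have "2 \<le> g" using g by simp
      from unicyclic_poly_shorten_tail[OF this 2(2,3) a] obtain t' where t':
        "num_edges t' = Suc q' + sum_list as" "num_leaves t' = length as"
        "nonneg_coeffs (unicyclic_poly (cycle_eb g) (up (Suc q') (star as)) - unicyclic_poly (cycle_eb g) t')"
        "unicyclic_poly (cycle_eb g) t' \<noteq> unicyclic_poly (cycle_eb g) (up (Suc q') (star as))"
        by blast
      have "tree_on_cycle g (up (Suc q') (star as)) G"
        using t(1) unfolding tree_on_cycle_reordering[OF 2(1)] q .
      from not_minimalI[OF G this _ _ t'(3,4)] t'(1,2) sum q len min show False by simp
    qed
    moreover have "mset as = mset (legs (n - g - q) l)"
      using 2 len sum l by (intro mset_balanced balanced_legs) auto
    then have "t \<approx> extremal_tree n l g q"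
      unfolding extremal_tree_def
      using 2(1) reordering_up[OF star_reordering] reordering_trans by blast
    ultimately show ?thesis using t(1) tree_on_cycle_reordering by blast
  qed
qed

lemma lap_le_trans: "G \<preceq> H \<Longrightarrow> H \<preceq> K \<Longrightarrow> G \<preceq> K"
  unfolding lap_le_def by (metis order_trans)

lemma lap_less_trans: "G \<prec> H \<Longrightarrow> H \<prec> K \<Longrightarrow> G \<prec> K"
  unfolding lap_less_iff using lap_le_trans by metis

lemma exists_minimal_below:
  assumes "finite S" "H \<in> S" "H \<prec> G"
  shows "\<exists>K\<in>minimal_elements S. K \<prec> G"
proof -
  define r where "r = {(K, H). K \<in> S \<and> H \<in> S \<and> K \<prec> H}"
  have r: "(K, L) \<in> r \<longleftrightarrow> K \<in> S \<and> L \<in> S \<and> K \<prec> L" for K L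
    by (simp only: r_def mem_Collect_eq case_prod_conv)
  have "r \<subseteq> S \<times> S" by (rule subrelI) (simp add: r)
  then have "finite r" using assms(1) by (meson finite_SigmaI finite_subset)
  moreover have "trans r"
  proof (rule transI)
    fix x y z assume "(x, y) \<in> r" "(y, z) \<in> r"
    then show "(x, z) \<in> r" unfolding r using lap_less_trans[of x y z] by (elim conjE, intro conjI)
  qed
  moreover have "irrefl r"
    by (rule irreflI) (simp add: r lap_less_iff)
  ultimately have "finite r" "acyclic r" by (simp_all only: acyclic_irrefl trancl_id)
  then have "wf r" by (rule finite_acyclic_wf)
  moreover have "H \<in> {K \<in> S. K \<prec> G}" using assms by simp
  ultimately obtain K where K: "K \<in> {K \<in> S. K \<prec> G}" "\<And>L. (L, K) \<in> r \<Longrightarrow> L \<notin> {K \<in> S. K \<prec> G}"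
    by (rule wfE_min) (rule that)
  have "\<not> L \<prec> K" if "L \<in> S" for L
  proof
    assume "L \<prec> K"
    moreover from this have "L \<prec> G" using K(1) lap_less_trans[of L K G] by simp
    ultimately show False using K(1) K(2)[of L] that by (simp add: r)
  qed
  with K(1) show ?thesis unfolding minimal_elements_def by blast
qed

lemma finite_graphs_of_order: "finite (graphs_of_order n)"
proof (rule finite_subset)
  show "graphs_of_order n \<subseteq> {{..<n}} \<times> Pow (Pow {..<n})"
    by (fastforce simp: graphs_of_order_def simple_graph_def)
qed simp

lemma extremal_imp_minimal:
  assumes G: "G \<in> graphs_of_order n" "tree_on_cycle g (extremal_tree n l g q) G"
    and l: "0 < l" and g: "3 \<le> g" and ok: "admissible n l g q"
  shows "G \<in> minimal_elements (unicyclic_graphs1 n l g)"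
proof -
  let ?S = "unicyclic_graphs1 n l g"
  have GS: "G \<in> ?S"
    using tree_on_cycle_unicyclic(1)[OF G] num_leaves_extremal_tree[OF ok l g] by simp
  have sub: "?S \<subseteq> graphs_of_order n"
    by (auto simp: unicyclic_graphs1_def unicyclic_graphs_def)
  have "\<not> H \<prec> G" if "H \<in> ?S" for H
  proof
    assume "H \<prec> G"
    from exists_minimal_below[OF finite_subset[OF sub finite_graphs_of_order] that this]
    obtain K where K: "K \<in> minimal_elements ?S" "K \<prec> G" by (rule bexE)
    then have KS: "K \<in> graphs_of_order n" using sub by (auto simp: minimal_elements_def)
    obtain q' where q': "admissible n l g q'" "tree_on_cycle g (extremal_tree n l g q') K"
      using minimal_imp_extremal[OF K(1) l g] admissible_mono[OF ok] by blast
    have less: "nonneg_coeffs (extremal_poly n l g q - extremal_poly n l g q')"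
      "extremal_poly n l g q' \<noteq> extremal_poly n l g q"
      using K(2) lap_less_tree_on_cycle[OF KS q'(2) G] by auto
    show False
    \<comment> \<open>For \<open>l = 1\<close> all candidates have the same polynomial, so none is
      strictly below another; for \<open>l \<ge> 2\<close> the antichain property forces
      \<open>q = q'\<close>.\<close>
    proof (cases "l = 1")
      case True
      have "g + q \<le> n" "g + q' \<le> n" using admissibleD[OF _ l g] ok q'(1) by fastforce+
      then show False using less(2) by (simp add: True extremal_tree_one_leg)
    next
      case False
      then have "q = q'" using extremal_poly_antichain[OF ok q'(1) _ g less(1)] l by simp
      then show False using less(2) by simp
    qed
  qed
  with GS show ?thesis by (auto simp: minimal_elements_def)
qed

lemma isomorphic_extremal_graph_iff:
  assumes "G \<in> graphs_of_order n" "admissible n l g q" "0 < l" "3 \<le> g"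
  shows "isomorphic G (extremal_graph n l g q) \<longleftrightarrow> tree_on_cycle g (extremal_tree n l g q) G"
proof -
  have "g + q \<le> n" using admissibleD[OF assms(2-4)] by simp
  then have ext: "tree_on_cycle g (extremal_tree n l g q) (extremal_graph n l g q)"
    using assms(3,4) by (intro extremal_graph_tree_on_cycle)
  moreover have "simple_graph G" using assms(1) by (simp add: graphs_of_order_def)
  ultimately show ?thesis
    using isomorphic_tree_on_cycle tree_on_cycle_isomorphic by metis
qed

theorem theorem3p3:
  fixes n l g :: nat and p :: int
  assumes "n > 0" and "l > 0" and "g \<ge> 3"
    and "p = \<lfloor>(real n - real g - real g * real l + real l) / (real l + 1)\<rfloor>"
    and "p \<ge> 0"
  shows "minimal_elements (unicyclic_graphs1 n l g) =
           {G \<in> graphs_of_order n. \<exists>q. int q \<le> p \<and> isomorphic G (extremal_graph n l g q)} \<and>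
         (l \<ge> 2 \<longrightarrow>
           int (card (iso_classes (minimal_elements (unicyclic_graphs1 n l g)))) = p + 1)"
proof -
  let ?M = "minimal_elements (unicyclic_graphs1 n l g)"
  have adm: "admissible n l g q \<longleftrightarrow> int q \<le> p" for q
    using assms(4) by (rule admissible_iff)
  have adm0: "admissible n l g 0" unfolding adm using assms(5) by simp
  have order: "G \<in> graphs_of_order n" if "G \<in> ?M" for G
    using that by (simp add: minimal_elements_def unicyclic_graphs1_def unicyclic_graphs_def)
  have M: "G \<in> ?M \<longleftrightarrow> G \<in> graphs_of_order n \<and>
      (\<exists>q. admissible n l g q \<and> tree_on_cycle g (extremal_tree n l g q) G)" for G
    using order minimal_imp_extremal[OF _ assms(2,3) adm0] extremal_imp_minimal[OF _ _ assms(2,3)]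
    by metis
  have 1: "?M = {G \<in> graphs_of_order n. \<exists>q. int q \<le> p \<and> isomorphic G (extremal_graph n l g q)}"
  proof (rule Set.set_eqI)
    fix G
    show "G \<in> ?M \<longleftrightarrow> G \<in> {G \<in> graphs_of_order n. \<exists>q. int q \<le> p \<and> isomorphic G (extremal_graph n l g q)}"
      unfolding M mem_Collect_eq adm[symmetric]
      using isomorphic_extremal_graph_iff[OF _ _ assms(2,3)] by metis
  qed
  have 2: "int (card (iso_classes ?M)) = p + 1" if l: "l \<ge> 2"
  proof -
    define K where "K q = {G \<in> graphs_of_order n. tree_on_cycle g (extremal_tree n l g q) G}" for q
    have K: "G \<in> K q \<longleftrightarrow> G \<in> graphs_of_order n \<and> tree_on_cycle g (extremal_tree n l g q) G" for G q
      by (simp only: K_def mem_Collect_eq)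
    \<comment> \<open>The classes are separated by their polynomials: a graph in both
      \<open>K q\<close> and \<open>K q'\<close> would make the two extremal polynomials equal,
      against the antichain property.\<close>
    have unique: "q = q'" if "admissible n l g q" "admissible n l g q'" "G \<in> K q" "G \<in> K q'" for G q q'
    proof -
      have "X * extremal_poly n l g q = X * extremal_poly n l g q'"
        using det_tree_on_cycle[of G n g] that(3,4) unfolding K by metis
      then have "extremal_poly n l g q - extremal_poly n l g q' = 0" by simp
      then show ?thesis
        using extremal_poly_antichain[OF that(1,2) l assms(3)] nonneg_coeffs_0 by metis
    qed
    have nonempty: "\<exists>G. G \<in> K q" if "admissible n l g q" for q
    proof -
      have "g + q \<le> n" using admissibleD[OF that assms(2,3)] by simp
      then show ?thesis
        using tree_on_cycle_exists[OF assms(3), of n "extremal_tree n l g q"]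
          num_edges_extremal_tree[OF assms(2), of g q n] unfolding K by metis
    qed
    have iso_class: "{(G, H). G \<in> ?M \<and> H \<in> ?M \<and> isomorphic G H} `` {G} = K q"
      if "admissible n l g q" "G \<in> K q" for G q
    proof (rule Set.set_eqI)
      fix H
      have G: "G \<in> ?M" using that unfolding K M by blast
      have "H \<in> ?M \<and> isomorphic G H \<longleftrightarrow> H \<in> K q"
      proof
        assume H: "H \<in> ?M \<and> isomorphic G H"
        then obtain q' where q': "admissible n l g q'" "H \<in> K q'" unfolding M K by blast
        have "simple_graph G" using that(2) by (simp add: K graphs_of_order_def)
        then have "G \<in> K q'"
          using q'(2) H that(2) isomorphic_tree_on_cycle unfolding K by metis
        then show "H \<in> K q" using unique[OF that(1) q'(1) that(2)] q'(2) by simp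
      next
        assume "H \<in> K q"
        then show "H \<in> ?M \<and> isomorphic G H"
          using that tree_on_cycle_isomorphic unfolding K M by metis
      qed
      then show "H \<in> {(G, H). G \<in> ?M \<and> H \<in> ?M \<and> isomorphic G H} `` {G} \<longleftrightarrow> H \<in> K q"
        using G by (simp only: Image_singleton_iff mem_Collect_eq case_prod_conv simp_thms)
    qed
    have "iso_classes ?M = K ` {q. admissible n l g q}"
    proof
      show "iso_classes ?M \<subseteq> K ` {q. admissible n l g q}"
      proof
        fix C assume "C \<in> iso_classes ?M"
        then obtain G where G: "G \<in> ?M" "C = {(G, H). G \<in> ?M \<and> H \<in> ?M \<and> isomorphic G H} `` {G}"
          unfolding iso_classes_def by (rule quotientE)
        then obtain q where "admissible n l g q" "G \<in> K q" unfolding M K by blast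
        with G(2) show "C \<in> K ` {q. admissible n l g q}"
          unfolding iso_class[OF \<open>admissible n l g q\<close> \<open>G \<in> K q\<close>] by simp
      qed
      show "K ` {q. admissible n l g q} \<subseteq> iso_classes ?M"
      proof
        fix C assume "C \<in> K ` {q. admissible n l g q}"
        then obtain q where q: "C = K q" "admissible n l g q" by blast
        then obtain G where G: "G \<in> K q" using nonempty by blast
        then have "G \<in> ?M" using q(2) unfolding K M by blast
        then show "C \<in> iso_classes ?M"
          unfolding q(1) iso_class[OF q(2) G, symmetric] iso_classes_def by (rule quotientI)
      qed
    qed
    moreover have "inj_on K {q. admissible n l g q}"
    proof (rule inj_onI)
      fix q q' assume "q \<in> {q. admissible n l g q}" "q' \<in> {q. admissible n l g q}" "K q = K q'"
      then show "q = q'" using unique[of q q'] nonempty[of q] by (metis mem_Collect_eq)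
    qed
    moreover have "{q. admissible n l g q} = {..nat p}"
      using assms(5) by (auto simp: adm nat_le_iff le_nat_iff)
    ultimately show ?thesis using assms(5) by (simp add: card_image)
  qed
  show ?thesis using 1 2 by blast
qed

end
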